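(* Let $C\subseteq\{Fa,Fu\}$. For every normal distributive $\nabla$-algebra $\mathcal{A}$ satisfying the conditions in $C$, there exist a semi-dynamic ring $\mathcal{R}\in\mathfrak{R}(C)$ and an injective $\nabla$-algebra morphism $i:\mathcal{A}\to\mathfrak{Al}(\mathcal{R})$.
   Context: \textbf{$\nabla$-algebras.} A $\nabla$-algebra is $(\mathsf{A},\nabla,\to)$ with $\mathsf{A}$ a bounded lattice and $\nabla c\wedge a\le b$ iff $c\le a\to b$. It is: - distributive if $\mathsf{A}$ is; - normal if $\nabla1=1$ and $\nabla(a\wedge b)=\nabla a\wedge\nabla b$; - faithful (Fa) if $\nabla$ is surjective; - full (Fu) if $a\mapsto1\to a$ is surjective. A $\nabla$-algebra morphism is a bounded lattice homomorphism preserving $\nabla$ and $\to$. \textbf{Rings.} For a commutative unital ring $R$: - $\langle A\rangle$ is the generated ideal. - $Rad(I)=\{x\mid\exists n,x^n\in I\}$ and $\mathcal{RI}(R)$ is the lattice of radical ideals. - $[J:I]=\{x\mid\forall y\in I,xy\in J\}$. - $Spec(R)$ is the space of prime ideals with topology generated by $\{P\mid r\notin P\}$. - $\mathcal{I}(U)=\{r\mid\forall P\notin U,r\in P\}$ and $\mathcal{U}(I)=\{P\mid\exists x\in I,x\notin P\}$ are inverse isomorphisms between $\mathcal{O}(Spec(R))$ and $\mathcal{RI}(R)$. - For continuous $F:Spec(R)\to Spec(S)$, $\hat F=\mathcal{I}\circ F^{-1}\circ\mathcal{U}:\mathcal{RI}(S)\to\mathcal{RI}(R)$. - For a ring homomorphism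 $\pi:R\to S$, $\pi_*(I)=Rad(\langle\pi[I]\rangle)$. \textbf{Semi-dynamic rings.} A semi-dynamic ring is $\mathcal{R}=(R,S,\pi,f)$ with $R,S$ commutative unital rings, $\pi:R\to S$ a ring homomorphism and $f:Spec(R)\to Spec(S)$ a homeomorphism with inverse $g$. It is: - faithful if for every $s\in S$ there are $r_1,\dots,r_k\in R$ and $m\ge0$ with $s\mid\pi(r_i)$ for all $i$ and $s^m=\sum_is_i\pi(r_i)$ for some $s_i\in S$; - full if for all $A\cup\{r\}\subseteq R$, $\pi(r)\in\langle\pi[A]\rangle$ implies $r^n\in\langle A\rangle$ for some $n\ge0$. $\mathfrak{R}(C)$ is the class of semi-dynamic rings satisfying the conditions in $C$. $\mathfrak{Al}(\mathcal{R})$ is the $\nabla$-algebra $(\mathcal{RI}(R),\nabla,\to)$ with $\nabla I=\hat f(\pi_*(I))$ and $I\to J=\pi^{-1}(\hat g([J:I]))$. *)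

theory Defs
  imports
    "HOL-Algebra.Lattice"
    "HOL-Algebra.Divisibility"
    "HOL-Algebra.Ideal"
    "HOL-Analysis.Function_Topology"
begin

section \<open>Nabla-algebras\<close>

record 'a nabla_algebra = "'a gorder" +
  nabla :: "'a \<Rightarrow> 'a" (\<open>\<nabla>\<index>\<close>)
  nimp :: "'a \<Rightarrow> 'a \<Rightarrow> 'a" (infixr \<open>\<leadsto>\<index>\<close> 60)

locale nabla_algebra = bounded_lattice A for A (structure) +
  assumes nabla_closed: "a \<in> carrier A \<Longrightarrow> \<nabla> a \<in> carrier A"
    and nimp_closed: "\<lbrakk>a \<in> carrier A; b \<in> carrier A\<rbrakk> \<Longrightarrow> a \<leadsto> b \<in> carrier A"
    and residuation: "\<lbrakk>a \<in> carrier A; b \<in> carrier A; c \<in> carrier A\<rbrakk> \<Longrightarrow>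
      \<nabla> c \<sqinter> a \<sqsubseteq> b \<longleftrightarrow> c \<sqsubseteq> a \<leadsto> b"

locale distributive_nabla_algebra = nabla_algebra +
  assumes meet_join_distrib: "\<lbrakk>a \<in> carrier A; b \<in> carrier A; c \<in> carrier A\<rbrakk> \<Longrightarrow>
      a \<sqinter> (b \<squnion> c) = (a \<sqinter> b) \<squnion> (a \<sqinter> c)"

locale normal_nabla_algebra = nabla_algebra +
  assumes nabla_top: "\<nabla> \<top> = \<top>"
    and nabla_meet: "\<lbrakk>a \<in> carrier A; b \<in> carrier A\<rbrakk> \<Longrightarrow> \<nabla> (a \<sqinter> b) = \<nabla> a \<sqinter> \<nabla> b"

definition faithful_nabla_algebra :: "('a, 'm) nabla_algebra_scheme \<Rightarrow> bool" where
  "faithful_nabla_algebra A \<longleftrightarrow> (\<lambda>a. \<nabla>\<^bsub>A\<^esub> a) ` carrier A = carrier A"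

definition full_nabla_algebra :: "('a, 'm) nabla_algebra_scheme \<Rightarrow> bool" where
  "full_nabla_algebra A \<longleftrightarrow> (\<lambda>a. \<top>\<^bsub>A\<^esub> \<leadsto>\<^bsub>A\<^esub> a) ` carrier A = carrier A"

definition nabla_algebra_morphism ::
  "('a, 'm) nabla_algebra_scheme \<Rightarrow> ('b, 'n) nabla_algebra_scheme \<Rightarrow> ('a \<Rightarrow> 'b) \<Rightarrow> bool" where
  "nabla_algebra_morphism A B h \<longleftrightarrow>
     nabla_algebra A \<and> nabla_algebra B \<and>
     h \<in> carrier A \<rightarrow> carrier B \<and>
     h \<bottom>\<^bsub>A\<^esub> = \<bottom>\<^bsub>B\<^esub> \<and> h \<top>\<^bsub>A\<^esub> = \<top>\<^bsub>B\<^esub> \<and>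
     (\<forall>a \<in> carrier A. \<forall>b \<in> carrier A.
        h (a \<sqinter>\<^bsub>A\<^esub> b) = h a \<sqinter>\<^bsub>B\<^esub> h b \<and>
        h (a \<squnion>\<^bsub>A\<^esub> b) = h a \<squnion>\<^bsub>B\<^esub> h b \<and>
        h (a \<leadsto>\<^bsub>A\<^esub> b) = h a \<leadsto>\<^bsub>B\<^esub> h b) \<and>
     (\<forall>a \<in> carrier A. h (\<nabla>\<^bsub>A\<^esub> a) = \<nabla>\<^bsub>B\<^esub> (h a))"


section \<open>Radical ideals and the prime spectrum\<close>

definition Rad :: "('r, 'm) ring_scheme \<Rightarrow> 'r set \<Rightarrow> 'r set" where
  "Rad R I = {x \<in> carrier R. \<exists>n::nat. x [^]\<^bsub>R\<^esub> n \<in> I}"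

definition radical_ideals :: "('r, 'm) ring_scheme \<Rightarrow> 'r set set" where
  "radical_ideals R = {I. ideal I R \<and> Rad R I = I}"

definition ideal_quotient :: "('r, 'm) ring_scheme \<Rightarrow> 'r set \<Rightarrow> 'r set \<Rightarrow> 'r set" where
  "ideal_quotient R J I = {x \<in> carrier R. \<forall>y \<in> I. x \<otimes>\<^bsub>R\<^esub> y \<in> J}"

definition Spec :: "('r, 'm) ring_scheme \<Rightarrow> 'r set set" where
  "Spec R = {P. primeideal P R}"

definition zariski :: "('r, 'm) ring_scheme \<Rightarrow> 'r set topology" where
  "zariski R = topology_generated_by ((\<lambda>r. {P \<in> Spec R. r \<notin> P}) ` carrier R)"

lemma topspace_zariski: "topspace (zariski R) = Spec R"
proof -
  have "\<one>\<^bsub>R\<^esub> \<in> carrier R \<and> \<one>\<^bsub>R\<^esub> \<notin> P" if "P \<in> Spec R" for P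
  proof -
    interpret primeideal P R using that by (simp add: Spec_def)
    show ?thesis using I_notcarr one_imp_carrier by auto
  qed
  then show ?thesis by (auto simp: zariski_def)
qed

definition ideal_of_open :: "('r, 'm) ring_scheme \<Rightarrow> 'r set set \<Rightarrow> 'r set" where
  "ideal_of_open R U = {r \<in> carrier R. \<forall>P \<in> Spec R. P \<notin> U \<longrightarrow> r \<in> P}"

definition open_of_ideal :: "('r, 'm) ring_scheme \<Rightarrow> 'r set \<Rightarrow> 'r set set" where
  "open_of_ideal R I = {P \<in> Spec R. \<exists>x \<in> I. x \<notin> P}"

definition spec_hat ::
  "('r, 'm) ring_scheme \<Rightarrow> ('s, 'n) ring_scheme \<Rightarrow> ('r set \<Rightarrow> 's set) \<Rightarrow> 's set \<Rightarrow> 'r set" where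
  "spec_hat R S F I = ideal_of_open R {P \<in> Spec R. F P \<in> open_of_ideal S I}"

definition push_ideal :: "('s, 'n) ring_scheme \<Rightarrow> ('r \<Rightarrow> 's) \<Rightarrow> 'r set \<Rightarrow> 's set" where
  "push_ideal S p I = Rad S (Idl\<^bsub>S\<^esub> (p ` I))"


section \<open>Semi-dynamic rings\<close>

record ('r, 's) semi_dynamic_ring =
  dom_ring :: "'r ring"
  cod_ring :: "'s ring"
  ring_map :: "'r \<Rightarrow> 's"
  spec_map :: "'r set \<Rightarrow> 's set"

definition semi_dynamic_ring :: "('r, 's) semi_dynamic_ring \<Rightarrow> bool" where
  "semi_dynamic_ring D \<longleftrightarrow>
     cring (dom_ring D) \<and> cring (cod_ring D) \<and>
     ring_map D \<in> ring_hom (dom_ring D) (cod_ring D) \<and>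
     homeomorphic_map (zariski (dom_ring D)) (zariski (cod_ring D)) (spec_map D)"

definition spec_map_inv :: "('r, 's) semi_dynamic_ring \<Rightarrow> 's set \<Rightarrow> 'r set" where
  "spec_map_inv D = inv_into (Spec (dom_ring D)) (spec_map D)"

lemma homeomorphic_maps_spec_map_inv:
  assumes "semi_dynamic_ring D"
  shows "homeomorphic_maps (zariski (dom_ring D)) (zariski (cod_ring D)) (spec_map D) (spec_map_inv D)"
proof -
  obtain g where g: "homeomorphic_maps (zariski (dom_ring D)) (zariski (cod_ring D)) (spec_map D) g"
    using assms by (auto simp: semi_dynamic_ring_def homeomorphic_map_maps)
  have inj: "inj_on (spec_map D) (Spec (dom_ring D))"
    using g by (metis homeomorphic_maps_def inj_on_inverseI topspace_zariski)
  have "spec_map_inv D P = g P" if P: "P \<in> Spec (cod_ring D)" for P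
  proof -
    have "g P \<in> Spec (dom_ring D)" "spec_map D (g P) = P"
      using g P by (auto simp: homeomorphic_maps_def continuous_map_def topspace_zariski)
    then show ?thesis
      using inj unfolding spec_map_inv_def by (metis inv_into_f_f)
  qed
  then show ?thesis
    using g by (intro homeomorphic_maps_eq[OF g]) (auto simp: topspace_zariski)
qed

definition faithful_sdr :: "('r, 's) semi_dynamic_ring \<Rightarrow> bool" where
  "faithful_sdr D \<longleftrightarrow>
     (let R = dom_ring D; S = cod_ring D; p = ring_map D in
      \<forall>s \<in> carrier S. \<exists>(k::nat) (r :: nat \<Rightarrow> 'r) (m::nat).
        (\<forall>i \<in> {1..k}. r i \<in> carrier R \<and> s divides\<^bsub>S\<^esub> p (r i)) \<and>
        (\<exists>t \<in> {1..k} \<rightarrow> carrier S. s [^]\<^bsub>S\<^esub> m = (\<Oplus>\<^bsub>S\<^esub>i \<in> {1..k}. t i \<otimes>\<^bsub>S\<^esub> p (r i))))"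

definition full_sdr :: "('r, 's) semi_dynamic_ring \<Rightarrow> bool" where
  "full_sdr D \<longleftrightarrow>
     (let R = dom_ring D; S = cod_ring D; p = ring_map D in
      \<forall>A r. A \<subseteq> carrier R \<longrightarrow> r \<in> carrier R \<longrightarrow>
        p r \<in> Idl\<^bsub>S\<^esub> (p ` A) \<longrightarrow> (\<exists>n::nat. r [^]\<^bsub>R\<^esub> n \<in> Idl\<^bsub>R\<^esub> A))"

definition Al :: "('r, 's) semi_dynamic_ring \<Rightarrow> 'r set nabla_algebra" where
  "Al D =
     (let R = dom_ring D; S = cod_ring D; p = ring_map D; f = spec_map D; g = spec_map_inv D in
      \<lparr>carrier = radical_ideals R,
       eq = (=),
       le = (\<subseteq>),
       nabla = (\<lambda>I. spec_hat R S f (push_ideal S p I)),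
       nimp = (\<lambda>I J. {x \<in> carrier R. p x \<in> spec_hat S R g (ideal_quotient R J I)})\<rparr>)"


section \<open>The conditions \<open>Fa\<close> and \<open>Fu\<close>\<close>

datatype condition = Fa | Fu

definition nabla_algebra_satisfies ::
  "('a, 'm) nabla_algebra_scheme \<Rightarrow> condition set \<Rightarrow> bool" where
  "nabla_algebra_satisfies A C \<longleftrightarrow>
     (Fa \<in> C \<longrightarrow> faithful_nabla_algebra A) \<and> (Fu \<in> C \<longrightarrow> full_nabla_algebra A)"

definition sdr_class :: "condition set \<Rightarrow> ('r, 's) semi_dynamic_ring set" where
  "sdr_class C =
     {D. semi_dynamic_ring D \<and> (Fa \<in> C \<longrightarrow> faithful_sdr D) \<and> (Fu \<in> C \<longrightarrow> full_sdr D)}"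

text \<open>
  HOL cannot quantify existentially over types, so the rings that represent a nabla-algebra
  over \<open>'a\<close> are sought with carriers in one type depending on \<open>'a\<close> only. This type is infinite
  and, with \<open>\<kappa> = |'a| + \<aleph>\<^sub>0\<close>, has cardinality \<open>2\<close> to the power \<open>2\<close> to the power \<open>\<kappa>\<close>; it therefore
  contains a copy of every ring of functions from the set of prime filters (or of subsets) of the
  algebra to a ring of at most that cardinality \<open>2\<close> to the power \<open>\<kappa>\<close>.
\<close>

type_synonym 'a ring_universe = "('a + nat) set set"

end

theory Submission
  imports Defs "HOL-Library.Poly_Mapping" "HOL-Library.Multiset_Order"
    "HOL-Computational_Algebra.Fraction_Field" "HOL-Computational_Algebra.Polynomial"
    "HOL-Algebra.Weak_Morphisms"
begin

text \<open>
  A simplified form of Hochster's construction. Let \<open>K\<close> be the field of rational functions in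
  variables \<open>t\<^bsub>(a,n)\<^esub>\<close> with \<open>a \<in> A\<close> and \<open>n\<close> a natural number; call \<open>t\<^bsub>(a,n)\<^esub>\<close> active at a prime
  filter \<open>P\<close> of \<open>A\<close> if \<open>\<nabla>\<^sup>n a \<in> P\<close>. The ring \<open>R\<close> consists of the \<open>K\<close>-valued functions \<open>r\<close> on the
  prime filters that depend on finitely many elements of \<open>A\<close> only and satisfy the following: for
  \<open>P \<subseteq> Q\<close> the value \<open>r Q\<close> is integral, with residue \<open>r P\<close>, for the Gauss valuation that gives
  weight \<open>1\<close> to the variables active at \<open>Q\<close> but not at \<open>P\<close> and weight \<open>0\<close> to the others. The set
  \<open>{P. r P \<noteq> 0}\<close> is then a clopen up-set, so it is given by an element \<open>d r\<close> of \<open>A\<close>. The valuations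
  of a fixed nonzero element of \<open>K\<close> are bounded independently of \<open>P\<close> and \<open>Q\<close>, so \<open>d r \<le> d s\<close>
  implies that \<open>s\<close> divides a power of \<open>r\<close>. Hence radical ideals of \<open>R\<close> correspond to
  lattice ideals of \<open>A\<close>, and \<open>a \<mapsto> {r. d r \<le> a}\<close> is the embedding. Composition with \<open>P \<mapsto> \<nabla>\<^sup>-\<^sup>1 P\<close> followed by the
  shift \<open>t\<^bsub>(a,n)\<^esub> \<mapsto> t\<^bsub>(a,n+1)\<^esub>\<close> is a ring endomorphism \<open>\<pi>\<close> with \<open>d (\<pi> r) = \<nabla> (d r)\<close>, so the
  semi-dynamic ring \<open>(R, R, \<pi>, id)\<close> does the job.
\<close>

section \<open>Rational functions and their specializations\<close>

text \<open>A copy of an arbitrary type that carries some linear order: the integral domain instance of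
  \<^typ>\<open>'m \<Rightarrow>\<^sub>0 int\<close> needs one on the variables.\<close>

typedef 'a ordered_copy = "UNIV :: 'a set" ..

lemma ex_linear_order: "\<exists>r. linear_order (r :: 'a rel)"
  using well_ordering[where 'a = 'a] by (auto simp: well_order_on_def)

definition copy_rel :: "'a rel" where
  "copy_rel = (SOME r. linear_order r)"

lemma linear_order_copy_rel: "linear_order copy_rel"
  unfolding copy_rel_def by (rule someI_ex[OF ex_linear_order])

instantiation ordered_copy :: (type) linorder
begin

definition less_eq_ordered_copy :: "'a ordered_copy \<Rightarrow> 'a ordered_copy \<Rightarrow> bool" where
  "x \<le> y \<longleftrightarrow> (Rep_ordered_copy x, Rep_ordered_copy y) \<in> copy_rel"

definition less_ordered_copy :: "'a ordered_copy \<Rightarrow> 'a ordered_copy \<Rightarrow> bool" where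
  "(x :: 'a ordered_copy) < y \<longleftrightarrow> x \<le> y \<and> \<not> y \<le> x"

instance
proof
  have lin: "linear_order (copy_rel :: 'a rel)"
    by (rule linear_order_copy_rel)
  fix x y z :: "'a ordered_copy"
  show "(x < y) = (x \<le> y \<and> \<not> y \<le> x)"
    by (rule less_ordered_copy_def)
  show "x \<le> x"
    using lin by (auto simp: less_eq_ordered_copy_def order_on_defs refl_on_def)
  show "x \<le> z" if "x \<le> y" "y \<le> z"
    using lin that unfolding less_eq_ordered_copy_def order_on_defs by (meson transD)
  show "x = y" if "x \<le> y" "y \<le> x"
    using lin that unfolding less_eq_ordered_copy_def order_on_defs
    by (meson antisymD Rep_ordered_copy_inject)
  show "x \<le> y \<or> y \<le> x"
  proof (cases "x = y")
    case True
    then show ?thesis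
      using lin by (auto simp: less_eq_ordered_copy_def order_on_defs refl_on_def)
  next
    case False
    then show ?thesis
      using lin by (auto simp: less_eq_ordered_copy_def order_on_defs total_on_def
          Rep_ordered_copy_inject)
  qed
qed

end

section \<open>Additive extension from monomials to polynomials\<close>

text \<open>The extension is a ring homomorphism if \<open>h\<close> is multiplicative. General
  \<open>h\<close> are allowed because extracting one coefficient after scaling is an instance
  too.\<close>

definition expand :: "('m \<Rightarrow> 'c::comm_ring_1) \<Rightarrow> ('m \<Rightarrow>\<^sub>0 int) \<Rightarrow> 'c" where
  "expand h f = (\<Sum>m\<in>Poly_Mapping.keys f. of_int (Poly_Mapping.lookup f m) * h m)"

lemma expand_superset:
  assumes "finite M" "Poly_Mapping.keys f \<subseteq> M"
  shows "expand h f = (\<Sum>m\<in>M. of_int (Poly_Mapping.lookup f m) * h m)"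
  unfolding expand_def using assms
  by (intro sum.mono_neutral_left) (auto simp: in_keys_iff)

lemma expand_zero [simp]: "expand h 0 = 0"
  by (simp add: expand_def)

lemma expand_single: "expand h (Poly_Mapping.single m c) = of_int c * h m"
  by (simp add: expand_def)

lemma expand_add: "expand h (f + g) = expand h f + expand h g"
proof -
  let ?M = "Poly_Mapping.keys f \<union> Poly_Mapping.keys g"
  have "Poly_Mapping.keys (f + g) \<subseteq> ?M"
    by (rule Poly_Mapping.keys_add)
  then show ?thesis
    by (simp add: expand_superset[of ?M] lookup_add distrib_right sum.distrib)
qed

lemma expand_sum: "expand h (\<Sum>i\<in>I. f i) = (\<Sum>i\<in>I. expand h (f i))"
  by (induction I rule: infinite_finite_induct) (simp_all add: expand_add)

lemma sum_single_keys: "(\<Sum>m\<in>Poly_Mapping.keys f. Poly_Mapping.single m (Poly_Mapping.lookup f m)) = f"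
  by (rule poly_mapping_eqI) (simp add: lookup_sum lookup_single when_def in_keys_iff)

lemma expand_mult:
  fixes f g :: "'m::comm_monoid_add \<Rightarrow>\<^sub>0 int"
  assumes h: "\<And>m n. h (m + n) = h m * h n"
  shows "expand h (f * g) = expand h f * expand h g"
proof -
  have "f * g = (\<Sum>m\<in>Poly_Mapping.keys f. \<Sum>n\<in>Poly_Mapping.keys g. Poly_Mapping.single (m + n) (Poly_Mapping.lookup f m * Poly_Mapping.lookup g n))"
    by (subst (1) sum_single_keys[of f, symmetric], subst (1) sum_single_keys[of g, symmetric])
      (simp add: sum_product mult_single)
  then show ?thesis
    by (simp add: expand_sum expand_single h)
      (simp add: expand_def sum_product algebra_simps)
qed

lemma expand_one:
  fixes h :: "'m::comm_monoid_add \<Rightarrow> 'c::comm_ring_1"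
  assumes "h 0 = 1" shows "expand h 1 = 1"
  using assms by (simp flip: single_one add: expand_single)

lemma expand_of_int:
  fixes h :: "'m::comm_monoid_add \<Rightarrow> 'c::comm_ring_1"
  assumes "h 0 = 1" shows "expand h (of_int c) = of_int c"
proof -
  have "(of_int c :: 'm \<Rightarrow>\<^sub>0 int) = Poly_Mapping.single 0 c"
    using single_of_int[of c, where ?'b = int, symmetric] by simp
  then show ?thesis
    using assms by (simp add: expand_single)
qed

section \<open>Polynomials in arbitrarily many variables: weights and renaming\<close>

type_synonym 'v mpoly = "'v multiset \<Rightarrow>\<^sub>0 int"

text \<open>The substitution \<open>t\<^sub>v \<mapsto> z t\<^sub>v\<close> for \<open>v \<in> S\<close>. The exponent of \<open>z\<close> is the order
  along \<open>S\<close>, and the lowest coefficient is the leading form.\<close>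

definition scale_vars :: "'v::linorder set \<Rightarrow> 'v mpoly \<Rightarrow> 'v mpoly poly" where
  "scale_vars S = expand (\<lambda>m. monom (Poly_Mapping.single m 1) (size (filter_mset (\<lambda>v. v \<in> S) m)))"

definition rename_vars :: "('v \<Rightarrow> 'w) \<Rightarrow> 'v mpoly \<Rightarrow> 'w::linorder mpoly" where
  "rename_vars \<phi> = expand (\<lambda>m. Poly_Mapping.single (image_mset \<phi> m) 1)"

lemma of_int_mult_single: "of_int c * Poly_Mapping.single m (1::int) = (Poly_Mapping.single (m :: 'm::comm_monoid_add) c)"
  by (metis single_of_int mult_single add_0 mult.right_neutral of_int_eq_id id_apply)

lemma scale_vars_zero [simp]: "scale_vars S 0 = 0"
  and scale_vars_one [simp]: "scale_vars S 1 = 1"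
  and scale_vars_add: "scale_vars S (f + g) = scale_vars S f + scale_vars S g"
  and scale_vars_mult: "scale_vars S (f * g) = scale_vars S f * scale_vars S g"
  unfolding scale_vars_def
  by (simp_all add: expand_add expand_mult expand_one mult_single mult_monom monom_0 one_pCons)

lemma scale_vars_uminus: "scale_vars S (- f) = - scale_vars S f"
  by (metis add.right_inverse add_eq_0_iff scale_vars_add scale_vars_zero)

lemma scale_vars_power: "scale_vars S (f ^ n) = scale_vars S f ^ n"
  by (induction n) (simp_all add: scale_vars_mult)

lemma scale_vars_of_int: "scale_vars S (of_int c) = of_int c"
  unfolding scale_vars_def by (rule expand_of_int) (simp add: monom_0 one_pCons)

lemma scale_vars_sum: "scale_vars S (\<Sum>i\<in>I. f i) = (\<Sum>i\<in>I. scale_vars S (f i))"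
  unfolding scale_vars_def by (rule expand_sum)

lemma scale_vars_single:
  "scale_vars S (Poly_Mapping.single m 1) = monom (Poly_Mapping.single m 1) (size (filter_mset (\<lambda>v. v \<in> S) m))"
  by (simp add: scale_vars_def expand_single)

lemma of_int_mult_coeff: "coeff (of_int c * p) n = of_int c * coeff p n"
  by (simp add: of_int_poly)

text \<open>Extracting a coefficient is additive, so it passes under \<open>expand\<close>, where it
  selects the monomials of weight \<open>n\<close>.\<close>

lemma coeff_scale_vars:
  "coeff (scale_vars S f) n =
    expand (\<lambda>m. if size (filter_mset (\<lambda>v. v \<in> S) m) = n then Poly_Mapping.single m 1 else 0) f"
  unfolding scale_vars_def expand_def
  by (simp add: coeff_sum of_int_mult_coeff cong: if_cong)

text \<open>Scaling leaves each monomial intact inside the coefficient, so terms of equal weight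
  cannot cancel. Every monomial of \<open>f\<close> therefore bounds the order of \<open>f\<close>
  along every \<open>S\<close>.\<close>

lemma coeff_scale_vars_nonzero:
  assumes "m \<in> Poly_Mapping.keys f"
  shows "coeff (scale_vars S f) (size (filter_mset (\<lambda>v. v \<in> S) m)) \<noteq> 0"
proof -
  let ?d = "\<lambda>m. size (filter_mset (\<lambda>v. v \<in> S) m)"
  have "coeff (scale_vars S f) (?d m)
      = (\<Sum>k\<in>Poly_Mapping.keys f. if ?d k = ?d m then Poly_Mapping.single k (Poly_Mapping.lookup f k) else 0)"
    by (simp add: coeff_scale_vars expand_def of_int_mult_single if_distrib cong: if_cong)
  then have "Poly_Mapping.lookup (coeff (scale_vars S f) (?d m)) m =
      (\<Sum>k\<in>Poly_Mapping.keys f. Poly_Mapping.lookup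
        (if ?d k = ?d m then Poly_Mapping.single k (Poly_Mapping.lookup f k) else 0) m)"
    by (simp only: lookup_sum)
  also have "\<dots> = (\<Sum>k\<in>Poly_Mapping.keys f. if k = m then Poly_Mapping.lookup f m else 0)"
    by (rule sum.cong) (auto simp: lookup_single when_def)
  also have "\<dots> = Poly_Mapping.lookup f m"
    using assms by simp
  finally show ?thesis
    using assms by (auto simp: in_keys_iff)
qed

lemma rename_vars_zero [simp]: "rename_vars \<phi> 0 = 0"
  and rename_vars_one [simp]: "rename_vars \<phi> 1 = 1"
  and rename_vars_add: "rename_vars \<phi> (f + g) = rename_vars \<phi> f + rename_vars \<phi> g"
  and rename_vars_mult: "rename_vars \<phi> (f * g) = rename_vars \<phi> f * rename_vars \<phi> g"
  unfolding rename_vars_def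
  by (simp_all add: expand_add expand_mult expand_one mult_single)

lemma rename_vars_single: "rename_vars \<phi> (Poly_Mapping.single m 1) = Poly_Mapping.single (image_mset \<phi> m) 1"
  by (simp add: rename_vars_def expand_single)

lemma rename_vars_of_int: "rename_vars \<phi> (of_int c) = of_int c"
  unfolding rename_vars_def by (rule expand_of_int) simp

lemma rename_vars_sum: "rename_vars \<phi> (\<Sum>i\<in>I. f i) = (\<Sum>i\<in>I. rename_vars \<phi> (f i))"
  unfolding rename_vars_def by (rule expand_sum)

text \<open>An injective renaming sends distinct monomials to distinct monomials, so nothing
  cancels.\<close>

lemma rename_vars_eq_0_iff:
  assumes "inj \<phi>"
  shows "rename_vars \<phi> f = 0 \<longleftrightarrow> f = 0"
proof
  assume 0: "rename_vars \<phi> f = 0"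
  have inj: "inj (image_mset \<phi>)"
    using assms by (rule multiset.inj_map)
  have "Poly_Mapping.lookup f m = 0" for m
  proof (rule ccontr)
    assume "Poly_Mapping.lookup f m \<noteq> 0"
    have "Poly_Mapping.lookup (rename_vars \<phi> f) (image_mset \<phi> m)
        = (\<Sum>k\<in>Poly_Mapping.keys f. if k = m then Poly_Mapping.lookup f m else 0)"
      unfolding rename_vars_def expand_def of_int_mult_single lookup_sum lookup_single
      using inj by (auto simp: when_def inj_eq intro!: sum.cong)
    also have "\<dots> = Poly_Mapping.lookup f m"
      by (simp add: in_keys_iff)
    finally show False
      using 0 \<open>Poly_Mapping.lookup f m \<noteq> 0\<close> by simp
  qed
  then show "f = 0"
    by (intro poly_mapping_eqI) simp
qed simp

lemma filter_image_mset_vimage: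
  "size (filter_mset (\<lambda>w. w \<in> S) (image_mset \<phi> m)) = size (filter_mset (\<lambda>v. v \<in> \<phi> -` S) m)"
  by (induction m) auto

text \<open>A renamed monomial has as many factors in \<open>S\<close> as the original one has in
  the preimage of \<open>S\<close>.\<close>

lemma coeff_scale_vars_rename:
  "coeff (scale_vars S (rename_vars \<phi> f)) n = rename_vars \<phi> (coeff (scale_vars (\<phi> -` S) f) n)"
proof -
  have "scale_vars S (rename_vars \<phi> f)
      = expand (\<lambda>m. scale_vars S (Poly_Mapping.single (image_mset \<phi> m) 1)) f"
    unfolding rename_vars_def expand_def
    by (simp add: scale_vars_sum scale_vars_mult scale_vars_of_int)
  then show ?thesis
    by (simp add: scale_vars_single filter_image_mset_vimage coeff_scale_vars)
      (simp add: expand_def coeff_sum of_int_mult_coeff rename_vars_sum rename_vars_mult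
        rename_vars_of_int rename_vars_single if_distrib[of "rename_vars \<phi>"] cong: if_cong)
qed

section \<open>Variables in the field of fractions\<close>

definition var :: "'v \<Rightarrow> 'v::linorder mpoly fract" where
  "var v = Fract (Poly_Mapping.single {#v#} 1) 1"

lemma var_nonzero: "var v \<noteq> 0"
proof -
  have "Poly_Mapping.lookup (Poly_Mapping.single {#v#} (1::int)) {#v#} \<noteq> 0"
    by simp
  then have "Poly_Mapping.single {#v#} (1::int) \<noteq> 0"
    by (metis lookup_zero)
  then show ?thesis
    by (simp add: var_def Zero_fract_def eq_fract)
qed

lemma var_power: "var v ^ n = Fract (Poly_Mapping.single (replicate_mset n v) 1) 1"
  by (induction n) (simp_all add: var_def One_fract_def mult_single flip: single_one)

text \<open>Both coefficients are positive, so the sum survives even if the two powers coincide.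
  This will realize joins of supports by sums.\<close>

lemma var_power_add_nonzero: "var v ^ m + var w ^ n \<noteq> 0"
proof -
  let ?f = "Poly_Mapping.single (replicate_mset m v) (1::int) + Poly_Mapping.single (replicate_mset n w) 1"
  have "Poly_Mapping.lookup ?f (replicate_mset m v) \<noteq> 0"
    by (simp add: lookup_add lookup_single when_def)
  then have "?f \<noteq> 0"
    by (metis lookup_zero)
  then show ?thesis
    by (simp add: var_power Zero_fract_def eq_fract)
qed

section \<open>Gauss valuations and their residues\<close>

text \<open>\<open>residue S x y\<close> says that \<open>x\<close> has order at least \<open>0\<close> along \<open>S\<close> and that its residue
  is \<open>y\<close>, the residue field being identified with the rational functions of degree \<open>0\<close>
  in the variables from \<open>S\<close>.\<close>

definition residue :: "'v::linorder set \<Rightarrow> 'v mpoly fract \<Rightarrow> 'v mpoly fract \<Rightarrow> bool" where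
  "residue S x y \<longleftrightarrow> (\<exists>f g p q n. scale_vars S f = monom 1 n * p \<and> scale_vars S g = monom 1 n * q \<and>
     coeff q 0 \<noteq> 0 \<and> x = Fract f g \<and> y = Fract (coeff p 0) (coeff q 0))"

lemma residueI:
  assumes "scale_vars S f = monom 1 n * p" "scale_vars S g = monom 1 n * q" "coeff q 0 \<noteq> 0"
  shows "residue S (Fract f g) (Fract (coeff p 0) (coeff q 0))"
  using assms unfolding residue_def by blast

lemma residueE:
  assumes "residue S x y"
  obtains f g p q n where "scale_vars S f = monom 1 n * p" "scale_vars S g = monom 1 n * q"
    "coeff q 0 \<noteq> 0" "g \<noteq> 0" "x = Fract f g" "y = Fract (coeff p 0) (coeff q 0)"
proof -
  obtain f g p q n where *: "scale_vars S f = monom 1 n * p" "scale_vars S g = monom 1 n * q"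
    "coeff q 0 \<noteq> 0" "x = Fract f g" "y = Fract (coeff p 0) (coeff q 0)"
    using assms unfolding residue_def by blast
  have "g \<noteq> 0"
    using *(2,3) by (auto simp: monom_eq_0_iff)
  with * that show thesis by blast
qed

lemma residue_zero: "residue S 0 0"
  using residueI[of S 0 0 0 1 1] by (simp add: monom_0 one_pCons fract_collapse)

lemma residue_one: "residue S 1 1"
  using residueI[of S 1 0 1 1 1] by (simp add: monom_0 one_pCons fract_collapse)

lemma residue_uminus_one: "residue S (- 1) (- 1)"
  using residueI[of S "- 1" 0 "- 1" 1 1]
  by (simp add: monom_0 one_pCons fract_collapse scale_vars_uminus flip: minus_fract)

lemma residue_var_outside:
  assumes "v \<notin> S" shows "residue S (var v) (var v)"
  using residueI[of S "Poly_Mapping.single {#v#} 1" 0 "monom (Poly_Mapping.single {#v#} 1) 0" 1 1] assms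
  by (simp add: scale_vars_single var_def flip: one_pCons monom_0)

lemma residue_var_inside:
  assumes "v \<in> S" shows "residue S (var v) 0"
  using residueI[of S "Poly_Mapping.single {#v#} 1" 0 "monom (Poly_Mapping.single {#v#} 1) 1" 1 1] assms
  by (simp add: scale_vars_single var_def fract_collapse flip: one_pCons monom_0)

lemma residue_add:
  assumes "residue S x y" "residue S x' y'"
  shows "residue S (x + x') (y + y')"
proof -
  obtain f g p q n where 1: "scale_vars S f = monom 1 n * p" "scale_vars S g = monom 1 n * q"
    "coeff q 0 \<noteq> 0" "g \<noteq> 0" "x = Fract f g" "y = Fract (coeff p 0) (coeff q 0)"
    using assms(1) by (rule residueE)
  obtain f' g' p' q' n' where 2: "scale_vars S f' = monom 1 n' * p'" "scale_vars S g' = monom 1 n' * q'"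
    "coeff q' 0 \<noteq> 0" "g' \<noteq> 0" "x' = Fract f' g'" "y' = Fract (coeff p' 0) (coeff q' 0)"
    using assms(2) by (rule residueE)
  have "monom (1 :: 'a mpoly) (n + n') = monom 1 n * monom 1 n'"
    by (simp add: mult_monom)
  then have "residue S (Fract (f * g' + f' * g) (g * g'))
     (Fract (coeff (p * q' + p' * q) 0) (coeff (q * q') 0))"
    using 1 2
    by (intro residueI[where n = "n + n'"])
      (simp_all add: scale_vars_add scale_vars_mult algebra_simps coeff_mult_0)
  then show ?thesis
    using 1 2 by (simp add: coeff_mult_0)
qed

lemma residue_mult:
  assumes "residue S x y" "residue S x' y'"
  shows "residue S (x * x') (y * y')"
proof -
  obtain f g p q n where 1: "scale_vars S f = monom 1 n * p" "scale_vars S g = monom 1 n * q"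
    "coeff q 0 \<noteq> 0" "g \<noteq> 0" "x = Fract f g" "y = Fract (coeff p 0) (coeff q 0)"
    using assms(1) by (rule residueE)
  obtain f' g' p' q' n' where 2: "scale_vars S f' = monom 1 n' * p'" "scale_vars S g' = monom 1 n' * q'"
    "coeff q' 0 \<noteq> 0" "g' \<noteq> 0" "x' = Fract f' g'" "y' = Fract (coeff p' 0) (coeff q' 0)"
    using assms(2) by (rule residueE)
  have "monom (1 :: 'a mpoly) (n + n') = monom 1 n * monom 1 n'"
    by (simp add: mult_monom)
  then have "residue S (Fract (f * f') (g * g')) (Fract (coeff (p * p') 0) (coeff (q * q') 0))"
    using 1 2
    by (intro residueI[where n = "n + n'"]) (simp_all add: scale_vars_mult algebra_simps coeff_mult_0)
  then show ?thesis
    using 1 2 by (simp add: coeff_mult_0)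
qed

lemma residue_uminus: "residue S x y \<Longrightarrow> residue S (- x) (- y)"
  using residue_mult[OF residue_uminus_one] by fastforce

lemma residue_power: "residue S x y \<Longrightarrow> residue S (x ^ n) (y ^ n)"
  by (induction n) (simp_all add: residue_one residue_mult)

text \<open>Numerator and denominator change roles; \<open>y \<noteq> 0\<close> supplies the nonzero
  constant coefficient of the new denominator.\<close>

lemma residue_inverse:
  assumes "residue S x y" "y \<noteq> 0"
  shows "residue S (inverse x) (inverse y)"
proof -
  obtain f g p q n where 1: "scale_vars S f = monom 1 n * p" "scale_vars S g = monom 1 n * q"
    "coeff q 0 \<noteq> 0" "g \<noteq> 0" "x = Fract f g" "y = Fract (coeff p 0) (coeff q 0)"
    using assms(1) by (rule residueE)
  have "coeff p 0 \<noteq> 0"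
    using 1 assms(2) by (auto simp: fract_collapse)
  then show ?thesis
    using residueI[OF 1(2,1)] 1 by simp
qed

text \<open>Read contrapositively, a nonzero residue comes from a nonzero value; this makes supports
  of admissible functions upward closed.\<close>

lemma residue_of_zero:
  assumes "residue S 0 y" shows "y = 0"
proof -
  obtain f g p q n where 1: "scale_vars S f = monom 1 n * p" "scale_vars S g = monom 1 n * q"
    "coeff q 0 \<noteq> 0" "g \<noteq> 0" "0 = Fract f g" "y = Fract (coeff p 0) (coeff q 0)"
    using assms by (rule residueE)
  have "f = 0"
    using 1 by (simp add: Zero_fract_def eq_fract)
  then have "p = 0"
    using 1(1) by (simp add: monom_eq_0_iff)
  then show ?thesis
    using 1 by (simp add: fract_collapse)
qed

text \<open>A single monomial \<open>m\<close> of \<open>a\<close> bounds the order along every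
  \<open>S\<close> by its degree, so \<open>Suc (size m)\<close> serves as \<open>N\<close> for all
  \<open>S\<close> at once.\<close>

lemma scale_vars_order:
  assumes "a \<noteq> 0"
  obtains N where "\<And>S. \<exists>j a'. j < N \<and> scale_vars S a = monom 1 j * a' \<and> coeff a' 0 \<noteq> 0"
proof -
  obtain m where m: "m \<in> Poly_Mapping.keys a"
    using assms keys_eq_empty[of a] by blast
  have "\<exists>j a'. j < Suc (size m) \<and> scale_vars S a = monom 1 j * a' \<and> coeff a' 0 \<noteq> 0" for S
  proof -
    let ?d = "size (filter_mset (\<lambda>v. v \<in> S) m)"
    have nz: "coeff (scale_vars S a) ?d \<noteq> 0"
      using m by (rule coeff_scale_vars_nonzero)
    then have "scale_vars S a \<noteq> 0" by auto
    \<comment> \<open>Splitting off all factors z, as many as the order of vanishing at 0, leaves a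
      polynomial with nonzero constant coefficient.\<close>
    then obtain a' where a': "scale_vars S a = [:- 0, 1:] ^ order 0 (scale_vars S a) * a'"
      "\<not> [:- 0, 1:] dvd a'"
      using order_decomp by blast
    let ?j = "order 0 (scale_vars S a)"
    have eq: "scale_vars S a = monom 1 ?j * a'"
      using a'(1) by (simp add: monom_altdef)
    have "coeff a' 0 \<noteq> 0"
      using a'(2) poly_eq_0_iff_dvd[of a' 0] by (simp add: poly_0_coeff_0)
    moreover have "?j \<le> ?d"
      using nz by (subst (asm) eq) (auto simp: coeff_monom_mult split: if_splits)
    moreover have "?d \<le> size m"
      by (rule size_filter_mset_lesseq)
    ultimately show ?thesis
      using eq by (meson le_imp_less_Suc le_trans)
  qed
  then show thesis by (rule that)
qed

text \<open>The order of \<open>w\<close> along \<open>S\<close> is at most the degree of its numerator, whatever \<open>S\<close> is.\<close>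

lemma residue_power_divide:
  assumes "w \<noteq> 0"
  obtains N where "\<And>S u M. residue S u 0 \<Longrightarrow> N \<le> M \<Longrightarrow> residue S (u ^ M / w) 0"
proof -
  obtain a b where w: "w = Fract a b" "b \<noteq> 0" "a \<noteq> 0"
    using assms by (cases w rule: Fract_cases_nonzero) auto
  obtain N where N: "\<And>S. \<exists>j a'. j < N \<and> scale_vars S a = monom 1 j * a' \<and> coeff a' 0 \<noteq> 0"
    using scale_vars_order[OF w(3)] by blast
  have "residue S (u ^ M / w) 0" if u: "residue S u 0" and M: "N \<le> M" for S u M
  proof -
    obtain j a' where j: "j < N" "scale_vars S a = monom 1 j * a'" "coeff a' 0 \<noteq> 0"
      using N by blast
    obtain f g p q n where 1: "scale_vars S f = monom 1 n * p" "scale_vars S g = monom 1 n * q"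
      "coeff q 0 \<noteq> 0" "g \<noteq> 0" "u = Fract f g" "0 = Fract (coeff p 0) (coeff q 0)"
      using u by (rule residueE)
    \<comment> \<open>Residue 0 means that the numerator of \<open>u\<close> has one more factor z
      than its denominator shares.\<close>
    have "coeff p 0 = 0"
      using 1 by (simp add: Zero_fract_def eq_fract)
    then obtain p' where p': "p = monom 1 1 * p'"
      by (metis dvdE monom_altdef poly_0_coeff_0 poly_eq_0_iff_dvd power_one_right
          minus_zero smult_1_left)
    have split: "monom (1 :: 'a mpoly) (M * n + j) = monom 1 (M * n) * monom 1 j"
      by (simp add: mult_monom)
    have pow: "monom (1 :: 'a mpoly) k ^ M = monom 1 (k * M)" for k
      by (simp add: monom_power)
    \<comment> \<open>The \<open>M\<close> factors \<open>u\<close> contribute \<open>M\<close>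
      extra factors z. The division by \<open>w\<close> uses up \<open>j\<close> of them, and at
      least one remains because \<open>j < N \<le> M\<close>.\<close>
    have "monom (1 :: 'a mpoly) (n * M) * monom 1 M = monom 1 (n * M + j) * monom 1 (M - j)"
      using j(1) M by (simp add: mult_monom)
    then have "scale_vars S (f ^ M * b)
        = monom 1 (n * M + j) * (monom 1 (M - j) * (p' ^ M * scale_vars S b))"
      by (simp add: scale_vars_mult scale_vars_power 1 p' power_mult_distrib pow
          flip: mult.assoc)
    moreover have "scale_vars S (g ^ M * a) = monom 1 (n * M + j) * (q ^ M * a')"
      by (simp add: scale_vars_mult scale_vars_power 1 j power_mult_distrib pow mult_ac split)
    moreover have "coeff (q ^ M * a') 0 \<noteq> 0"
      using 1 j by (simp add: coeff_mult_0 coeff_0_power)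
    ultimately have "residue S (Fract (f ^ M * b) (g ^ M * a))
      (Fract (coeff (monom 1 (M - j) * (p' ^ M * scale_vars S b)) 0) (coeff (q ^ M * a') 0))"
      by (rule residueI)
    moreover have "coeff (monom 1 (M - j) * (p' ^ M * scale_vars S b)) 0 = 0"
      using j(1) M by (simp add: coeff_monom_mult)
    moreover have "u ^ M = Fract (f ^ M) (g ^ M)"
      unfolding 1(5) by (induction M) (simp_all add: fract_collapse)
    ultimately show ?thesis
      by (simp add: w fract_collapse)
  qed
  then show thesis by (rule that)
qed

section \<open>Renaming in the field of fractions\<close>

text \<open>The value is chosen through some representative; \<open>rename_fract\<close> below shows
  independence of the representative for injective \<open>\<phi>\<close>.\<close>

definition rename_fract :: "('v \<Rightarrow> 'w) \<Rightarrow> 'v::linorder mpoly fract \<Rightarrow> 'w::linorder mpoly fract" where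
  "rename_fract \<phi> x = (SOME y. \<exists>f g. g \<noteq> 0 \<and> x = Fract f g \<and> y = Fract (rename_vars \<phi> f) (rename_vars \<phi> g))"

text \<open>Multiplicativity transports the cross-multiplied equation between two representatives,
  and injectivity keeps the denominators nonzero.\<close>

lemma rename_fract:
  assumes "inj \<phi>" "g \<noteq> 0"
  shows "rename_fract \<phi> (Fract f g) = Fract (rename_vars \<phi> f) (rename_vars \<phi> g)"
  unfolding rename_fract_def
proof (rule some_equality)
  fix y
  assume "\<exists>f' g'. g' \<noteq> 0 \<and> Fract f g = Fract f' g' \<and> y = Fract (rename_vars \<phi> f') (rename_vars \<phi> g')"
  then obtain f' g' where *: "g' \<noteq> 0" "f * g' = f' * g"
    "y = Fract (rename_vars \<phi> f') (rename_vars \<phi> g')"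
    using assms by (auto simp: eq_fract)
  then have "rename_vars \<phi> f * rename_vars \<phi> g' = rename_vars \<phi> f' * rename_vars \<phi> g"
    by (metis rename_vars_mult)
  then show "y = Fract (rename_vars \<phi> f) (rename_vars \<phi> g)"
    using assms * by (simp add: eq_fract rename_vars_eq_0_iff)
qed (use assms in blast)

lemma rename_fract_one: "inj \<phi> \<Longrightarrow> rename_fract \<phi> 1 = 1"
  by (simp add: One_fract_def rename_fract)

lemma rename_fract_add:
  assumes "inj \<phi>"
  shows "rename_fract \<phi> (x + y) = rename_fract \<phi> x + rename_fract \<phi> y"
  using assms by (cases x; cases y)
    (simp add: rename_fract rename_vars_add rename_vars_mult rename_vars_eq_0_iff)

lemma rename_fract_mult:
  assumes "inj \<phi>"
  shows "rename_fract \<phi> (x * y) = rename_fract \<phi> x * rename_fract \<phi> y"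
  using assms by (cases x; cases y) (simp add: rename_fract rename_vars_mult)

lemma rename_fract_eq_0_iff:
  assumes "inj \<phi>"
  shows "rename_fract \<phi> x = 0 \<longleftrightarrow> x = 0"
  using assms by (cases x) (simp add: rename_fract rename_vars_eq_0_iff Zero_fract_def eq_fract)

text \<open>By \<open>coeff_scale_vars_rename\<close> the witnesses for \<open>x\<close> and
  \<open>y\<close> can be renamed coefficientwise, with the same power of z.\<close>

lemma residue_rename:
  assumes \<phi>: "inj \<phi>" and "residue (\<phi> -` S) x y"
  shows "residue S (rename_fract \<phi> x) (rename_fract \<phi> y)"
proof -
  obtain f g p q n where 1: "scale_vars (\<phi> -` S) f = monom 1 n * p"
    "scale_vars (\<phi> -` S) g = monom 1 n * q"
    "coeff q 0 \<noteq> 0" "g \<noteq> 0" "x = Fract f g" "y = Fract (coeff p 0) (coeff q 0)"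
    using assms(2) by (rule residueE)
  have *: "scale_vars S (rename_vars \<phi> h) = monom 1 n * map_poly (rename_vars \<phi>) r"
    if "scale_vars (\<phi> -` S) h = monom 1 n * r" for h r
    by (rule poly_eqI) (simp add: coeff_scale_vars_rename that coeff_monom_mult coeff_map_poly)
  have "residue S (Fract (rename_vars \<phi> f) (rename_vars \<phi> g))
    (Fract (coeff (map_poly (rename_vars \<phi>) p) 0) (coeff (map_poly (rename_vars \<phi>) q) 0))"
    using 1 \<phi> by (intro residueI[OF *[OF 1(1)] *[OF 1(2)]])
      (simp add: coeff_map_poly rename_vars_eq_0_iff)
  then show ?thesis
    using 1 \<phi> by (simp add: coeff_map_poly rename_fract)
qed

section \<open>Prime filters\<close>

locale bounded_distributive_lattice = bounded_lattice +
  assumes meet_join_distrib: "\<lbrakk>a \<in> carrier L; b \<in> carrier L; c \<in> carrier L\<rbrakk> \<Longrightarrow>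
      a \<sqinter> (b \<squnion> c) = (a \<sqinter> b) \<squnion> (a \<sqinter> c)"
begin

definition prime_filters :: "'a set set" where
  "prime_filters = {P. P \<subseteq> carrier L \<and> \<top> \<in> P \<and> \<bottom> \<notin> P \<and>
     (\<forall>a \<in> carrier L. \<forall>b \<in> carrier L. (a \<sqinter> b \<in> P \<longleftrightarrow> a \<in> P \<and> b \<in> P) \<and>
       (a \<squnion> b \<in> P \<longleftrightarrow> a \<in> P \<or> b \<in> P))}"

lemma prime_filterD:
  assumes "P \<in> prime_filters"
  shows "P \<subseteq> carrier L" "\<top> \<in> P" "\<bottom> \<notin> P"
    "\<lbrakk>a \<in> carrier L; b \<in> carrier L\<rbrakk> \<Longrightarrow> a \<sqinter> b \<in> P \<longleftrightarrow> a \<in> P \<and> b \<in> P"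
    "\<lbrakk>a \<in> carrier L; b \<in> carrier L\<rbrakk> \<Longrightarrow> a \<squnion> b \<in> P \<longleftrightarrow> a \<in> P \<or> b \<in> P"
  using assms by (auto simp: prime_filters_def)

lemma prime_filter_up:
  assumes "P \<in> prime_filters" "a \<in> P" "b \<in> carrier L" "a \<sqsubseteq> b"
  shows "b \<in> P"
proof -
  have "a \<in> carrier L"
    using assms(1,2) prime_filterD(1) by blast
  moreover from this have "a = a \<sqinter> b"
    using assms(3,4) le_iff_join by blast
  ultimately show ?thesis
    using prime_filterD(4)[OF assms(1), of a b] assms(2,3) by simp
qed

lemma meet_meet_le:
  assumes "m \<in> carrier L" "n \<in> carrier L" "a \<in> carrier L"
  shows "(m \<sqinter> n) \<sqinter> a \<sqsubseteq> m \<sqinter> a" "(m \<sqinter> n) \<sqinter> a \<sqsubseteq> n \<sqinter> a"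
proof -
  have mn: "m \<sqinter> n \<in> carrier L" "m \<sqinter> n \<sqinter> a \<in> carrier L"
    using assms by simp_all
  have "m \<sqinter> n \<sqinter> a \<sqsubseteq> m"
    using meet_left[OF mn(1) assms(3)] meet_left[OF assms(1,2)] by (rule le_trans) fact+
  moreover have "m \<sqinter> n \<sqinter> a \<sqsubseteq> n"
    using meet_left[OF mn(1) assms(3)] meet_right[OF assms(1,2)] by (rule le_trans) fact+
  moreover have "m \<sqinter> n \<sqinter> a \<sqsubseteq> a"
    using mn(1) assms(3) by (rule meet_right)
  ultimately show "m \<sqinter> n \<sqinter> a \<sqsubseteq> m \<sqinter> a" "m \<sqinter> n \<sqinter> a \<sqsubseteq> n \<sqinter> a"
    using assms mn(2) by (auto intro!: meet_le)
qed

definition filter_over :: "'a set \<Rightarrow> 'a set \<Rightarrow> bool" where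
  "filter_over X F \<longleftrightarrow> X \<subseteq> F \<and> F \<subseteq> carrier L \<and> (\<forall>a \<in> F. \<forall>b \<in> carrier L. a \<sqsubseteq> b \<longrightarrow> b \<in> F) \<and>
     (\<forall>a \<in> F. \<forall>b \<in> F. a \<sqinter> b \<in> F)"

lemma filter_over_generated:
  assumes "X \<subseteq> carrier L" "\<And>x y. x \<in> X \<Longrightarrow> y \<in> X \<Longrightarrow> \<exists>z \<in> X. z \<sqsubseteq> x \<and> z \<sqsubseteq> y"
  shows "filter_over X {c \<in> carrier L. \<exists>x \<in> X. x \<sqsubseteq> c}"
  unfolding filter_over_def
proof (intro conjI ballI impI)
  show "X \<subseteq> {c \<in> carrier L. \<exists>x \<in> X. x \<sqsubseteq> c}" "{c \<in> carrier L. \<exists>x \<in> X. x \<sqsubseteq> c} \<subseteq> carrier L"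
    using assms(1) le_refl by blast+
next
  fix a b assume "a \<in> {c \<in> carrier L. \<exists>x \<in> X. x \<sqsubseteq> c}" "b \<in> carrier L" "a \<sqsubseteq> b"
  then show "b \<in> {c \<in> carrier L. \<exists>x \<in> X. x \<sqsubseteq> c}"
    using assms(1) le_trans[of _ a b] by blast
next
  fix a b assume a: "a \<in> {c \<in> carrier L. \<exists>x \<in> X. x \<sqsubseteq> c}" and b: "b \<in> {c \<in> carrier L. \<exists>x \<in> X. x \<sqsubseteq> c}"
  then obtain x y where xy: "x \<in> X" "y \<in> X" "x \<sqsubseteq> a" "y \<sqsubseteq> b" by blast
  then obtain z where z: "z \<in> X" "z \<sqsubseteq> x" "z \<sqsubseteq> y"
    using assms(2) by blast
  have c: "a \<in> carrier L" "b \<in> carrier L" "x \<in> carrier L" "y \<in> carrier L" "z \<in> carrier L"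
    using a b xy z assms(1) by auto
  have "z \<sqsubseteq> a" "z \<sqsubseteq> b"
    using le_trans[of z x a] le_trans[of z y b] c xy z by blast+
  then have "z \<sqsubseteq> a \<sqinter> b"
    using c by (simp add: meet_le)
  then show "a \<sqinter> b \<in> {c \<in> carrier L. \<exists>x \<in> X. x \<sqsubseteq> c}"
    using z(1) c by auto
qed

text \<open>The prime filter theorem: a filter above \<open>X\<close> that is maximal among those
  missing \<open>Z\<close> exists by Zorn's lemma and is prime by distributivity. Directed sets
  instead of filters and ideals allow singletons and families of meets or joins to be separated
  directly.\<close>

lemma prime_filter_separation:
  assumes X: "X \<subseteq> carrier L" "X \<noteq> {}" "\<And>x y. x \<in> X \<Longrightarrow> y \<in> X \<Longrightarrow> \<exists>z \<in> X. z \<sqsubseteq> x \<and> z \<sqsubseteq> y"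
    and Z: "Z \<subseteq> carrier L" "Z \<noteq> {}" "\<And>x y. x \<in> Z \<Longrightarrow> y \<in> Z \<Longrightarrow> \<exists>z \<in> Z. x \<sqsubseteq> z \<and> y \<sqsubseteq> z"
    and sep: "\<And>x z. x \<in> X \<Longrightarrow> z \<in> Z \<Longrightarrow> \<not> x \<sqsubseteq> z"
  obtains P where "P \<in> prime_filters" "X \<subseteq> P" "Z \<inter> P = {}"
proof -
  let ?\<F> = "{F. filter_over X F \<and> Z \<inter> F = {}}"
  have "{c \<in> carrier L. \<exists>x \<in> X. x \<sqsubseteq> c} \<in> ?\<F>"
    using filter_over_generated[OF X(1,3)] sep by blast
  then have "?\<F> \<noteq> {}" by blast
  moreover have "\<Union>\<C> \<in> ?\<F>" if "\<C> \<noteq> {}" "subset.chain ?\<F> \<C>" for \<C>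
  proof -
    have "\<C> \<subseteq> ?\<F>" and lin: "\<And>F G. F \<in> \<C> \<Longrightarrow> G \<in> \<C> \<Longrightarrow> F \<subseteq> G \<or> G \<subseteq> F"
      using that(2) unfolding subset.chain_def by blast+
    then have fil: "X \<subseteq> F" "F \<subseteq> carrier L" "Z \<inter> F = {}"
      "a \<in> F \<Longrightarrow> b \<in> carrier L \<Longrightarrow> a \<sqsubseteq> b \<Longrightarrow> b \<in> F"
      "a \<in> F \<Longrightarrow> b \<in> F \<Longrightarrow> a \<sqinter> b \<in> F" if "F \<in> \<C>" for F a b
      using that by (auto simp: filter_over_def)
    have "a \<sqinter> b \<in> \<Union>\<C>" if ab: "a \<in> \<Union>\<C>" "b \<in> \<Union>\<C>" for a b
    proof -
      obtain F G where "F \<in> \<C>" "a \<in> F" "G \<in> \<C>" "b \<in> G"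
        using ab by blast
      then obtain F where "F \<in> \<C>" "a \<in> F" "b \<in> F"
        using lin[of F G] by blast
      then show ?thesis
        using fil(5) by blast
    qed
    moreover have "X \<subseteq> \<Union>\<C>"
      using \<open>\<C> \<noteq> {}\<close> fil(1) by blast
    moreover have "\<Union>\<C> \<subseteq> carrier L" "Z \<inter> \<Union>\<C> = {}"
      using fil(2,3) by blast+
    moreover have "\<forall>a \<in> \<Union>\<C>. \<forall>b \<in> carrier L. a \<sqsubseteq> b \<longrightarrow> b \<in> \<Union>\<C>"
      using fil(4) by (meson UnionE UnionI)
    ultimately show ?thesis
      by (simp add: filter_over_def)
  qed
  ultimately obtain M where "M \<in> ?\<F>" and max': "\<forall>F \<in> ?\<F>. M \<subseteq> F \<longrightarrow> F = M"
    using subset_Zorn_nonempty[of ?\<F>] by meson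
  then have M: "filter_over X M" "Z \<inter> M = {}"
    by simp_all
  have max: "F = M" if "filter_over X F" "Z \<inter> F = {}" "M \<subseteq> F" for F
    using max' that by simp
  have MX: "X \<subseteq> M" and Mc: "M \<subseteq> carrier L"
    and up: "\<And>a b. a \<in> M \<Longrightarrow> b \<in> carrier L \<Longrightarrow> a \<sqsubseteq> b \<Longrightarrow> b \<in> M"
    and meet: "\<And>a b. a \<in> M \<Longrightarrow> b \<in> M \<Longrightarrow> a \<sqinter> b \<in> M"
    using M(1) unfolding filter_over_def by blast+
  obtain x0 z0 where "x0 \<in> X" "z0 \<in> Z"
    using X(2) Z(2) by blast
  \<comment> \<open>By maximality, the filter generated by \<open>M\<close> and \<open>a\<close>
    must meet \<open>Z\<close>.\<close>
  have extend: "\<exists>m \<in> M. \<exists>z \<in> Z. m \<sqinter> a \<sqsubseteq> z" if a: "a \<in> carrier L" "a \<notin> M" for a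
  proof (rule ccontr)
    assume none: "\<not> (\<exists>m \<in> M. \<exists>z \<in> Z. m \<sqinter> a \<sqsubseteq> z)"
    let ?B = "(\<lambda>m. m \<sqinter> a) ` M"
    let ?F = "{c \<in> carrier L. \<exists>x \<in> ?B. x \<sqsubseteq> c}"
    have FB: "filter_over ?B ?F"
    proof (rule filter_over_generated)
      show "?B \<subseteq> carrier L"
        using Mc a(1) by auto
      fix x y assume "x \<in> ?B" "y \<in> ?B"
      then obtain m n where mn: "m \<in> M" "n \<in> M" "x = m \<sqinter> a" "y = n \<sqinter> a" by auto
      have "m \<in> carrier L" "n \<in> carrier L"
        using mn(1,2) Mc by auto
      then have "(m \<sqinter> n) \<sqinter> a \<sqsubseteq> x \<and> (m \<sqinter> n) \<sqinter> a \<sqsubseteq> y"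
        unfolding mn(3,4) using a(1) by (simp add: meet_meet_le)
      then show "\<exists>z \<in> ?B. z \<sqsubseteq> x \<and> z \<sqsubseteq> y"
        using imageI[OF meet[OF mn(1,2)], of "\<lambda>m. m \<sqinter> a"] by (rule rev_bexI[rotated])
    qed
    have sub: "M \<subseteq> ?F"
    proof
      fix m assume "m \<in> M"
      moreover from this have "m \<in> carrier L"
        using Mc by auto
      moreover from this have "m \<sqinter> a \<sqsubseteq> m"
        using a(1) by (rule meet_left)
      ultimately show "m \<in> ?F"
        by auto
    qed
    have "filter_over X ?F"
      using FB subset_trans[OF MX sub] unfolding filter_over_def by simp
    moreover have "Z \<inter> ?F = {}"
      using none by auto
    ultimately have "?F = M"
      using sub by (rule max)
    moreover have "a \<in> ?F"
    proof -
      have "x0 \<in> M" "x0 \<in> carrier L"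
        using \<open>x0 \<in> X\<close> MX Mc by auto
      then show ?thesis
        using meet_right[of x0 a] a(1) by auto
    qed
    ultimately show False
      using a(2) by simp
  qed
  have "\<top> \<in> M"
    using up[of x0 \<top>] \<open>x0 \<in> X\<close> MX Mc top_higher[of x0] top_closed by blast
  moreover have "\<bottom> \<notin> M"
    using up[of \<bottom> z0] \<open>z0 \<in> Z\<close> M(2) Z(1) bottom_lower[of z0] by blast
  moreover have "a \<sqinter> b \<in> M \<longleftrightarrow> a \<in> M \<and> b \<in> M" if "a \<in> carrier L" "b \<in> carrier L" for a b
    using up[of "a \<sqinter> b" a] up[of "a \<sqinter> b" b] meet[of a b] that meet_left[of a b] meet_right[of a b] by blast
  moreover have "a \<squnion> b \<in> M \<longleftrightarrow> a \<in> M \<or> b \<in> M" if ab: "a \<in> carrier L" "b \<in> carrier L" for a b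
  proof
    show "a \<in> M \<or> b \<in> M \<Longrightarrow> a \<squnion> b \<in> M"
      using up[of a "a \<squnion> b"] up[of b "a \<squnion> b"] ab join_left[of a b] join_right[of a b] by auto
    assume j: "a \<squnion> b \<in> M"
    show "a \<in> M \<or> b \<in> M"
    proof (rule ccontr)
      assume "\<not> (a \<in> M \<or> b \<in> M)"
      then obtain m n y z where mn: "m \<in> M" "n \<in> M" "y \<in> Z" "z \<in> Z" "m \<sqinter> a \<sqsubseteq> y" "n \<sqinter> b \<sqsubseteq> z"
        using extend[of a] extend[of b] ab by blast
      obtain w where w: "w \<in> Z" "y \<sqsubseteq> w" "z \<sqsubseteq> w"
        using Z(3) mn by blast
      have c: "m \<in> carrier L" "n \<in> carrier L" "y \<in> carrier L" "z \<in> carrier L" "w \<in> carrier L"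
        using mn w Mc Z(1) by blast+
      have "(m \<sqinter> n) \<sqinter> a \<sqsubseteq> m \<sqinter> a" "(m \<sqinter> n) \<sqinter> b \<sqsubseteq> n \<sqinter> b"
        using c ab by (simp_all add: meet_meet_le)
      then have "(m \<sqinter> n) \<sqinter> a \<sqsubseteq> w" "(m \<sqinter> n) \<sqinter> b \<sqsubseteq> w"
        using c ab mn w le_trans[of _ "m \<sqinter> a" w] le_trans[of _ "n \<sqinter> b" w]
          le_trans[of "m \<sqinter> a" y w] le_trans[of "n \<sqinter> b" z w] by simp_all
      \<comment> \<open>Distributivity joins the two bounds, which forces the element
        \<open>w\<close> of \<open>Z\<close> into \<open>M\<close>.\<close>
      then have "(m \<sqinter> n) \<sqinter> (a \<squnion> b) \<sqsubseteq> w"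
        using c ab by (simp add: meet_join_distrib join_le)
      then have "w \<in> M"
        using up[of "(m \<sqinter> n) \<sqinter> (a \<squnion> b)" w] meet mn j c by blast
      then show False
        using w(1) M(2) by blast
    qed
  qed
  ultimately have "M \<in> prime_filters"
    using Mc by (simp add: prime_filters_def)
  then show thesis
    using that MX M(2) by blast
qed

lemma le_iff_prime_filters:
  assumes "a \<in> carrier L" "b \<in> carrier L"
  shows "a \<sqsubseteq> b \<longleftrightarrow> (\<forall>P \<in> prime_filters. a \<in> P \<longrightarrow> b \<in> P)"
proof
  show "a \<sqsubseteq> b \<Longrightarrow> \<forall>P \<in> prime_filters. a \<in> P \<longrightarrow> b \<in> P"
    using assms prime_filter_up by simp
  assume *: "\<forall>P \<in> prime_filters. a \<in> P \<longrightarrow> b \<in> P"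
  show "a \<sqsubseteq> b"
  proof (rule ccontr)
    assume "\<not> a \<sqsubseteq> b"
    then obtain P where "P \<in> prime_filters" "{a} \<subseteq> P" "{b} \<inter> P = {}"
      using assms by (elim prime_filter_separation[of "{a}" "{b}", rotated -1]) auto
    then show False
      using * by simp
  qed
qed

lemma eq_iff_prime_filters:
  assumes "a \<in> carrier L" "b \<in> carrier L"
  shows "a = b \<longleftrightarrow> (\<forall>P \<in> prime_filters. a \<in> P \<longleftrightarrow> b \<in> P)"
proof
  show "\<forall>P \<in> prime_filters. a \<in> P \<longleftrightarrow> b \<in> P \<Longrightarrow> a = b"
    using assms le_antisym[of a b] le_iff_prime_filters[of a b] le_iff_prime_filters[of b a] by blast
qed simp

section \<open>Clopen up-sets of the space of prime filters\<close>

lemma finite_meet_prime_filters: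
  assumes "finite G" "G \<subseteq> carrier L"
  shows "\<exists>c \<in> carrier L. \<forall>P \<in> prime_filters. c \<in> P \<longleftrightarrow> G \<subseteq> P"
  using assms
proof (induction G)
  case empty
  have "\<forall>P \<in> prime_filters. \<top> \<in> P \<longleftrightarrow> {} \<subseteq> P"
    using prime_filterD(2) by blast
  then show ?case
    by blast
next
  case (insert a G)
  then obtain c where c: "c \<in> carrier L" "\<forall>P \<in> prime_filters. c \<in> P \<longleftrightarrow> G \<subseteq> P"
    by blast
  have a: "a \<in> carrier L"
    using insert.prems by blast
  have "\<forall>P \<in> prime_filters. a \<sqinter> c \<in> P \<longleftrightarrow> insert a G \<subseteq> P"
  proof
    fix P assume P: "P \<in> prime_filters"
    show "a \<sqinter> c \<in> P \<longleftrightarrow> insert a G \<subseteq> P"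
      using prime_filterD(4)[OF P a c(1)] bspec[OF c(2) P] by blast
  qed
  moreover have "a \<sqinter> c \<in> carrier L"
    using a c(1) by simp
  ultimately show ?case
    by blast
qed

lemma finite_join_prime_filters:
  assumes "finite G" "G \<subseteq> carrier L"
  shows "\<exists>c \<in> carrier L. \<forall>P \<in> prime_filters. c \<in> P \<longleftrightarrow> G \<inter> P \<noteq> {}"
  using assms
proof (induction G)
  case empty
  have "\<forall>P \<in> prime_filters. \<bottom> \<in> P \<longleftrightarrow> {} \<inter> P \<noteq> {}"
    using prime_filterD(3) by blast
  then show ?case
    by blast
next
  case (insert a G)
  then obtain c where c: "c \<in> carrier L" "\<forall>P \<in> prime_filters. c \<in> P \<longleftrightarrow> G \<inter> P \<noteq> {}"
    by blast
  have a: "a \<in> carrier L"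
    using insert.prems by blast
  have "\<forall>P \<in> prime_filters. a \<squnion> c \<in> P \<longleftrightarrow> insert a G \<inter> P \<noteq> {}"
  proof
    fix P assume P: "P \<in> prime_filters"
    show "a \<squnion> c \<in> P \<longleftrightarrow> insert a G \<inter> P \<noteq> {}"
      using prime_filterD(5)[OF P a c(1)] bspec[OF c(2) P] by blast
  qed
  moreover have "a \<squnion> c \<in> carrier L"
    using a c(1) by simp
  ultimately show ?case
    by blast
qed

text \<open>The hypothesis on \<open>E\<close> says that \<open>D\<close> is clopen in the Priestley space.\<close>

lemma clopen_upset_represented:
  assumes D: "D \<subseteq> prime_filters" and E: "finite E" "E \<subseteq> carrier L"
    and up: "\<And>P Q. P \<in> D \<Longrightarrow> Q \<in> prime_filters \<Longrightarrow> P \<subseteq> Q \<Longrightarrow> Q \<in> D"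
    and dep: "\<And>P Q. P \<in> D \<Longrightarrow> Q \<in> prime_filters \<Longrightarrow> P \<inter> E = Q \<inter> E \<Longrightarrow> Q \<in> D"
  obtains a where "a \<in> carrier L" "\<And>P. P \<in> prime_filters \<Longrightarrow> a \<in> P \<longleftrightarrow> P \<in> D"
proof -
  \<comment> \<open>The filters with trace \<open>G\<close> on \<open>E\<close> are cut out by two
    elements: \<open>g\<close> acts as the meet of \<open>G\<close> and \<open>h\<close> as the join
    of \<open>E - G\<close>.\<close>
  have pattern: "\<exists>g \<in> carrier L. \<exists>h \<in> carrier L. \<forall>P \<in> prime_filters. P \<inter> E = G \<longleftrightarrow> g \<in> P \<and> h \<notin> P"
    if G: "G \<subseteq> E" for G
  proof -
    obtain g where g: "g \<in> carrier L" "\<forall>P \<in> prime_filters. g \<in> P \<longleftrightarrow> G \<subseteq> P"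
      using finite_meet_prime_filters[OF finite_subset[OF G E(1)] subset_trans[OF G E(2)]] by blast
    obtain h where h: "h \<in> carrier L" "\<forall>P \<in> prime_filters. h \<in> P \<longleftrightarrow> (E - G) \<inter> P \<noteq> {}"
      using finite_join_prime_filters[OF finite_Diff[OF E(1), of G] subset_trans[OF Diff_subset E(2)]]
      by blast
    show ?thesis
    proof (rule bexI[OF _ g(1)], rule bexI[OF _ h(1)], rule ballI)
      fix P assume "P \<in> prime_filters"
      then have "g \<in> P \<and> h \<notin> P \<longleftrightarrow> G \<subseteq> P \<and> (E - G) \<inter> P = {}"
        using g(2) h(2) by simp
      then show "P \<inter> E = G \<longleftrightarrow> g \<in> P \<and> h \<notin> P"
        using G by blast
    qed
  qed
  \<comment> \<open>Each \<open>Q\<close> in \<open>D\<close> has an element all of whose prime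
    filters lie in \<open>D\<close>. Only finitely many traces occur outside \<open>D\<close>, so
    they can be excluded one at a time.\<close>
  have nbhd: "\<exists>c \<in> Q. \<forall>P \<in> prime_filters. c \<in> P \<longrightarrow> P \<in> D" if Q: "Q \<in> D" for Q
  proof -
    have QY: "Q \<in> prime_filters" and Qc: "Q \<subseteq> carrier L"
      using Q D prime_filterD(1) by auto
    define bad where "bad = (\<lambda>P. P \<inter> E) ` (prime_filters - D)"
    have bad_E: "bad \<subseteq> Pow E"
      by (auto simp: bad_def)
    have "\<exists>c \<in> Q. \<forall>P \<in> prime_filters. c \<in> P \<longrightarrow> P \<inter> E \<noteq> G" if G: "G \<in> bad" for G
    proof (rule ccontr)
      assume none: "\<not> (\<exists>c \<in> Q. \<forall>P \<in> prime_filters. c \<in> P \<longrightarrow> P \<inter> E \<noteq> G)"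
      obtain g h where gh: "g \<in> carrier L" "h \<in> carrier L"
        "\<forall>P \<in> prime_filters. P \<inter> E = G \<longleftrightarrow> g \<in> P \<and> h \<notin> P"
        using pattern[of G] G bad_E by blast
      let ?X = "(\<lambda>c. c \<sqinter> g) ` Q"
      \<comment> \<open>If no element of \<open>Q\<close> excludes the trace \<open>G\<close>,
        separation yields a prime filter above \<open>Q\<close> with trace \<open>G\<close>. It lies
        in \<open>D\<close> as \<open>D\<close> is an up-set, although \<open>G\<close> is a trace
        from outside \<open>D\<close>.\<close>
      have "\<exists>P. P \<in> prime_filters \<and> ?X \<subseteq> P \<and> {h} \<inter> P = {}"
      proof (rule prime_filter_separation[of ?X "{h}"])
        show "?X \<subseteq> carrier L" "?X \<noteq> {}" "{h} \<subseteq> carrier L" "{h} \<noteq> {}"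
          using gh Qc prime_filterD(2)[OF QY] by auto
        show "\<exists>z\<in>{h}. x \<sqsubseteq> z \<and> y \<sqsubseteq> z" if "x \<in> {h}" "y \<in> {h}" for x y
          using that gh(2) by auto
        show "\<exists>z\<in>?X. z \<sqsubseteq> x \<and> z \<sqsubseteq> y" if "x \<in> ?X" "y \<in> ?X" for x y
        proof -
          obtain m n where mn: "m \<in> Q" "n \<in> Q" "x = m \<sqinter> g" "y = n \<sqinter> g"
            using \<open>x \<in> ?X\<close> \<open>y \<in> ?X\<close> by blast
          moreover have c: "m \<in> carrier L" "n \<in> carrier L"
            using mn Qc by auto
          ultimately have "(m \<sqinter> n) \<sqinter> g \<sqsubseteq> x \<and> (m \<sqinter> n) \<sqinter> g \<sqsubseteq> y"
            using gh(1) by (simp add: meet_meet_le)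
          then show ?thesis
            using prime_filterD(4)[OF QY] mn c by blast
        qed
        show "\<not> x \<sqsubseteq> z" if "x \<in> ?X" "z \<in> {h}" for x z
        proof
          assume le: "x \<sqsubseteq> z"
          obtain m where m: "m \<in> Q" "x = m \<sqinter> g" "m \<in> carrier L"
            using \<open>x \<in> ?X\<close> Qc by auto
          then obtain P where P: "P \<in> prime_filters" "m \<in> P" "P \<inter> E = G"
            using none by blast
          then have "x \<in> P" "h \<notin> P"
            using gh m prime_filterD(4)[OF P(1)] by auto
          then show False
            using prime_filter_up[OF P(1)] le gh(2) \<open>z \<in> {h}\<close> by auto
        qed
      qed blast
      then obtain P where P: "P \<in> prime_filters" "?X \<subseteq> P" "h \<notin> P"
        by blast
      have meets: "c \<in> P \<and> g \<in> P" if "c \<in> Q" for c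
      proof -
        have "c \<sqinter> g \<in> P" "c \<in> carrier L"
          using P(2) that Qc by blast+
        then show ?thesis
          using prime_filterD(4)[OF P(1)] gh(1) by blast
      qed
      have "g \<in> P"
        using meets prime_filterD(2)[OF QY] by blast
      then have PG: "P \<inter> E = G"
        using gh(3) P by blast
      have "P \<in> D"
        using up[OF Q P(1)] meets by blast
      then show False
        using dep[OF \<open>P \<in> D\<close>] PG G unfolding bad_def by blast
    qed
    then have "\<forall>G \<in> bad. \<exists>c. c \<in> Q \<and> (\<forall>P \<in> prime_filters. c \<in> P \<longrightarrow> P \<inter> E \<noteq> G)"
      by (simp add: Bex_def)
    then obtain c where c: "\<forall>G \<in> bad. c G \<in> Q \<and> (\<forall>P \<in> prime_filters. c G \<in> P \<longrightarrow> P \<inter> E \<noteq> G)"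
      unfolding bchoice_iff by (rule exE)
    have cQ: "c ` bad \<subseteq> Q"
      using c by blast
    have "finite (c ` bad)" "c ` bad \<subseteq> carrier L"
      using finite_subset[OF bad_E] E(1) subset_trans[OF cQ Qc] by simp_all
    then obtain d where d: "d \<in> carrier L" "\<forall>P \<in> prime_filters. d \<in> P \<longleftrightarrow> c ` bad \<subseteq> P"
      using finite_meet_prime_filters by blast
    have "d \<in> Q"
      using bspec[OF d(2) QY] cQ by simp
    moreover have "P \<in> D" if P: "P \<in> prime_filters" "d \<in> P" for P
    proof (rule ccontr)
      assume "P \<notin> D"
      then have "P \<inter> E \<in> bad"
        unfolding bad_def using P by blast
      moreover from this have "c (P \<inter> E) \<in> P"
        using bspec[OF d(2) P(1)] P(2) by blast
      ultimately show False
        using bspec[OF c] P(1) by blast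
    qed
    ultimately show ?thesis by blast
  qed
  \<comment> \<open>The elements contained in no prime filter outside \<open>D\<close>. The sought
    element is a finite join from \<open>?I\<close>, one member for each trace occurring in
    \<open>D\<close>.\<close>
  let ?I = "{c \<in> carrier L. \<forall>P \<in> prime_filters. c \<in> P \<longrightarrow> P \<in> D}"
  define good where "good = (\<lambda>P. P \<inter> E) ` D"
  have good_E: "good \<subseteq> Pow E"
    by (auto simp: good_def)
  have "\<exists>c \<in> ?I. \<forall>P \<in> prime_filters. P \<inter> E = G \<longrightarrow> c \<in> P" if G: "G \<in> good" for G
  proof (rule ccontr)
    assume none: "\<not> (\<exists>c \<in> ?I. \<forall>P \<in> prime_filters. P \<inter> E = G \<longrightarrow> c \<in> P)"
    obtain g h where gh: "g \<in> carrier L" "h \<in> carrier L"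
      "\<forall>P \<in> prime_filters. P \<inter> E = G \<longleftrightarrow> g \<in> P \<and> h \<notin> P"
      using pattern[of G] G good_E by blast
    let ?Z = "(\<lambda>c. h \<squnion> c) ` ?I"
    have "\<bottom> \<in> ?I"
      using prime_filterD(3) by auto
    \<comment> \<open>If no single member of \<open>?I\<close> covers the trace \<open>G\<close>,
      separation yields a prime filter with this trace that avoids \<open>?I\<close>. It belongs to
      \<open>D\<close>, so \<open>nbhd\<close> gives a contradiction.\<close>
    have "\<exists>P. P \<in> prime_filters \<and> {g} \<subseteq> P \<and> ?Z \<inter> P = {}"
    proof (rule prime_filter_separation[of "{g}" ?Z])
      show "?Z \<subseteq> carrier L" "{g} \<subseteq> carrier L" "{g} \<noteq> {}"
        using gh by auto
      show "?Z \<noteq> {}"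
        using \<open>\<bottom> \<in> ?I\<close> by blast
      show "\<exists>z\<in>{g}. z \<sqsubseteq> x \<and> z \<sqsubseteq> y" if "x \<in> {g}" "y \<in> {g}" for x y
        using that gh(1) by auto
      show "\<exists>z\<in>?Z. x \<sqsubseteq> z \<and> y \<sqsubseteq> z" if "x \<in> ?Z" "y \<in> ?Z" for x y
      proof -
        obtain m n where mn: "m \<in> ?I" "n \<in> ?I" "x = h \<squnion> m" "y = h \<squnion> n"
          using \<open>x \<in> ?Z\<close> \<open>y \<in> ?Z\<close> by blast
        then have "m \<squnion> n \<in> ?I"
          by (auto simp: prime_filterD(5))
        moreover have "x \<sqsubseteq> h \<squnion> (m \<squnion> n) \<and> y \<sqsubseteq> h \<squnion> (m \<squnion> n)"
          using mn gh(2) by (auto simp: le_iff_prime_filters prime_filterD(5))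
        ultimately show ?thesis by blast
      qed
      show "\<not> x \<sqsubseteq> z" if "x \<in> {g}" "z \<in> ?Z" for x z
      proof
        assume le: "x \<sqsubseteq> z"
        obtain m where m: "m \<in> ?I" "z = h \<squnion> m" "m \<in> carrier L"
          using \<open>z \<in> ?Z\<close> by auto
        then obtain P where P: "P \<in> prime_filters" "m \<notin> P" "P \<inter> E = G"
          using none by blast
        then have "g \<in> P" "z \<notin> P" "z \<in> carrier L"
          using gh m prime_filterD(5)[OF P(1)] by auto
        then show False
          using prime_filter_up[OF P(1)] le \<open>x \<in> {g}\<close> by auto
      qed
    qed blast
    then obtain P where P: "P \<in> prime_filters" "g \<in> P" "?Z \<inter> P = {}"
      by blast
    have avoid: "h \<notin> P \<and> c \<notin> P" if "c \<in> ?I" for c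
      using P(3) that gh(2) prime_filterD(5)[OF P(1), of h c] by blast
    have "P \<inter> E = G"
      using gh(3) P avoid[OF \<open>\<bottom> \<in> ?I\<close>] by blast
    then have "P \<in> D"
      using G dep P(1) unfolding good_def by blast
    then obtain c where "c \<in> P" "\<forall>P \<in> prime_filters. c \<in> P \<longrightarrow> P \<in> D"
      using nbhd by blast
    moreover from this have "c \<in> ?I"
      using prime_filterD(1)[OF P(1)] by auto
    ultimately show False
      using avoid by blast
  qed
  then have "\<forall>G \<in> good. \<exists>c. c \<in> ?I \<and> (\<forall>P \<in> prime_filters. P \<inter> E = G \<longrightarrow> c \<in> P)"
    unfolding Bex_def by simp
  then obtain c where c: "\<forall>G \<in> good. c G \<in> ?I \<and> (\<forall>P \<in> prime_filters. P \<inter> E = G \<longrightarrow> c G \<in> P)"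
    unfolding bchoice_iff by (rule exE)
  have "finite (c ` good)"
    using finite_subset[OF good_E] E(1) by simp
  moreover have "c ` good \<subseteq> carrier L"
    using c by blast
  ultimately obtain a where a: "a \<in> carrier L" "\<forall>P \<in> prime_filters. a \<in> P \<longleftrightarrow> c ` good \<inter> P \<noteq> {}"
    using finite_join_prime_filters by blast
  have "a \<in> P \<longleftrightarrow> P \<in> D" if P: "P \<in> prime_filters" for P
  proof
    assume "a \<in> P"
    then obtain G where "G \<in> good" "c G \<in> P"
      using bspec[OF a(2) P] by blast
    then show "P \<in> D"
      using bspec[OF c, of G] P by blast
  next
    assume "P \<in> D"
    then have "P \<inter> E \<in> good"
      unfolding good_def by blast
    then have "c (P \<inter> E) \<in> P"
      using bspec[OF c, of "P \<inter> E"] P by blast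
    then show "a \<in> P"
      using bspec[OF a(2) P] \<open>P \<inter> E \<in> good\<close> by blast
  qed
  with a(1) that show thesis by blast
qed

end

section \<open>Rings supported on a distributive lattice\<close>

context bounded_distributive_lattice
begin

definition lattice_ideal :: "'a set \<Rightarrow> bool" where
  "lattice_ideal J \<longleftrightarrow> J \<subseteq> carrier L \<and> \<bottom> \<in> J \<and>
     (\<forall>a \<in> J. \<forall>b \<in> J. a \<squnion> b \<in> J) \<and> (\<forall>a \<in> J. \<forall>b \<in> carrier L. b \<sqsubseteq> a \<longrightarrow> b \<in> J)"

lemma lattice_idealI:
  assumes "J \<subseteq> carrier L" "\<bottom> \<in> J" "\<And>a b. a \<in> J \<Longrightarrow> b \<in> J \<Longrightarrow> a \<squnion> b \<in> J"
    "\<And>a b. a \<in> J \<Longrightarrow> b \<in> carrier L \<Longrightarrow> b \<sqsubseteq> a \<Longrightarrow> b \<in> J"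
  shows "lattice_ideal J"
  using assms unfolding lattice_ideal_def by blast

lemma lattice_idealD:
  assumes "lattice_ideal J"
  shows "J \<subseteq> carrier L" "\<bottom> \<in> J" "a \<in> J \<Longrightarrow> b \<in> J \<Longrightarrow> a \<squnion> b \<in> J"
    "a \<in> J \<Longrightarrow> b \<in> carrier L \<Longrightarrow> b \<sqsubseteq> a \<Longrightarrow> b \<in> J"
  using assms unfolding lattice_ideal_def by blast+

lemma meet_mono_left:
  assumes "a \<in> carrier L" "b \<in> carrier L" "c \<in> carrier L" "a \<sqsubseteq> b"
  shows "a \<sqinter> c \<sqsubseteq> b \<sqinter> c"
proof (rule meet_le)
  show "a \<sqinter> c \<sqsubseteq> b"
    using meet_left[OF assms(1,3)] assms(4) by (rule le_trans) (simp_all add: assms)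
qed (simp_all add: assms meet_right)

lemma join_meet_distrib:
  assumes "a \<in> carrier L" "b \<in> carrier L" "c \<in> carrier L"
  shows "(a \<squnion> b) \<sqinter> c = (a \<sqinter> c) \<squnion> (b \<sqinter> c)"
  using meet_join_distrib[OF assms(3,1,2)] by (simp add: meet_comm[of _ c])

lemma join_mono:
  assumes "a \<in> carrier L" "b \<in> carrier L" "c \<in> carrier L" "d \<in> carrier L" "a \<sqsubseteq> c" "b \<sqsubseteq> d"
  shows "a \<squnion> b \<sqsubseteq> c \<squnion> d"
proof (rule join_le)
  show "a \<sqsubseteq> c \<squnion> d"
    using assms(5) join_left[OF assms(3,4)] by (rule le_trans) (simp_all add: assms)
  show "b \<sqsubseteq> c \<squnion> d"
    using assms(6) join_right[OF assms(3,4)] by (rule le_trans) (simp_all add: assms)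
qed (simp_all add: assms)

lemma lattice_ideal_principal:
  assumes "a \<in> carrier L"
  shows "lattice_ideal {b \<in> carrier L. b \<sqsubseteq> a}"
proof (rule lattice_idealI)
  fix b c assume "b \<in> {b \<in> carrier L. b \<sqsubseteq> a}" "c \<in> carrier L" "c \<sqsubseteq> b"
  then show "c \<in> {b \<in> carrier L. b \<sqsubseteq> a}"
    using assms le_trans[of c b a] by simp
qed (simp_all add: assms join_le)

text \<open>The lattice counterpart of an ideal quotient; distributivity gives closure under
  joins.\<close>

lemma lattice_ideal_residual:
  assumes J: "lattice_ideal J" and M: "M \<subseteq> carrier L"
  shows "lattice_ideal {b \<in> carrier L. \<forall>c \<in> M. b \<sqinter> c \<in> J}"
proof (rule lattice_idealI)
  have "\<bottom> \<sqinter> c \<in> J" if "c \<in> M" for c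
    using lattice_idealD(2)[OF J] bottom_meet[of c] that M by (auto simp: eq_is_equal)
  then show "\<bottom> \<in> {b \<in> carrier L. \<forall>c \<in> M. b \<sqinter> c \<in> J}"
    by simp
  fix a assume a: "a \<in> {b \<in> carrier L. \<forall>c \<in> M. b \<sqinter> c \<in> J}"
  show "a \<squnion> b \<in> {b \<in> carrier L. \<forall>c \<in> M. b \<sqinter> c \<in> J}"
    if b: "b \<in> {b \<in> carrier L. \<forall>c \<in> M. b \<sqinter> c \<in> J}" for b
    using a b M lattice_idealD(3)[OF J] by (auto simp: join_meet_distrib subset_iff)
  show "b \<in> {b \<in> carrier L. \<forall>c \<in> M. b \<sqinter> c \<in> J}" if b: "b \<in> carrier L" "b \<sqsubseteq> a" for b
  proof -
    have "b \<sqinter> c \<in> J" if "c \<in> M" for c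
    proof -
      have "b \<sqinter> c \<sqsubseteq> a \<sqinter> c" "a \<sqinter> c \<in> J" "b \<sqinter> c \<in> carrier L"
        using a b that M meet_mono_left[of b a c] by auto
      then show ?thesis
        using lattice_idealD(4)[OF J] by blast
    qed
    then show ?thesis
      using b(1) by simp
  qed
qed simp

lemma lattice_ideal_not_prime_filter:
  assumes P: "P \<in> prime_filters"
  shows "lattice_ideal {b \<in> carrier L. b \<notin> P}"
proof (rule lattice_idealI)
  fix a b
  assume "a \<in> {b \<in> carrier L. b \<notin> P}" "b \<in> {b \<in> carrier L. b \<notin> P}"
  then show "a \<squnion> b \<in> {b \<in> carrier L. b \<notin> P}"
    using prime_filterD(5)[OF P, of a b] by simp
next
  fix a b
  assume "a \<in> {b \<in> carrier L. b \<notin> P}" "b \<in> carrier L" "b \<sqsubseteq> a"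
  then show "b \<in> {b \<in> carrier L. b \<notin> P}"
    using prime_filter_up[OF P, of b a] by blast
qed (use prime_filterD(3)[OF P] in auto)

end

section \<open>Correspondence of radical ideals with lattice ideals\<close>

text \<open>Here \<open>d r\<close> plays the role of the compact open set of all primes not
  containing \<open>r\<close>; the last two axioms make the primes correspond to the prime filters of \<open>L\<close>.\<close>

locale lattice_support = bounded_distributive_lattice L + R: cring R
  for L :: "('a, 'm) gorder_scheme" (structure) and R :: "('r, 'k) ring_scheme" and d :: "'r \<Rightarrow> 'a" +
  assumes d_closed: "x \<in> carrier R \<Longrightarrow> d x \<in> carrier L"
    and d_zero: "d \<zero>\<^bsub>R\<^esub> = \<bottom>"
    and d_one: "d \<one>\<^bsub>R\<^esub> = \<top>"
    and d_mult: "\<lbrakk>x \<in> carrier R; y \<in> carrier R\<rbrakk> \<Longrightarrow> d (x \<otimes>\<^bsub>R\<^esub> y) = d x \<sqinter> d y"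
    and d_add: "\<lbrakk>x \<in> carrier R; y \<in> carrier R\<rbrakk> \<Longrightarrow> d (x \<oplus>\<^bsub>R\<^esub> y) \<sqsubseteq> d x \<squnion> d y"
    and d_surj: "a \<in> carrier L \<Longrightarrow> \<exists>x \<in> carrier R. d x = a"
    and d_combination: "\<lbrakk>x \<in> carrier R; y \<in> carrier R\<rbrakk> \<Longrightarrow>
      \<exists>s \<in> carrier R. \<exists>t \<in> carrier R. d (s \<otimes>\<^bsub>R\<^esub> x \<oplus>\<^bsub>R\<^esub> t \<otimes>\<^bsub>R\<^esub> y) = d x \<squnion> d y"
    and d_divides: "\<lbrakk>x \<in> carrier R; y \<in> carrier R; d x \<sqsubseteq> d y\<rbrakk> \<Longrightarrow>
      \<exists>n::nat. \<exists>t \<in> carrier R. x [^]\<^bsub>R\<^esub> n = t \<otimes>\<^bsub>R\<^esub> y"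
begin

text \<open>The combination provided by \<open>d_combination\<close> lies in the ideal generated by
  \<open>x\<close> and \<open>y\<close>; so every ideal realizes the joins of the supports of its
  elements.\<close>

lemma d_join:
  assumes "x \<in> carrier R" "y \<in> carrier R"
  shows "\<exists>z \<in> Idl\<^bsub>R\<^esub> {x, y}. d z = d x \<squnion> d y"
proof -
  obtain s t where st: "s \<in> carrier R" "t \<in> carrier R"
    "d (s \<otimes>\<^bsub>R\<^esub> x \<oplus>\<^bsub>R\<^esub> t \<otimes>\<^bsub>R\<^esub> y) = d x \<squnion> d y"
    using d_combination[OF assms] by blast
  have c: "{x, y} \<subseteq> carrier R"
    using assms by simp
  interpret ideal "Idl\<^bsub>R\<^esub> {x, y}" R
    using c by (rule R.genideal_ideal)
  have "x \<in> Idl\<^bsub>R\<^esub> {x, y}" "y \<in> Idl\<^bsub>R\<^esub> {x, y}"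
    using R.genideal_self[OF c] by simp_all
  then have "s \<otimes>\<^bsub>R\<^esub> x \<oplus>\<^bsub>R\<^esub> t \<otimes>\<^bsub>R\<^esub> y \<in> Idl\<^bsub>R\<^esub> {x, y}"
    using st by (intro a_closed I_l_closed)
  with st(3) show ?thesis by blast
qed

lemma d_power_le:
  assumes x: "x \<in> carrier R"
  shows "d x \<sqsubseteq> d (x [^]\<^bsub>R\<^esub> (n::nat))"
proof (induction n)
  case 0
  then show ?case
    using x by (simp add: d_one d_closed)
next
  case (Suc n)
  then show ?case
    using x by (simp add: d_mult d_closed meet_le)
qed

text \<open>The exponent is kept positive because the zeroth power has support
  \<open>\<top>\<close>.\<close>

lemma d_power_Suc:
  assumes x: "x \<in> carrier R"
  shows "d (x [^]\<^bsub>R\<^esub> Suc n) = d x"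
proof (rule le_antisym)
  show "d (x [^]\<^bsub>R\<^esub> Suc n) \<sqsubseteq> d x"
    using x by (simp add: d_mult d_closed meet_right)
qed (use x d_power_le[of x "Suc n"] in \<open>simp_all add: d_closed del: R.nat_pow_Suc\<close>)

text \<open>One more factor \<open>x\<close> makes the exponent positive, so that the power has the
  same support as \<open>x\<close>.\<close>

lemma d_divides_Suc:
  assumes "x \<in> carrier R" "y \<in> carrier R" "d x \<sqsubseteq> d y"
  obtains n t where "t \<in> carrier R" "x [^]\<^bsub>R\<^esub> Suc n = t \<otimes>\<^bsub>R\<^esub> y"
proof -
  obtain n :: nat and t where t: "t \<in> carrier R" "x [^]\<^bsub>R\<^esub> n = t \<otimes>\<^bsub>R\<^esub> y"
    using d_divides[OF assms] by blast
  have "x [^]\<^bsub>R\<^esub> Suc n = (t \<otimes>\<^bsub>R\<^esub> x) \<otimes>\<^bsub>R\<^esub> y"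
    using t assms(1,2) by (simp add: R.m_ac)
  then show thesis
    using that t(1) assms(1) by blast
qed

text \<open>Membership in a radical depends on supports only: \<open>d x\<close> lies below the
  support of every power of \<open>x\<close>, and \<open>d_divides\<close> turns a comparison of
  supports into a power inside the ideal.\<close>

lemma Rad_ideal:
  assumes I: "ideal I R"
  shows "Rad R I = {x \<in> carrier R. \<exists>y \<in> I. d x \<sqsubseteq> d y}"
proof (intro equalityI subsetI)
  interpret I: ideal I R by (rule I)
  fix x
  show "x \<in> {x \<in> carrier R. \<exists>y \<in> I. d x \<sqsubseteq> d y}" if "x \<in> Rad R I"
    using that d_power_le unfolding Rad_def by blast
  assume "x \<in> {x \<in> carrier R. \<exists>y \<in> I. d x \<sqsubseteq> d y}"
  then obtain y where x: "x \<in> carrier R" and y: "y \<in> I" "d x \<sqsubseteq> d y"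
    by blast
  then obtain n :: nat and t where "t \<in> carrier R" "x [^]\<^bsub>R\<^esub> n = t \<otimes>\<^bsub>R\<^esub> y"
    using d_divides[of x y] I.Icarr by blast
  then show "x \<in> Rad R I"
    using x I.I_l_closed[OF y(1)] unfolding Rad_def mem_Collect_eq by metis
qed

lemma lattice_ideal_of_ideal:
  assumes I: "ideal I R"
  shows "lattice_ideal {b \<in> carrier L. \<exists>y \<in> I. b \<sqsubseteq> d y}"
proof (rule lattice_idealI)
  interpret I: ideal I R by (rule I)
  show "\<bottom> \<in> {b \<in> carrier L. \<exists>y \<in> I. b \<sqsubseteq> d y}"
    using I.zero_closed d_zero by (auto intro!: bexI[of _ "\<zero>\<^bsub>R\<^esub>"])
  fix a assume a: "a \<in> {b \<in> carrier L. \<exists>y \<in> I. b \<sqsubseteq> d y}"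
  show "b \<in> {b \<in> carrier L. \<exists>y \<in> I. b \<sqsubseteq> d y}" if b: "b \<in> carrier L" "b \<sqsubseteq> a" for b
  proof -
    obtain y where "y \<in> I" "a \<sqsubseteq> d y"
      using a by blast
    then have "b \<sqsubseteq> d y"
      using a b le_trans[of b a "d y"] d_closed[OF I.Icarr] by simp
    then show ?thesis
      using b(1) \<open>y \<in> I\<close> by blast
  qed
  show "a \<squnion> b \<in> {b \<in> carrier L. \<exists>y \<in> I. b \<sqsubseteq> d y}"
    if b: "b \<in> {b \<in> carrier L. \<exists>y \<in> I. b \<sqsubseteq> d y}" for b
  proof -
    obtain x y where xy: "x \<in> I" "y \<in> I" "a \<sqsubseteq> d x" "b \<sqsubseteq> d y"
      using a b by blast
    then have c: "x \<in> carrier R" "y \<in> carrier R"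
      by (simp_all add: I.Icarr)
    then obtain z where z: "z \<in> Idl\<^bsub>R\<^esub> {x, y}" "d z = d x \<squnion> d y"
      using d_join by blast
    have "z \<in> I"
      using z(1) R.genideal_minimal[OF I, of "{x, y}"] xy by blast
    moreover have "a \<squnion> b \<sqsubseteq> d z"
      unfolding z(2) using a b xy c d_closed by (intro join_mono) auto
    moreover have "a \<squnion> b \<in> carrier L"
      using a b by simp
    ultimately show ?thesis
      by blast
  qed
qed simp

text \<open>\<open>d_add\<close> and \<open>d_mult\<close> make the preimage an ideal, and
  \<open>Rad_ideal\<close> makes it radical since \<open>J\<close> is downward closed. Further
  radical ideals are obtained by writing them in this form.\<close>

lemma radical_ideal_vimage:
  assumes J: "lattice_ideal J"
  shows "{x \<in> carrier R. d x \<in> J} \<in> radical_ideals R"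
proof -
  let ?I = "{x \<in> carrier R. d x \<in> J}"
  have mult: "x \<otimes>\<^bsub>R\<^esub> y \<in> ?I" if "x \<in> carrier R" "y \<in> ?I" for x y
    using that lattice_idealD(4)[OF J, of "d y" "d x \<sqinter> d y"]
    by (simp add: d_mult d_closed meet_right)
  have ideal: "ideal ?I R"
  proof (rule idealI[OF R.ring_axioms])
    show "subgroup ?I (add_monoid R)"
    proof (rule R.add.subgroupI)
      show "?I \<noteq> {}"
        using lattice_idealD(2)[OF J] d_zero by auto
      show "\<ominus>\<^bsub>R\<^esub> x \<in> ?I" if "x \<in> ?I" for x
        using mult[of "\<ominus>\<^bsub>R\<^esub> \<one>\<^bsub>R\<^esub>" x] that by (simp add: R.l_minus)
      show "x \<oplus>\<^bsub>R\<^esub> y \<in> ?I" if "x \<in> ?I" "y \<in> ?I" for x y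
      proof -
        have "d x \<squnion> d y \<in> J"
          using that lattice_idealD(3)[OF J] by blast
        then have "d (x \<oplus>\<^bsub>R\<^esub> y) \<in> J"
          using that lattice_idealD(4)[OF J _ _ d_add[of x y]] by (simp add: d_closed)
        then show ?thesis
          using that by simp
      qed
    qed auto
    show "x \<otimes>\<^bsub>R\<^esub> y \<in> ?I" if "y \<in> ?I" "x \<in> carrier R" for x y
      using that by (rule mult[rotated])
    show "y \<otimes>\<^bsub>R\<^esub> x \<in> ?I" if "y \<in> ?I" "x \<in> carrier R" for x y
      using mult[OF that(2,1)] that by (simp add: R.m_comm)
  qed
  have "Rad R ?I = ?I"
  proof
    show "Rad R ?I \<subseteq> ?I"
      unfolding Rad_ideal[OF ideal] using lattice_idealD(4)[OF J] d_closed by blast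
    show "?I \<subseteq> Rad R ?I"
      unfolding Rad_ideal[OF ideal] using d_closed le_refl by blast
  qed
  then show ?thesis
    using ideal by (simp add: radical_ideals_def)
qed

lemma radical_idealD:
  assumes "I \<in> radical_ideals R"
  shows "ideal I R" "I \<subseteq> carrier R"
    "\<lbrakk>x \<in> carrier R; y \<in> I; d x \<sqsubseteq> d y\<rbrakk> \<Longrightarrow> x \<in> I"
proof -
  show I: "ideal I R"
    using assms by (simp add: radical_ideals_def)
  then show "I \<subseteq> carrier R"
    by (meson ideal.Icarr subsetI)
  show "\<lbrakk>x \<in> carrier R; y \<in> I; d x \<sqsubseteq> d y\<rbrakk> \<Longrightarrow> x \<in> I"
    using assms Rad_ideal[OF I] unfolding radical_ideals_def by blast
qed

lemma radical_ideal_Rad: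
  assumes I: "ideal I R"
  shows "Rad R I \<in> radical_ideals R"
proof -
  have "Rad R I = {x \<in> carrier R. d x \<in> {b \<in> carrier L. \<exists>y \<in> I. b \<sqsubseteq> d y}}"
    using d_closed by (auto simp: Rad_ideal[OF I])
  then show ?thesis
    using radical_ideal_vimage[OF lattice_ideal_of_ideal[OF I]] by simp
qed

lemma Rad_minimal:
  assumes "ideal I R" "K \<in> radical_ideals R" "I \<subseteq> K"
  shows "Rad R I \<subseteq> K"
  using assms radical_idealD(3)[OF assms(2)] by (auto simp: Rad_ideal)

lemma subset_Rad:
  assumes "I \<subseteq> carrier R" shows "I \<subseteq> Rad R I"
proof
  fix x assume "x \<in> I"
  then have "x \<in> carrier R" "x [^]\<^bsub>R\<^esub> (1::nat) \<in> I"
    using assms by auto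
  then show "x \<in> Rad R I"
    unfolding Rad_def by blast
qed

text \<open>The inverse direction to taking preimages under \<open>d\<close>: by
  \<open>mem_radical_ideal_iff\<close> a radical ideal is the preimage of its lattice ideal.\<close>

definition lattice_ideal_of :: "'r set \<Rightarrow> 'a set" where
  "lattice_ideal_of I = {b \<in> carrier L. \<exists>y \<in> I. b \<sqsubseteq> d y}"

lemma mem_radical_ideal_iff:
  assumes "I \<in> radical_ideals R" "x \<in> carrier R"
  shows "x \<in> I \<longleftrightarrow> d x \<in> lattice_ideal_of I"
proof
  show "x \<in> I \<Longrightarrow> d x \<in> lattice_ideal_of I"
    using d_closed[OF assms(2)] le_refl unfolding lattice_ideal_of_def by blast
  show "d x \<in> lattice_ideal_of I \<Longrightarrow> x \<in> I"
    using radical_idealD(3)[OF assms(1,2)] unfolding lattice_ideal_of_def by blast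
qed

lemma lattice_ideal_of: "I \<in> radical_ideals R \<Longrightarrow> lattice_ideal (lattice_ideal_of I)"
  unfolding lattice_ideal_of_def using radical_idealD(1) lattice_ideal_of_ideal by blast

text \<open>Products have meets as supports, so the quotient is the preimage of a residual of
  lattice ideals.\<close>

lemma ideal_quotient_alt:
  assumes I: "I \<in> radical_ideals R" and J: "J \<in> radical_ideals R"
  shows "ideal_quotient R J I =
    {x \<in> carrier R. d x \<in> {b \<in> carrier L. \<forall>c \<in> d ` I. b \<sqinter> c \<in> lattice_ideal_of J}}"
proof -
  have "x \<otimes>\<^bsub>R\<^esub> y \<in> J \<longleftrightarrow> d x \<sqinter> d y \<in> lattice_ideal_of J" if "x \<in> carrier R" "y \<in> I" for x y
    using that radical_idealD(2)[OF I] by (auto simp: mem_radical_ideal_iff[OF J] d_mult)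
  then show ?thesis
    unfolding ideal_quotient_def using d_closed by auto
qed

lemma lattice_ideal_quotient:
  assumes I: "I \<in> radical_ideals R" and J: "J \<in> radical_ideals R"
  shows "lattice_ideal {b \<in> carrier L. \<forall>c \<in> d ` I. b \<sqinter> c \<in> lattice_ideal_of J}"
  using lattice_ideal_of[OF J] radical_idealD(2)[OF I] d_closed
  by (intro lattice_ideal_residual) auto

lemma radical_ideal_quotient:
  assumes I: "I \<in> radical_ideals R" and J: "J \<in> radical_ideals R"
  shows "ideal_quotient R J I \<in> radical_ideals R"
  unfolding ideal_quotient_alt[OF assms] by (rule radical_ideal_vimage[OF lattice_ideal_quotient[OF assms]])

section \<open>Primes, and the ideals representing lattice elements\<close>

lemma prime_of_prime_filter:
  assumes P: "P \<in> prime_filters"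
  shows "{x \<in> carrier R. d x \<notin> P} \<in> Spec R"
proof -
  have eq: "{x \<in> carrier R. d x \<notin> P} = {x \<in> carrier R. d x \<in> {b \<in> carrier L. b \<notin> P}}"
    using d_closed by auto
  have "primeideal {x \<in> carrier R. d x \<notin> P} R"
  proof (rule primeidealI[OF _ R.is_cring])
    show "ideal {x \<in> carrier R. d x \<notin> P} R"
      unfolding eq using radical_ideal_vimage[OF lattice_ideal_not_prime_filter[OF P]]
      by (simp add: radical_ideals_def)
    show "carrier R \<noteq> {x \<in> carrier R. d x \<notin> P}"
    proof -
      have "\<one>\<^bsub>R\<^esub> \<notin> {x \<in> carrier R. d x \<notin> P}"
        using prime_filterD(2)[OF P] d_one by simp
      then show ?thesis
        using R.one_closed by blast
    qed
    show "a \<in> {x \<in> carrier R. d x \<notin> P} \<or> b \<in> {x \<in> carrier R. d x \<notin> P}"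
      if "a \<in> carrier R" "b \<in> carrier R" "a \<otimes>\<^bsub>R\<^esub> b \<in> {x \<in> carrier R. d x \<notin> P}" for a b
      using that prime_filterD(4)[OF P, of "d a" "d b"] by (simp add: d_mult d_closed)
  qed
  then show ?thesis
    by (simp add: Spec_def)
qed

text \<open>The left side is the intersection of the primes containing \<open>I\<close>. If
  \<open>r\<close> is outside \<open>I\<close>, a prime filter containing \<open>d r\<close> and
  missing the lattice ideal of \<open>I\<close> gives a prime above \<open>I\<close> without
  \<open>r\<close>. The condition on \<open>F\<close> is restricted to primes so that it also covers
  an inverse formed by \<open>inv_into\<close>.\<close>

lemma spec_hat_identity:
  assumes F: "\<And>P. P \<in> Spec R \<Longrightarrow> F P = P" and I: "I \<in> radical_ideals R"
  shows "spec_hat R R F I = I"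
proof -
  have "spec_hat R R F I = {r \<in> carrier R. \<forall>P \<in> Spec R. I \<subseteq> P \<longrightarrow> r \<in> P}"
    unfolding spec_hat_def ideal_of_open_def open_of_ideal_def using F by auto
  also have "\<dots> = I"
  proof
    show "I \<subseteq> {r \<in> carrier R. \<forall>P \<in> Spec R. I \<subseteq> P \<longrightarrow> r \<in> P}"
      using radical_idealD(2)[OF I] by blast
    show "{r \<in> carrier R. \<forall>P \<in> Spec R. I \<subseteq> P \<longrightarrow> r \<in> P} \<subseteq> I"
    proof
      fix r assume r: "r \<in> {r \<in> carrier R. \<forall>P \<in> Spec R. I \<subseteq> P \<longrightarrow> r \<in> P}"
      show "r \<in> I"
      proof (rule ccontr)
        assume "r \<notin> I"
        let ?J = "lattice_ideal_of I"
        have J: "lattice_ideal ?J"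
          by (rule lattice_ideal_of[OF I])
        obtain Q where Q: "Q \<in> prime_filters" "{d r} \<subseteq> Q" "?J \<inter> Q = {}"
        proof (rule prime_filter_separation[of "{d r}" ?J])
          show "{d r} \<subseteq> carrier L" "{d r} \<noteq> {}" "?J \<subseteq> carrier L" "?J \<noteq> {}"
            using r d_closed lattice_idealD(1,2)[OF J] by auto
          show "\<exists>z\<in>{d r}. z \<sqsubseteq> x \<and> z \<sqsubseteq> y" if "x \<in> {d r}" "y \<in> {d r}" for x y
            using that r d_closed by auto
          show "\<exists>z\<in>?J. x \<sqsubseteq> z \<and> y \<sqsubseteq> z" if "x \<in> ?J" "y \<in> ?J" for x y
          proof -
            have "x \<in> carrier L" "y \<in> carrier L"
              using that lattice_idealD(1)[OF J] by auto
            then show ?thesis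
              using lattice_idealD(3)[OF J that] join_left[of x y] join_right[of x y] by blast
          qed
          show "\<not> x \<sqsubseteq> z" if "x \<in> {d r}" "z \<in> ?J" for x z
            using that lattice_idealD(4)[OF J, of z "d r"] \<open>r \<notin> I\<close> r mem_radical_ideal_iff[OF I, of r] d_closed
            by auto
        qed
        have "I \<subseteq> {x \<in> carrier R. d x \<notin> Q}"
          using Q(3) mem_radical_ideal_iff[OF I] radical_idealD(2)[OF I] by blast
        then have "r \<in> {x \<in> carrier R. d x \<notin> Q}"
          using r prime_of_prime_filter[OF Q(1)] by blast
        then show False
          using Q(2) by simp
      qed
    qed
  qed
  finally show ?thesis .
qed

text \<open>The image of \<open>a\<close> under the embedding: the radical of the principal ideal of
  any \<open>x\<close> with \<open>d x = a\<close>.\<close>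

definition basic_ideal :: "'a \<Rightarrow> 'r set" where
  "basic_ideal a = {x \<in> carrier R. d x \<sqsubseteq> a}"

lemma basic_ideal_radical:
  assumes "a \<in> carrier L"
  shows "basic_ideal a \<in> radical_ideals R"
proof -
  have "basic_ideal a = {x \<in> carrier R. d x \<in> {b \<in> carrier L. b \<sqsubseteq> a}}"
    using d_closed by (auto simp: basic_ideal_def)
  then show ?thesis
    using radical_ideal_vimage[OF lattice_ideal_principal[OF assms]] by simp
qed

lemma basic_ideal_subset:
  assumes "I \<in> radical_ideals R" "x \<in> I"
  shows "basic_ideal (d x) \<subseteq> I"
  using radical_idealD(3)[OF assms(1) _ assms(2)] by (auto simp: basic_ideal_def)

lemma basic_ideal_mono_iff:
  assumes "a \<in> carrier L" "b \<in> carrier L"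
  shows "basic_ideal a \<subseteq> basic_ideal b \<longleftrightarrow> a \<sqsubseteq> b"
proof
  assume *: "basic_ideal a \<subseteq> basic_ideal b"
  obtain x where "x \<in> carrier R" "d x = a"
    using d_surj assms by blast
  then show "a \<sqsubseteq> b"
    using * le_refl[OF assms(1)] unfolding basic_ideal_def by blast
next
  assume "a \<sqsubseteq> b"
  then show "basic_ideal a \<subseteq> basic_ideal b"
    using assms d_closed le_trans[of _ a b] unfolding basic_ideal_def by blast
qed

end

section \<open>Order properties of nabla\<close>

sublocale distributive_nabla_algebra \<subseteq> bounded_distributive_lattice A
  by unfold_locales (rule meet_join_distrib)

context nabla_algebra
begin

lemma meet_top: "a \<in> carrier A \<Longrightarrow> a \<sqinter> \<top> = a"
  using top_meet[of a] meet_comm[of A a \<top>] by (simp add: eq_is_equal)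

text \<open>Residuation at \<open>\<top>\<close> exhibits \<open>\<nabla>\<close> as a left adjoint,
  whence it preserves \<open>\<bottom>\<close> and joins.\<close>

lemma nabla_le_iff:
  assumes "a \<in> carrier A" "b \<in> carrier A"
  shows "\<nabla> a \<sqsubseteq> b \<longleftrightarrow> a \<sqsubseteq> \<top> \<leadsto> b"
  using residuation[of \<top> b a] assms by (simp add: meet_top nabla_closed)

lemma nabla_bottom: "\<nabla> \<bottom> = \<bottom>"
proof (rule bottom_eq)
  show "\<nabla> \<bottom> \<in> carrier A"
    by (simp add: nabla_closed)
  show "\<nabla> \<bottom> \<sqsubseteq> x" if "x \<in> carrier A" for x
    using that by (simp add: nabla_le_iff nimp_closed)
qed

lemma nabla_join_le:
  assumes "a \<in> carrier A" "b \<in> carrier A"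
  shows "\<nabla> (a \<squnion> b) \<sqsubseteq> \<nabla> a \<squnion> \<nabla> b"
proof -
  have "\<nabla> a \<sqsubseteq> \<nabla> a \<squnion> \<nabla> b" "\<nabla> b \<sqsubseteq> \<nabla> a \<squnion> \<nabla> b"
    using assms by (simp_all add: join_left join_right nabla_closed)
  then show ?thesis
    using assms by (simp add: nabla_le_iff nabla_closed nimp_closed join_le)
qed

text \<open>Fullness writes \<open>b\<close> as \<open>\<top> \<leadsto> c\<close>. Then
  \<open>\<nabla> b \<sqsubseteq> c\<close> by adjointness, and
  \<open>\<nabla> a \<sqsubseteq> c\<close> transposes back to
  \<open>a \<sqsubseteq> b\<close>.\<close>

lemma full_imp_nabla_order_reflecting:
  assumes "full_nabla_algebra A" "a \<in> carrier A" "b \<in> carrier A" "\<nabla> a \<sqsubseteq> \<nabla> b"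
  shows "a \<sqsubseteq> b"
proof -
  obtain c where c: "c \<in> carrier A" "b = \<top> \<leadsto> c"
    using assms(1,3) unfolding full_nabla_algebra_def by blast
  have "\<nabla> b \<sqsubseteq> c"
    using c assms(3) le_refl[OF assms(3)] nabla_le_iff by simp
  then have "\<nabla> a \<sqsubseteq> c"
    using le_trans[OF assms(4), of c] assms(2,3) c(1) nabla_closed by simp
  then show ?thesis
    using c assms(2) nabla_le_iff by simp
qed

end

context normal_nabla_algebra
begin

lemma nabla_mono:
  assumes "a \<in> carrier A" "b \<in> carrier A" "a \<sqsubseteq> b"
  shows "\<nabla> a \<sqsubseteq> \<nabla> b"
proof -
  have "a = a \<sqinter> b"
    using assms le_iff_join by blast
  then have "\<nabla> a = \<nabla> a \<sqinter> \<nabla> b"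
    using nabla_meet[OF assms(1,2)] by simp
  then show ?thesis
    using iffD2[OF le_iff_join[of "\<nabla> a" "\<nabla> b"]] assms(1,2) nabla_closed by simp
qed

lemma nabla_join:
  assumes "a \<in> carrier A" "b \<in> carrier A"
  shows "\<nabla> (a \<squnion> b) = \<nabla> a \<squnion> \<nabla> b"
proof (rule le_antisym)
  show "\<nabla> a \<squnion> \<nabla> b \<sqsubseteq> \<nabla> (a \<squnion> b)"
    using assms by (simp add: join_le nabla_mono nabla_closed join_left join_right)
qed (simp_all add: assms nabla_join_le nabla_closed)

end

section \<open>The semi-dynamic ring attached to a support map\<close>

locale supported_nabla_algebra =
  distributive_nabla_algebra A + normal_nabla_algebra A + lattice_support A R d
  for A :: "('a, 'm) nabla_algebra_scheme" (structure) and R :: "'r ring" and d :: "'r \<Rightarrow> 'a" +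
  fixes \<pi> :: "'r \<Rightarrow> 'r"
  assumes \<pi>_hom: "\<pi> \<in> ring_hom R R"
    and d_\<pi>: "x \<in> carrier R \<Longrightarrow> d (\<pi> x) = \<nabla> (d x)"
begin

lemma \<pi>_closed: "x \<in> carrier R \<Longrightarrow> \<pi> x \<in> carrier R"
  using ring_hom_closed[OF \<pi>_hom] .

definition D :: "('r, 'r) semi_dynamic_ring" where
  "D = \<lparr>dom_ring = R, cod_ring = R, ring_map = \<pi>, spec_map = id\<rparr>"

lemma semi_dynamic_ring_D: "semi_dynamic_ring D"
  using R.is_cring \<pi>_hom by (simp add: semi_dynamic_ring_def D_def)

lemma push_radical:
  assumes "I \<in> radical_ideals R"
  shows "push_ideal R \<pi> I \<in> radical_ideals R"
  unfolding push_ideal_def using radical_idealD(2)[OF assms] \<pi>_closed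
  by (intro radical_ideal_Rad R.genideal_ideal) blast

text \<open>A radical ideal contains the generated radical ideal as soon as it contains the
  generators; this adjunction is behind residuation in \<open>Al D\<close>.\<close>

lemma push_subset_iff:
  assumes "I \<in> radical_ideals R" "K \<in> radical_ideals R"
  shows "push_ideal R \<pi> I \<subseteq> K \<longleftrightarrow> \<pi> ` I \<subseteq> K"
proof
  have c: "\<pi> ` I \<subseteq> carrier R"
    using radical_idealD(2)[OF assms(1)] \<pi>_closed by blast
  have id: "ideal (Idl\<^bsub>R\<^esub> (\<pi> ` I)) R"
    using c by (rule R.genideal_ideal)
  show "\<pi> ` I \<subseteq> K \<Longrightarrow> push_ideal R \<pi> I \<subseteq> K"
    unfolding push_ideal_def
    using Rad_minimal[OF id assms(2)] R.genideal_minimal[OF radical_idealD(1)[OF assms(2)]] by blast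
  have "Idl\<^bsub>R\<^esub> (\<pi> ` I) \<subseteq> carrier R"
    using ideal.Icarr[OF id] by blast
  then have "\<pi> ` I \<subseteq> push_ideal R \<pi> I"
    unfolding push_ideal_def using R.genideal_self[OF c] subset_Rad by blast
  then show "push_ideal R \<pi> I \<subseteq> K \<Longrightarrow> \<pi> ` I \<subseteq> K"
    by blast
qed

lemma nabla_Al:
  assumes "I \<in> radical_ideals R"
  shows "\<nabla>\<^bsub>Al D\<^esub> I = push_ideal R \<pi> I"
  using spec_hat_identity[OF _ push_radical[OF assms], of id] by (simp add: Al_def D_def)

text \<open>The inverse comes from \<open>inv_into\<close>, so it is computed on primes
  only.\<close>

lemma spec_map_inv_D:
  assumes "P \<in> Spec R"
  shows "spec_map_inv D P = P"
  using inv_into_f_f[of id "Spec R" P] assms by (simp add: spec_map_inv_def D_def)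

lemma nimp_Al:
  assumes "I \<in> radical_ideals R" "J \<in> radical_ideals R"
  shows "I \<leadsto>\<^bsub>Al D\<^esub> J = {x \<in> carrier R. \<pi> x \<in> ideal_quotient R J I}"
proof -
  have "spec_hat R R (spec_map_inv D) (ideal_quotient R J I) = ideal_quotient R J I"
    using spec_map_inv_D radical_ideal_quotient[OF assms] by (rule spec_hat_identity)
  then show ?thesis
    by (simp add: Al_def) (simp add: D_def)
qed

lemma Al_simps:
  "carrier (Al D) = radical_ideals R" "I \<sqsubseteq>\<^bsub>Al D\<^esub> J \<longleftrightarrow> I \<subseteq> J" "I .=\<^bsub>Al D\<^esub> J \<longleftrightarrow> I = J"
  by (simp_all add: Al_def D_def)

text \<open>\<open>\<nabla>\<close> preserves \<open>\<bottom>\<close>, joins and order, so lattice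
  ideals pull back along it, and \<open>d_\<pi>\<close> moves the pullback to the ring.\<close>

lemma radical_ideal_vimage_\<pi>:
  assumes J: "lattice_ideal J"
  shows "{x \<in> carrier R. d (\<pi> x) \<in> J} \<in> radical_ideals R"
proof -
  have "lattice_ideal {a \<in> carrier A. \<nabla> a \<in> J}"
  proof (rule lattice_idealI)
    show "\<bottom> \<in> {a \<in> carrier A. \<nabla> a \<in> J}"
      using lattice_idealD(2)[OF J] by (simp add: nabla_bottom)
    fix a b assume a: "a \<in> {a \<in> carrier A. \<nabla> a \<in> J}"
    show "b \<in> {a \<in> carrier A. \<nabla> a \<in> J} \<Longrightarrow> a \<squnion> b \<in> {a \<in> carrier A. \<nabla> a \<in> J}"
      using a lattice_idealD(3)[OF J, of "\<nabla> a" "\<nabla> b"] by (simp add: nabla_join)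
    show "b \<in> {a \<in> carrier A. \<nabla> a \<in> J}" if "b \<in> carrier A" "b \<sqsubseteq> a"
      using a that lattice_idealD(4)[OF J, of "\<nabla> a" "\<nabla> b"] by (simp add: nabla_mono nabla_closed)
  qed simp
  then have "{x \<in> carrier R. d x \<in> {a \<in> carrier A. \<nabla> a \<in> J}} \<in> radical_ideals R"
    by (rule radical_ideal_vimage)
  moreover have "{x \<in> carrier R. d (\<pi> x) \<in> J} = {x \<in> carrier R. d x \<in> {a \<in> carrier A. \<nabla> a \<in> J}}"
    using d_closed d_\<pi> by auto
  ultimately show ?thesis
    by simp
qed

lemma nimp_radical:
  assumes "I \<in> radical_ideals R" "J \<in> radical_ideals R"
  shows "I \<leadsto>\<^bsub>Al D\<^esub> J \<in> radical_ideals R"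
proof -
  have "I \<leadsto>\<^bsub>Al D\<^esub> J
      = {x \<in> carrier R. d (\<pi> x) \<in> {b \<in> carrier A. \<forall>c \<in> d ` I. b \<sqinter> c \<in> lattice_ideal_of J}}"
    unfolding nimp_Al[OF assms] ideal_quotient_alt[OF assms] using \<pi>_closed by blast
  then show ?thesis
    using radical_ideal_vimage_\<pi>[OF lattice_ideal_quotient[OF assms]] by simp
qed

lemma radical_ideal_Int:
  assumes I: "I \<in> radical_ideals R" and J: "J \<in> radical_ideals R"
  shows "I \<inter> J \<in> radical_ideals R"
proof -
  have "ideal (I \<inter> J) R"
    by (intro R.i_intersect radical_idealD(1) I J)
  moreover have "Rad R (I \<inter> J) = I \<inter> J"
  proof -
    have "Rad R (I \<inter> J) \<subseteq> Rad R I \<inter> Rad R J"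
      unfolding Rad_def by blast
    then have "Rad R (I \<inter> J) \<subseteq> I \<inter> J"
      using I J by (simp add: radical_ideals_def)
    moreover have "I \<inter> J \<subseteq> Rad R (I \<inter> J)"
      using radical_idealD(2)[OF I] by (intro subset_Rad) blast
    ultimately show ?thesis
      by blast
  qed
  ultimately show ?thesis
    by (simp add: radical_ideals_def)
qed

lemma radical_ideal_join:
  assumes I: "I \<in> radical_ideals R" and J: "J \<in> radical_ideals R"
  shows "Rad R (Idl\<^bsub>R\<^esub> (I \<union> J)) \<in> radical_ideals R" "I \<union> J \<subseteq> Rad R (Idl\<^bsub>R\<^esub> (I \<union> J))"
    "\<lbrakk>K \<in> radical_ideals R; I \<union> J \<subseteq> K\<rbrakk> \<Longrightarrow> Rad R (Idl\<^bsub>R\<^esub> (I \<union> J)) \<subseteq> K"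
proof -
  have c: "I \<union> J \<subseteq> carrier R"
    using radical_idealD(2) I J by blast
  have id: "ideal (Idl\<^bsub>R\<^esub> (I \<union> J)) R"
    using c by (rule R.genideal_ideal)
  show "Rad R (Idl\<^bsub>R\<^esub> (I \<union> J)) \<in> radical_ideals R"
    using id by (rule radical_ideal_Rad)
  have "Idl\<^bsub>R\<^esub> (I \<union> J) \<subseteq> carrier R"
    using ideal.Icarr[OF id] by blast
  then show "I \<union> J \<subseteq> Rad R (Idl\<^bsub>R\<^esub> (I \<union> J))"
    using R.genideal_self[OF c] subset_Rad by blast
  show "\<lbrakk>K \<in> radical_ideals R; I \<union> J \<subseteq> K\<rbrakk> \<Longrightarrow> Rad R (Idl\<^bsub>R\<^esub> (I \<union> J)) \<subseteq> K"
    using Rad_minimal[OF id] R.genideal_minimal[OF radical_idealD(1)] by blast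
qed

text \<open>\<open>K\<close> is left arbitrary so that the lemma fits both the radical of a sum and
  \<open>basic_ideal (a \<squnion> b)\<close>.\<close>

lemma Al_lub:
  assumes "I \<in> radical_ideals R" "J \<in> radical_ideals R" "K \<in> radical_ideals R" "I \<union> J \<subseteq> K"
    "\<And>M. M \<in> radical_ideals R \<Longrightarrow> I \<union> J \<subseteq> M \<Longrightarrow> K \<subseteq> M"
  shows "least (Al D) K (Upper (Al D) {I, J})"
proof (rule least_UpperI)
  show "x \<sqsubseteq>\<^bsub>Al D\<^esub> K" if "x \<in> {I, J}" for x
    using assms(4) that by (auto simp: Al_simps)
  show "K \<sqsubseteq>\<^bsub>Al D\<^esub> y" if "y \<in> Upper (Al D) {I, J}" for y
    using assms(1,2) assms(5)[of y] that by (auto simp: Al_simps Upper_def)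
qed (use assms in \<open>simp_all add: Al_simps\<close>)

lemma Al_glb:
  assumes "I \<in> radical_ideals R" "J \<in> radical_ideals R"
  shows "greatest (Al D) (I \<inter> J) (Lower (Al D) {I, J})"
proof (rule greatest_LowerI)
  show "I \<inter> J \<sqsubseteq>\<^bsub>Al D\<^esub> x" if "x \<in> {I, J}" for x
    using that by (auto simp: Al_simps)
  show "y \<sqsubseteq>\<^bsub>Al D\<^esub> I \<inter> J" if "y \<in> Lower (Al D) {I, J}" for y
    using assms that by (auto simp: Al_simps Lower_def)
qed (use assms radical_ideal_Int in \<open>simp_all add: Al_simps\<close>)

lemma bounded_lattice_Al: "bounded_lattice (Al D)"
proof -
  interpret partial_order "Al D"
    by unfold_locales (auto simp: Al_simps fun_eq_iff)
  interpret lattice "Al D"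
  proof unfold_locales
    fix I J assume "I \<in> carrier (Al D)" "J \<in> carrier (Al D)"
    then have IJ: "I \<in> radical_ideals R" "J \<in> radical_ideals R"
      by (simp_all add: Al_simps)
    show "\<exists>K. least (Al D) K (Upper (Al D) {I, J})"
      using Al_lub[OF IJ radical_ideal_join[OF IJ]] by blast
    show "\<exists>K. greatest (Al D) K (Lower (Al D) {I, J})"
      using Al_glb[OF IJ] by blast
  qed
  show ?thesis
  proof unfold_locales
    \<comment> \<open>The bottom element is the nilradical: every radical ideal contains zero, whose
      support is \<open>\<bottom>\<close>.\<close>
    have "basic_ideal \<bottom> \<subseteq> I" if "I \<in> radical_ideals R" for I
      using basic_ideal_subset[OF that, of "\<zero>\<^bsub>R\<^esub>"] radical_idealD(1)[OF that]
      by (simp add: d_zero additive_subgroup.zero_closed ideal.axioms(1))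
    then show "\<exists>I. least (Al D) I (carrier (Al D))"
      unfolding least_def Al_simps using basic_ideal_radical[OF bottom_closed] by blast
    have "I \<subseteq> basic_ideal \<top>" if "I \<in> radical_ideals R" for I
      using radical_idealD(2)[OF that] d_closed by (auto simp: basic_ideal_def)
    then show "\<exists>I. greatest (Al D) I (carrier (Al D))"
      unfolding greatest_def Al_simps using basic_ideal_radical[OF top_closed] by blast
  qed
qed

sublocale Al: bounded_lattice "Al D"
  by (rule bounded_lattice_Al)

lemma Al_meet:
  assumes "I \<in> radical_ideals R" "J \<in> radical_ideals R"
  shows "I \<sqinter>\<^bsub>Al D\<^esub> J = I \<inter> J"
proof (rule Al.meetI)
  show "K = I \<inter> J" if "greatest (Al D) K (Lower (Al D) {I, J})" for K
    using Al.weak_greatest_unique[OF that Al_glb[OF assms]] by (simp add: Al_simps)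
qed (use assms in \<open>simp_all add: Al_simps\<close>)

lemma Al_join:
  assumes "I \<in> radical_ideals R" "J \<in> radical_ideals R" "least (Al D) K (Upper (Al D) {I, J})"
  shows "I \<squnion>\<^bsub>Al D\<^esub> J = K"
proof (rule Al.joinI)
  show "M = K" if "least (Al D) M (Upper (Al D) {I, J})" for M
    using Al.weak_least_unique[OF that assms(3)] by (simp add: Al_simps)
qed (use assms in \<open>simp_all add: Al_simps\<close>)

lemma nabla_algebra_Al: "nabla_algebra (Al D)"
proof unfold_locales
  show "\<nabla>\<^bsub>Al D\<^esub> I \<in> carrier (Al D)" if "I \<in> carrier (Al D)" for I
    using that nabla_Al push_radical by (simp add: Al_simps)
  show "I \<leadsto>\<^bsub>Al D\<^esub> J \<in> carrier (Al D)" if "I \<in> carrier (Al D)" "J \<in> carrier (Al D)" for I J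
    using that nimp_radical by (simp add: Al_simps)
  fix I J K assume "I \<in> carrier (Al D)" "J \<in> carrier (Al D)" "K \<in> carrier (Al D)"
  then have I: "I \<in> radical_ideals R" and J: "J \<in> radical_ideals R" and K: "K \<in> radical_ideals R"
    by (simp_all add: Al_simps)
  let ?Q = "ideal_quotient R J I"
  have Q: "?Q \<in> radical_ideals R"
    using I J by (rule radical_ideal_quotient)
  \<comment> \<open>For radical ideals the quotient is the Heyting implication. Products of elements
    of the two ideals lie in both, and conversely an element of both has its square in
    \<open>J\<close>.\<close>
  have "push_ideal R \<pi> K \<inter> I \<subseteq> J \<longleftrightarrow> push_ideal R \<pi> K \<subseteq> ?Q"
  proof
    note P = push_radical[OF K]
    assume *: "push_ideal R \<pi> K \<inter> I \<subseteq> J"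
    show "push_ideal R \<pi> K \<subseteq> ?Q"
    proof
      fix x assume x: "x \<in> push_ideal R \<pi> K"
      have "x \<otimes>\<^bsub>R\<^esub> y \<in> J" if y: "y \<in> I" for y
      proof -
        have c: "x \<in> carrier R" "y \<in> carrier R"
          using x y radical_idealD(2) P I by blast+
        have "x \<otimes>\<^bsub>R\<^esub> y \<in> push_ideal R \<pi> K" "x \<otimes>\<^bsub>R\<^esub> y \<in> I"
          using ideal.I_r_closed[OF radical_idealD(1)[OF P] x c(2)]
            ideal.I_l_closed[OF radical_idealD(1)[OF I] y c(1)] by auto
        then show ?thesis
          using * by blast
      qed
      then show "x \<in> ?Q"
        using x radical_idealD(2)[OF P] unfolding ideal_quotient_def by blast
    qed
  next
    assume *: "push_ideal R \<pi> K \<subseteq> ?Q"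
    show "push_ideal R \<pi> K \<inter> I \<subseteq> J"
    proof
      fix x assume "x \<in> push_ideal R \<pi> K \<inter> I"
      then have "x \<otimes>\<^bsub>R\<^esub> x \<in> J" "x \<in> carrier R"
        using * unfolding ideal_quotient_def by blast+
      moreover from this have "d x \<sqsubseteq> d (x \<otimes>\<^bsub>R\<^esub> x)"
        by (simp add: d_mult d_closed meet_le)
      ultimately show "x \<in> J"
        using radical_idealD(3)[OF J] by blast
    qed
  qed
  also have "\<dots> \<longleftrightarrow> K \<subseteq> I \<leadsto>\<^bsub>Al D\<^esub> J"
    unfolding push_subset_iff[OF K Q] nimp_Al[OF I J] using radical_idealD(2)[OF K] by blast
  finally show "\<nabla>\<^bsub>Al D\<^esub> K \<sqinter>\<^bsub>Al D\<^esub> I \<sqsubseteq>\<^bsub>Al D\<^esub> J \<longleftrightarrow> K \<sqsubseteq>\<^bsub>Al D\<^esub> I \<leadsto>\<^bsub>Al D\<^esub> J"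
    by (simp add: nabla_Al[OF K] Al_meet[OF push_radical[OF K] I] Al_simps)
qed

section \<open>The embedding and its compatibility with the operations\<close>

text \<open>If \<open>d x = a\<close>, then \<open>\<pi> x\<close> has support
  \<open>\<nabla> a\<close>, and a radical ideal contains everything supported below one of its
  elements.\<close>

lemma push_basic_ideal:
  assumes a: "a \<in> carrier A"
  shows "push_ideal R \<pi> (basic_ideal a) = basic_ideal (\<nabla> a)"
proof
  have a': "\<nabla> a \<in> carrier A"
    using a by (rule nabla_closed)
  show "push_ideal R \<pi> (basic_ideal a) \<subseteq> basic_ideal (\<nabla> a)"
    unfolding push_subset_iff[OF basic_ideal_radical[OF a] basic_ideal_radical[OF a']]
    using a by (auto simp: basic_ideal_def \<pi>_closed d_\<pi> d_closed nabla_mono)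
  obtain x where x: "x \<in> carrier R" "d x = a"
    using d_surj[OF a] by blast
  then have "x \<in> basic_ideal a"
    using a by (simp add: basic_ideal_def)
  then have "\<pi> x \<in> push_ideal R \<pi> (basic_ideal a)"
    using push_subset_iff[OF basic_ideal_radical[OF a] push_radical[OF basic_ideal_radical[OF a]]]
    by blast
  then show "basic_ideal (\<nabla> a) \<subseteq> push_ideal R \<pi> (basic_ideal a)"
    using basic_ideal_subset[OF push_radical[OF basic_ideal_radical[OF a]]] x d_\<pi> by metis
qed

text \<open>Membership in the quotient can be tested on one \<open>y\<close> with
  \<open>d y = a\<close>. For elements \<open>\<pi> x\<close> the resulting condition is
  \<open>\<nabla> (d x) \<sqinter> a \<sqsubseteq> b\<close>, to which residuation applies.\<close>

lemma nimp_basic_ideal: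
  assumes a: "a \<in> carrier A" and b: "b \<in> carrier A"
  shows "basic_ideal a \<leadsto>\<^bsub>Al D\<^esub> basic_ideal b = basic_ideal (a \<leadsto> b)"
proof -
  have quot: "x \<in> ideal_quotient R (basic_ideal b) (basic_ideal a) \<longleftrightarrow> d x \<sqinter> a \<sqsubseteq> b"
    if x: "x \<in> carrier R" for x
  proof
    obtain y where y: "y \<in> carrier R" "d y = a"
      using d_surj[OF a] by blast
    assume "x \<in> ideal_quotient R (basic_ideal b) (basic_ideal a)"
    then have "x \<otimes>\<^bsub>R\<^esub> y \<in> basic_ideal b"
      using y a by (simp add: ideal_quotient_def basic_ideal_def)
    then show "d x \<sqinter> a \<sqsubseteq> b"
      using x y by (simp add: basic_ideal_def d_mult)
  next
    assume *: "d x \<sqinter> a \<sqsubseteq> b"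
    have "d x \<sqinter> d y \<sqsubseteq> b" if y: "y \<in> carrier R" "d y \<sqsubseteq> a" for y
    proof (rule le_trans[OF _ *])
      show "d x \<sqinter> d y \<sqsubseteq> d x \<sqinter> a"
        using meet_mono_left[of "d y" a "d x"] x y a d_closed by (simp add: meet_comm[of A "d x"])
    qed (use x y a b d_closed in simp_all)
    then show "x \<in> ideal_quotient R (basic_ideal b) (basic_ideal a)"
      using x by (simp add: ideal_quotient_def basic_ideal_def d_mult)
  qed
  show ?thesis
    unfolding nimp_Al[OF basic_ideal_radical[OF a] basic_ideal_radical[OF b]]
    using a b quot \<pi>_closed by (auto simp: d_\<pi> d_closed residuation basic_ideal_def[of "a \<leadsto> b"])
qed

lemma join_basic_ideal:
  assumes a: "a \<in> carrier A" and b: "b \<in> carrier A"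
  shows "basic_ideal a \<squnion>\<^bsub>Al D\<^esub> basic_ideal b = basic_ideal (a \<squnion> b)"
proof (rule Al_join, rule_tac[3] Al_lub)
  show "basic_ideal a \<union> basic_ideal b \<subseteq> basic_ideal (a \<squnion> b)"
    using a b by (simp add: basic_ideal_mono_iff join_left join_right)
  fix M assume M: "M \<in> radical_ideals R" "basic_ideal a \<union> basic_ideal b \<subseteq> M"
  obtain x y where xy: "x \<in> carrier R" "d x = a" "y \<in> carrier R" "d y = b"
    using d_surj[OF a] d_surj[OF b] by blast
  then have "{x, y} \<subseteq> M"
    using M(2) a b by (auto simp: basic_ideal_def)
  then have "Idl\<^bsub>R\<^esub> {x, y} \<subseteq> M"
    using R.genideal_minimal[OF radical_idealD(1)[OF M(1)]] by blast
  moreover obtain z where z: "z \<in> Idl\<^bsub>R\<^esub> {x, y}" "d z = a \<squnion> b"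
    using d_join[OF xy(1,3)] xy by blast
  ultimately show "basic_ideal (a \<squnion> b) \<subseteq> M"
    using basic_ideal_subset[OF M(1), of z] by auto
qed (simp_all add: a b basic_ideal_radical)

lemma basic_ideal_morphism: "nabla_algebra_morphism A (Al D) basic_ideal"
  unfolding nabla_algebra_morphism_def
proof (intro conjI ballI)
  show "nabla_algebra A" "nabla_algebra (Al D)"
    by (rule nabla_algebra_axioms nabla_algebra_Al)+
  show "basic_ideal \<in> carrier A \<rightarrow> carrier (Al D)"
    by (simp add: Al_simps basic_ideal_radical)
  show "basic_ideal \<bottom> = \<bottom>\<^bsub>Al D\<^esub>"
  proof (rule Al.bottom_eq)
    show "basic_ideal \<bottom> \<sqsubseteq>\<^bsub>Al D\<^esub> I" if "I \<in> carrier (Al D)" for I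
      using that basic_ideal_subset[of I "\<zero>\<^bsub>R\<^esub>"] radical_idealD(1)[of I]
      by (simp add: Al_simps d_zero additive_subgroup.zero_closed ideal.axioms(1))
  qed (simp add: Al_simps basic_ideal_radical)
  show "basic_ideal \<top> = \<top>\<^bsub>Al D\<^esub>"
  proof (rule Al.top_eq)
    show "I \<sqsubseteq>\<^bsub>Al D\<^esub> basic_ideal \<top>" if "I \<in> carrier (Al D)" for I
      using that radical_idealD(2)[of I] d_closed by (auto simp: Al_simps basic_ideal_def)
  qed (simp add: Al_simps basic_ideal_radical)
  fix a assume a: "a \<in> carrier A"
  show "basic_ideal (\<nabla> a) = \<nabla>\<^bsub>Al D\<^esub> (basic_ideal a)"
    using a by (simp add: nabla_Al basic_ideal_radical push_basic_ideal)
  fix b assume b: "b \<in> carrier A"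
  show "basic_ideal (a \<leadsto> b) = basic_ideal a \<leadsto>\<^bsub>Al D\<^esub> basic_ideal b"
    using a b by (simp add: nimp_basic_ideal)
  show "basic_ideal (a \<squnion> b) = basic_ideal a \<squnion>\<^bsub>Al D\<^esub> basic_ideal b"
    using a b by (simp add: join_basic_ideal)
  have "basic_ideal (a \<sqinter> b) = basic_ideal a \<inter> basic_ideal b"
  proof
    show "basic_ideal (a \<sqinter> b) \<subseteq> basic_ideal a \<inter> basic_ideal b"
      using a b by (simp add: basic_ideal_mono_iff meet_left meet_right)
    show "basic_ideal a \<inter> basic_ideal b \<subseteq> basic_ideal (a \<sqinter> b)"
      using a b d_closed meet_le by (auto simp: basic_ideal_def)
  qed
  then show "basic_ideal (a \<sqinter> b) = basic_ideal a \<sqinter>\<^bsub>Al D\<^esub> basic_ideal b"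
    using a b by (simp add: Al_meet basic_ideal_radical)
qed

lemma inj_basic_ideal: "inj_on basic_ideal (carrier A)"
proof (rule inj_onI)
  fix a b assume "a \<in> carrier A" "b \<in> carrier A" "basic_ideal a = basic_ideal b"
  then show "a = b"
    using basic_ideal_mono_iff[of a b] basic_ideal_mono_iff[of b a] le_antisym[of a b] by simp
qed

section \<open>Faithfulness and fullness of the semi-dynamic ring\<close>

text \<open>A single \<open>r\<close> suffices. Since \<open>\<nabla>\<close> is surjective, some
  \<open>\<pi> x\<close> has the support of \<open>s\<close>, and equal supports give divisibility
  of powers in both directions.\<close>

lemma faithful_D:
  assumes "faithful_nabla_algebra A"
  shows "faithful_sdr D"
proof -
  have "\<exists>(k::nat) (r :: nat \<Rightarrow> 'r) (m::nat).
        (\<forall>i \<in> {1..k}. r i \<in> carrier R \<and> s divides\<^bsub>R\<^esub> \<pi> (r i)) \<and>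
        (\<exists>t \<in> {1..k} \<rightarrow> carrier R. s [^]\<^bsub>R\<^esub> m = (\<Oplus>\<^bsub>R\<^esub>i \<in> {1..k}. t i \<otimes>\<^bsub>R\<^esub> \<pi> (r i)))"
    if s: "s \<in> carrier R" for s
  proof -
    obtain a where a: "a \<in> carrier A" "d s = \<nabla> a"
      using assms d_closed[OF s] unfolding faithful_nabla_algebra_def by blast
    obtain x where x: "x \<in> carrier R" "d x = a"
      using d_surj a(1) by blast
    have "d (\<pi> x) \<sqsubseteq> d s"
      using x a s by (simp add: d_\<pi> nabla_closed)
    then obtain n t where t: "t \<in> carrier R" "\<pi> x [^]\<^bsub>R\<^esub> Suc n = t \<otimes>\<^bsub>R\<^esub> s"
      using d_divides_Suc[OF \<pi>_closed[OF x(1)] s] by blast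
    \<comment> \<open>This power makes \<open>s\<close> divide \<open>\<pi> r\<close>, and its
      positive exponent keeps the support equal to \<open>a\<close>.\<close>
    define r where "r = x [^]\<^bsub>R\<^esub> Suc n"
    have r: "r \<in> carrier R"
      unfolding r_def using x(1) by (rule R.nat_pow_closed)
    have "d r = a"
      unfolding r_def using d_power_Suc[OF x(1)] x(2) by simp
    then have "d s \<sqsubseteq> d (\<pi> r)"
      using r a by (simp add: d_\<pi> nabla_closed)
    then obtain m :: nat and u where u: "u \<in> carrier R" "s [^]\<^bsub>R\<^esub> m = u \<otimes>\<^bsub>R\<^esub> \<pi> r"
      using d_divides[OF s \<pi>_closed[OF r]] by blast
    interpret hom: ring_hom_ring R R \<pi>
      using \<pi>_hom R.ring_axioms by (simp add: ring_hom_ringI2)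
    have "\<pi> r = s \<otimes>\<^bsub>R\<^esub> t"
      unfolding r_def hom.hom_nat_pow[OF x(1)] using t s by (simp add: R.m_comm)
    then have "s divides\<^bsub>R\<^esub> \<pi> r"
      using t(1) by (auto simp: factor_def)
    moreover have "s [^]\<^bsub>R\<^esub> m = (\<Oplus>\<^bsub>R\<^esub>i \<in> {1..1::nat}. u \<otimes>\<^bsub>R\<^esub> \<pi> r)"
      using u \<pi>_closed[OF r] by simp
    ultimately show ?thesis
      using r u(1) by (intro exI[of _ 1] exI[of _ "\<lambda>_. r"] exI[of _ m])
        (auto intro!: bexI[of _ "\<lambda>_. u"])
  qed
  then show ?thesis
    by (simp add: faithful_sdr_def D_def Let_def)
qed

text \<open>The elements below supports of \<open>\<pi> y\<close>, with \<open>y\<close> in the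
  ideal generated by \<open>X\<close>, form a lattice ideal because \<open>\<nabla>\<close>
  preserves joins. Its preimage under \<open>d\<close> contains \<open>\<pi> r\<close>, so
  \<open>\<nabla> (d r) \<sqsubseteq> \<nabla> (d y)\<close> for some such \<open>y\<close>;
  fullness removes \<open>\<nabla>\<close>.\<close>

lemma full_D:
  assumes "full_nabla_algebra A"
  shows "full_sdr D"
proof -
  have "\<exists>n::nat. r [^]\<^bsub>R\<^esub> n \<in> Idl\<^bsub>R\<^esub> X"
    if X: "X \<subseteq> carrier R" and r: "r \<in> carrier R" and *: "\<pi> r \<in> Idl\<^bsub>R\<^esub> (\<pi> ` X)" for X r
  proof -
    let ?K = "Idl\<^bsub>R\<^esub> X"
    let ?J = "{b \<in> carrier A. \<exists>y \<in> ?K. b \<sqsubseteq> d (\<pi> y)}"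
    have K: "ideal ?K R"
      using X by (rule R.genideal_ideal)
    have Kc: "?K \<subseteq> carrier R"
      using ideal.Icarr[OF K] by blast
    have "lattice_ideal ?J"
    proof (rule lattice_idealI)
      show "\<bottom> \<in> ?J"
        using additive_subgroup.zero_closed[OF ideal.axioms(1)[OF K]]
          bottom_lower[of "d (\<pi> \<zero>\<^bsub>R\<^esub>)"] d_closed[OF \<pi>_closed[OF R.zero_closed]] by blast
      fix a assume "a \<in> ?J"
      then obtain x where a: "a \<in> carrier A" and x: "x \<in> ?K" "x \<in> carrier R" "a \<sqsubseteq> d (\<pi> x)"
        using Kc by blast
      show "b \<in> ?J" if b: "b \<in> carrier A" "b \<sqsubseteq> a" for b
        using b x a le_trans[OF b(2) x(3)] d_closed \<pi>_closed by blast
      fix b assume "b \<in> ?J"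
      then obtain y where b: "b \<in> carrier A" and y: "y \<in> ?K" "y \<in> carrier R" "b \<sqsubseteq> d (\<pi> y)"
        using Kc by blast
      obtain z where z: "z \<in> Idl\<^bsub>R\<^esub> {x, y}" "d z = d x \<squnion> d y"
        using d_join x(2) y(2) by blast
      have zK: "z \<in> ?K"
        using R.genideal_minimal[OF K, of "{x, y}"] z(1) x(1) y(1) by blast
      then have "d (\<pi> z) = d (\<pi> x) \<squnion> d (\<pi> y)"
        using Kc x y z(2) by (simp add: d_\<pi> nabla_join d_closed subsetD)
      then have "a \<squnion> b \<sqsubseteq> d (\<pi> z)"
        using a b x y d_closed \<pi>_closed by (simp add: join_mono)
      then show "a \<squnion> b \<in> ?J"
        using a b zK by auto
    qed blast
    then have M: "{x \<in> carrier R. d x \<in> ?J} \<in> radical_ideals R"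
      by (rule radical_ideal_vimage)
    have "\<pi> x \<in> {x \<in> carrier R. d x \<in> ?J}" if "x \<in> X" for x
    proof -
      have "x \<in> ?K" "x \<in> carrier R"
        using that X R.genideal_self[OF X] by blast+
      then show ?thesis
        using \<pi>_closed d_closed le_refl by blast
    qed
    then have "\<pi> ` X \<subseteq> {x \<in> carrier R. d x \<in> ?J}"
      by blast
    then have "\<pi> r \<in> {x \<in> carrier R. d x \<in> ?J}"
      using R.genideal_minimal[OF radical_idealD(1)[OF M]] * by blast
    then obtain y where y: "y \<in> ?K" "d (\<pi> r) \<sqsubseteq> d (\<pi> y)"
      by blast
    then have "d r \<sqsubseteq> d y"
      using full_imp_nabla_order_reflecting[OF assms, of "d r" "d y"] r Kc d_closed
      by (simp add: d_\<pi> subsetD)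
    then have "r \<in> Rad R ?K"
      unfolding Rad_ideal[OF K] using r y(1) by blast
    then show ?thesis
      by (simp add: Rad_def)
  qed
  then show ?thesis
    by (simp add: full_sdr_def D_def Let_def)
qed

lemma representation:
  assumes "nabla_algebra_satisfies A C"
  shows "\<exists>(D :: ('r, 'r) semi_dynamic_ring) i.
    D \<in> sdr_class C \<and> nabla_algebra_morphism A (Al D) i \<and> inj_on i (carrier A)"
proof (intro exI conjI)
  show "D \<in> sdr_class C"
    using assms semi_dynamic_ring_D faithful_D full_D
    by (simp add: sdr_class_def nabla_algebra_satisfies_def)
qed (rule basic_ideal_morphism inj_basic_ideal)+

end

section \<open>The ring of functions on the prime filters\<close>

text \<open>Variables are labelled by lattice elements, possibly with repetitions. Surjectivity of
  \<open>\<delta>\<close> gives each element a variable and hence a function supported on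
  it.\<close>

locale function_ring = bounded_distributive_lattice L
  for L :: "('a, 'm) gorder_scheme" (structure) +
  fixes \<delta> :: "'v::linorder \<Rightarrow> 'a"
  assumes range_\<delta>: "range \<delta> = carrier L"
begin

definition active :: "'a set \<Rightarrow> 'v set" where
  "active P = {v. \<delta> v \<in> P}"

text \<open>For finite \<open>E\<close> this says that \<open>r\<close> is constant on the blocks of
  a finite clopen partition.\<close>

definition depends_on :: "'a set \<Rightarrow> ('a set \<Rightarrow> 'b) \<Rightarrow> bool" where
  "depends_on E r \<longleftrightarrow> (\<forall>P \<in> prime_filters. \<forall>Q \<in> prime_filters. P \<inter> E = Q \<inter> E \<longrightarrow> r P = r Q)"

text \<open>The value 0 off the prime filters makes an admissible function determined by its values
  on prime filters.\<close>

definition admissible :: "('a set \<Rightarrow> 'v mpoly fract) set" where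
  "admissible = {r. (\<forall>P. P \<notin> prime_filters \<longrightarrow> r P = 0) \<and>
     (\<exists>E. finite E \<and> E \<subseteq> carrier L \<and> depends_on E r) \<and>
     (\<forall>P \<in> prime_filters. \<forall>Q \<in> prime_filters. P \<subseteq> Q \<longrightarrow> residue (active Q - active P) (r Q) (r P))}"

lemma depends_onI:
  assumes "\<And>P Q. P \<in> prime_filters \<Longrightarrow> Q \<in> prime_filters \<Longrightarrow> P \<inter> E = Q \<inter> E \<Longrightarrow> r P = r Q"
  shows "depends_on E r"
  using assms unfolding depends_on_def by blast

lemma depends_onD:
  assumes "depends_on E r" "P \<in> prime_filters" "Q \<in> prime_filters" "P \<inter> E = Q \<inter> E"
  shows "r P = r Q"
  using assms unfolding depends_on_def by blast

lemma admissibleI: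
  assumes "\<And>P. P \<notin> prime_filters \<Longrightarrow> r P = 0" "finite E" "E \<subseteq> carrier L" "depends_on E r"
    "\<And>P Q. P \<in> prime_filters \<Longrightarrow> Q \<in> prime_filters \<Longrightarrow> P \<subseteq> Q \<Longrightarrow>
      residue (active Q - active P) (r Q) (r P)"
  shows "r \<in> admissible"
  unfolding admissible_def mem_Collect_eq using assms by blast

lemma admissibleD:
  assumes "r \<in> admissible"
  shows "P \<notin> prime_filters \<Longrightarrow> r P = 0" "\<exists>E. finite E \<and> E \<subseteq> carrier L \<and> depends_on E r"
    "\<lbrakk>P \<in> prime_filters; Q \<in> prime_filters; P \<subseteq> Q\<rbrakk> \<Longrightarrow> residue (active Q - active P) (r Q) (r P)"
  using assms unfolding admissible_def mem_Collect_eq by blast+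

text \<open>The argument \<open>P\<close> lets \<open>g\<close> treat prime filters and other sets
  differently; on all prime filters it is the same operation. The sets on which \<open>r\<close> and
  \<open>s\<close> depend are united.\<close>

lemma admissible_binary:
  assumes r: "r \<in> admissible" and s: "s \<in> admissible"
    and zero: "\<And>P. P \<notin> prime_filters \<Longrightarrow> g P 0 0 = 0"
    and uniform: "\<And>P Q x y. P \<in> prime_filters \<Longrightarrow> Q \<in> prime_filters \<Longrightarrow> g P x y = g Q x y"
    and res: "\<And>P Q. P \<in> prime_filters \<Longrightarrow> Q \<in> prime_filters \<Longrightarrow> P \<subseteq> Q \<Longrightarrow>
      residue (active Q - active P) (g Q (r Q) (s Q)) (g P (r P) (s P))"
  shows "(\<lambda>P. g P (r P) (s P)) \<in> admissible"
proof -
  obtain E where E: "finite E" "E \<subseteq> carrier L" "depends_on E r"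
    using admissibleD(2)[OF r] by blast
  obtain F where F: "finite F" "F \<subseteq> carrier L" "depends_on F s"
    using admissibleD(2)[OF s] by blast
  show ?thesis
  proof (rule admissibleI[of _ "E \<union> F"])
    show "depends_on (E \<union> F) (\<lambda>P. g P (r P) (s P))"
    proof (rule depends_onI)
      fix P Q assume PQ: "P \<in> prime_filters" "Q \<in> prime_filters" "P \<inter> (E \<union> F) = Q \<inter> (E \<union> F)"
      then have "P \<inter> E = Q \<inter> E" "P \<inter> F = Q \<inter> F"
        by blast+
      then show "g P (r P) (s P) = g Q (r Q) (s Q)"
        using depends_onD[OF E(3) PQ(1,2)] depends_onD[OF F(3) PQ(1,2)] uniform[OF PQ(1,2)] by simp
    qed
  qed (use E F zero admissibleD(1)[OF r] admissibleD(1)[OF s] res in simp_all)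
qed

definition fring :: "('a set \<Rightarrow> 'v mpoly fract) ring" where
  "fring = \<lparr>carrier = admissible, mult = (\<lambda>r s P. r P * s P), one = (\<lambda>P. if P \<in> prime_filters then 1 else 0),
     zero = (\<lambda>P. 0), add = (\<lambda>r s P. r P + s P)\<rparr>"

lemma fring_simps [simp]:
  "carrier fring = admissible" "r \<otimes>\<^bsub>fring\<^esub> s = (\<lambda>P. r P * s P)" "r \<oplus>\<^bsub>fring\<^esub> s = (\<lambda>P. r P + s P)"
  "\<zero>\<^bsub>fring\<^esub> = (\<lambda>P. 0)" "\<one>\<^bsub>fring\<^esub> = (\<lambda>P. if P \<in> prime_filters then 1 else 0)"
  by (simp_all add: fring_def)

lemma zero_admissible: "(\<lambda>P. 0) \<in> admissible"
  by (rule admissibleI[of _ "{}"]) (simp_all add: depends_on_def residue_zero)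

lemma one_admissible: "(\<lambda>P. if P \<in> prime_filters then 1 else 0) \<in> admissible"
  by (rule admissibleI[of _ "{}"]) (simp_all add: depends_on_def residue_one)

lemma add_admissible: "r \<in> admissible \<Longrightarrow> s \<in> admissible \<Longrightarrow> (\<lambda>P. r P + s P) \<in> admissible"
  by (rule admissible_binary[where g = "\<lambda>P. (+)"]) (simp_all add: residue_add admissibleD(3))

lemma mult_admissible: "r \<in> admissible \<Longrightarrow> s \<in> admissible \<Longrightarrow> (\<lambda>P. r P * s P) \<in> admissible"
  by (rule admissible_binary[where g = "\<lambda>P. (*)"]) (simp_all add: residue_mult admissibleD(3))

lemma uminus_admissible: "r \<in> admissible \<Longrightarrow> (\<lambda>P. - r P) \<in> admissible"
  using admissible_binary[where g = "\<lambda>P x y. - x" and s = r] by (simp add: residue_uminus admissibleD(3))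

lemma cring_fring: "cring fring"
proof (rule cringI)
  show "abelian_group fring"
  proof (rule abelian_groupI)
    show "\<exists>s\<in>carrier fring. s \<oplus>\<^bsub>fring\<^esub> r = \<zero>\<^bsub>fring\<^esub>" if "r \<in> carrier fring" for r
      using that uminus_admissible by (intro bexI[of _ "\<lambda>P. - r P"]) simp_all
  qed (simp_all add: add_admissible zero_admissible add_ac)
  show "comm_monoid fring"
  proof (rule comm_monoidI)
    show "\<one>\<^bsub>fring\<^esub> \<otimes>\<^bsub>fring\<^esub> r = r" if "r \<in> carrier fring" for r
      using admissibleD(1)[of r] that by (auto simp: fun_eq_iff)
  qed (simp_all add: mult_admissible one_admissible mult_ac)
qed (simp add: distrib_right)

text \<open>The case distinction matters for \<open>n = 0\<close>: the unit vanishes off the prime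
  filters.\<close>

lemma nat_pow_fring:
  "r [^]\<^bsub>fring\<^esub> (n::nat) = (\<lambda>P. if P \<in> prime_filters then r P ^ n else 0)"
  by (induction n) (simp_all add: nat_pow_def fun_eq_iff)

section \<open>Supports and divisibility of admissible functions\<close>

definition d :: "('a set \<Rightarrow> 'v mpoly fract) \<Rightarrow> 'a" where
  "d r = (SOME a. a \<in> carrier L \<and> (\<forall>P \<in> prime_filters. a \<in> P \<longleftrightarrow> r P \<noteq> 0))"

text \<open>The nonvanishing locus is upward closed by \<open>residue_of_zero\<close> and clopen by
  finite dependence, so \<open>clopen_upset_represented\<close> applies.\<close>

lemma d_admissible:
  assumes r: "r \<in> admissible"
  shows "d r \<in> carrier L" "P \<in> prime_filters \<Longrightarrow> d r \<in> P \<longleftrightarrow> r P \<noteq> 0"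
proof -
  let ?D = "{P \<in> prime_filters. r P \<noteq> 0}"
  obtain E where E: "finite E" "E \<subseteq> carrier L" "depends_on E r"
    using admissibleD(2)[OF r] by blast
  obtain a where "a \<in> carrier L" "\<And>P. P \<in> prime_filters \<Longrightarrow> a \<in> P \<longleftrightarrow> P \<in> ?D"
  proof (rule clopen_upset_represented[of ?D E])
    show "Q \<in> ?D" if "P \<in> ?D" "Q \<in> prime_filters" "P \<subseteq> Q" for P Q
      using that admissibleD(3)[OF r, of P Q]
        residue_of_zero[of "active Q - active P" "r P"] by auto
    show "Q \<in> ?D" if "P \<in> ?D" "Q \<in> prime_filters" "P \<inter> E = Q \<inter> E" for P Q
      using that depends_onD[OF E(3), of P Q] by simp
  qed (use E in auto)
  then have "\<exists>a. a \<in> carrier L \<and> (\<forall>P \<in> prime_filters. a \<in> P \<longleftrightarrow> r P \<noteq> 0)"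
    by auto
  then have "d r \<in> carrier L \<and> (\<forall>P \<in> prime_filters. d r \<in> P \<longleftrightarrow> r P \<noteq> 0)"
    unfolding d_def by (rule someI_ex)
  then show "d r \<in> carrier L" "P \<in> prime_filters \<Longrightarrow> d r \<in> P \<longleftrightarrow> r P \<noteq> 0"
    by blast+
qed

lemma d_eqI:
  assumes "r \<in> admissible" "a \<in> carrier L" "\<And>P. P \<in> prime_filters \<Longrightarrow> a \<in> P \<longleftrightarrow> r P \<noteq> 0"
  shows "d r = a"
  unfolding eq_iff_prime_filters[OF d_admissible(1)[OF assms(1)] assms(2)]
  using assms(3) d_admissible(2)[OF assms(1)] by blast

definition monomial :: "'v \<Rightarrow> 'a set \<Rightarrow> 'v mpoly fract" where
  "monomial v P = (if P \<in> prime_filters \<and> \<delta> v \<in> P then var v else 0)"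

lemma \<delta>_closed: "\<delta> v \<in> carrier L"
  using range_\<delta> by blast

text \<open>A variable active at both filters has weight 0 and is its own residue; one that is
  active only at the larger filter has weight 1 and residue 0.\<close>

lemma monomial_admissible: "monomial v \<in> admissible"
proof (rule admissibleI[of _ "{\<delta> v}"])
  show "depends_on {\<delta> v} (monomial v)"
    by (rule depends_onI) (auto simp: monomial_def)
  fix P Q assume PQ: "P \<in> prime_filters" "Q \<in> prime_filters" "P \<subseteq> Q"
  consider "\<delta> v \<in> P" | "\<delta> v \<in> Q" "\<delta> v \<notin> P" | "\<delta> v \<notin> Q"
    by blast
  then show "residue (active Q - active P) (monomial v Q) (monomial v P)"
  proof cases
    case 1
    then show ?thesis
      using PQ by (auto simp: monomial_def active_def intro!: residue_var_outside)
  next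
    case 2
    then show ?thesis
      using PQ by (auto simp: monomial_def active_def intro!: residue_var_inside)
  next
    case 3
    then show ?thesis
      using PQ by (auto simp: monomial_def residue_zero)
  qed
qed (simp_all add: monomial_def \<delta>_closed)

lemma d_monomial: "d (monomial v) = \<delta> v"
  by (rule d_eqI) (simp_all add: monomial_admissible \<delta>_closed, simp add: monomial_def var_nonzero)

text \<open>The values factor through the finitely many traces on \<open>E\<close>. This will allow
  one exponent to work for all values.\<close>

lemma finite_values:
  assumes "r \<in> admissible"
  shows "finite (r ` prime_filters)"
proof -
  obtain E where E: "finite E" "E \<subseteq> carrier L" "depends_on E r"
    using admissibleD(2)[OF assms] by blast
  have "finite ((\<lambda>P. P \<inter> E) ` prime_filters)"
    by (rule finite_subset[of _ "Pow E"]) (use E(1) in auto)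
  moreover have "r ` prime_filters \<subseteq> (\<lambda>G. r (SOME P. P \<in> prime_filters \<and> P \<inter> E = G)) ` (\<lambda>P. P \<inter> E) ` prime_filters"
  proof
    fix x assume "x \<in> r ` prime_filters"
    then obtain P where P: "P \<in> prime_filters" "x = r P" by blast
    let ?Q = "SOME Q. Q \<in> prime_filters \<and> Q \<inter> E = P \<inter> E"
    have "?Q \<in> prime_filters \<and> ?Q \<inter> E = P \<inter> E"
      by (rule someI[of "\<lambda>Q. Q \<in> prime_filters \<and> Q \<inter> E = P \<inter> E" P]) (simp add: P)
    then have "x = r ?Q"
      using depends_onD[OF E(3), of ?Q P] P by simp
    then show "x \<in> (\<lambda>G. r (SOME P. P \<in> prime_filters \<and> P \<inter> E = G)) ` (\<lambda>P. P \<inter> E) ` prime_filters"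
      using P(1) by blast
  qed
  ultimately show ?thesis
    by (rule finite_surj)
qed

text \<open>The quotient \<open>t\<close> is a high power of \<open>r\<close> divided pointwise by
  \<open>s\<close>. The exponent from \<open>residue_power_divide\<close> depends only on the value
  of \<open>s\<close>, and \<open>s\<close> has finitely many values.\<close>

lemma function_divides:
  assumes r: "r \<in> admissible" and s: "s \<in> admissible" and le: "d r \<sqsubseteq> d s"
  obtains n t where "t \<in> admissible" "r [^]\<^bsub>fring\<^esub> Suc n = t \<otimes>\<^bsub>fring\<^esub> s"
proof -
  have zero: "r P = 0" if "P \<in> prime_filters" "s P = 0" for P
    using prime_filter_up[OF that(1) _ d_admissible(1)[OF s] le] d_admissible(2)[OF r that(1)]
      d_admissible(2)[OF s that(1)] that(2) by blast
  let ?W = "s ` prime_filters - {0}"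
  have "\<forall>w \<in> ?W. \<exists>N. \<forall>S u M. residue S u 0 \<longrightarrow> N \<le> M \<longrightarrow> residue S (u ^ M / w) 0"
  proof
    fix w assume "w \<in> ?W"
    then show "\<exists>N. \<forall>S u M. residue S u 0 \<longrightarrow> N \<le> M \<longrightarrow> residue S (u ^ M / w) 0"
      using residue_power_divide[of w] by (metis DiffE insertI1)
  qed
  then obtain Nf where Nf: "\<forall>w \<in> ?W. \<forall>S u M. residue S u 0 \<longrightarrow> Nf w \<le> M \<longrightarrow> residue S (u ^ M / w) 0"
    unfolding bchoice_iff by (rule exE)
  \<comment> \<open>The sum bounds every \<open>Nf w\<close>.\<close>
  define N where "N = (\<Sum>w\<in>?W. Nf w)"
  have N: "residue S (u ^ Suc N / w) 0" if "w \<in> ?W" "residue S u 0" for S u w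
  proof -
    have "Nf w \<le> N"
      unfolding N_def using that(1) finite_values[OF s] by (intro member_le_sum) auto
    then show ?thesis
      using Nf that by (meson le_SucI)
  qed
  \<comment> \<open>Where \<open>s\<close> vanishes so does \<open>r\<close>, and division by 0
    gives the value 0 that \<open>t\<close> needs there.\<close>
  define t where "t = (\<lambda>P. if P \<in> prime_filters then r P ^ Suc N / s P else 0)"
  have "t \<in> admissible"
    unfolding t_def
  proof (rule admissible_binary[where g = "\<lambda>P x y. if P \<in> prime_filters then x ^ Suc N / y else 0", OF r s])
    fix P Q assume PQ: "P \<in> prime_filters" "Q \<in> prime_filters" "P \<subseteq> Q"
    let ?S = "active Q - active P"
    have rr: "residue ?S (r Q) (r P)" and ss: "residue ?S (s Q) (s P)"
      using admissibleD(3)[OF r PQ] admissibleD(3)[OF s PQ] .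
    \<comment> \<open>If \<open>s P \<noteq> 0\<close>, residues can be divided. If \<open>s\<close>
      vanishes at \<open>P\<close> but not at \<open>Q\<close>, then \<open>r P = 0\<close>, and the
      power of \<open>r Q\<close> outweighs the order of \<open>s Q\<close>.\<close>
    have "residue ?S (r Q ^ Suc N / s Q) (r P ^ Suc N / s P)"
    proof (cases "s P = 0")
      case True
      show ?thesis
      proof (cases "s Q = 0")
        case True
        then show ?thesis
          using \<open>s P = 0\<close> by (simp add: residue_zero)
      next
        case False
        then have "residue ?S (r Q ^ Suc N / s Q) 0"
          using N[of "s Q" ?S "r Q"] rr zero[OF PQ(1) True] PQ(2) by simp
        then show ?thesis
          using True by simp
      qed
    next
      case False
      then show ?thesis
        using residue_mult[OF residue_power[OF rr, of "Suc N"] residue_inverse[OF ss]]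
        by (simp add: divide_inverse)
    qed
    then show "residue ?S (if Q \<in> prime_filters then r Q ^ Suc N / s Q else 0)
        (if P \<in> prime_filters then r P ^ Suc N / s P else 0)"
      using PQ by simp
  qed simp_all
  moreover have "r [^]\<^bsub>fring\<^esub> Suc N = t \<otimes>\<^bsub>fring\<^esub> s"
    using zero unfolding nat_pow_fring by (auto simp: t_def fun_eq_iff)
  ultimately show thesis
    by (rule that)
qed

sublocale lattice_support L fring d
proof -
  interpret cring fring
    by (rule cring_fring)
  show "lattice_support L fring d"
  proof unfold_locales
    show "d \<zero>\<^bsub>fring\<^esub> = \<bottom>"
      using prime_filterD(3) by (intro d_eqI) (simp_all add: zero_admissible)
    show "d \<one>\<^bsub>fring\<^esub> = \<top>"
      using prime_filterD(2) by (intro d_eqI) (simp_all add: one_admissible)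
    show "\<exists>x \<in> carrier fring. d x = a" if "a \<in> carrier L" for a
    proof -
      obtain v where "a = \<delta> v"
        using \<open>a \<in> carrier L\<close> range_\<delta> by blast
      then show ?thesis
        using d_monomial monomial_admissible by auto
    qed
    fix r assume "r \<in> carrier fring"
    then have r: "r \<in> admissible" by simp
    show "d r \<in> carrier L"
      using r by (rule d_admissible(1))
    fix s assume "s \<in> carrier fring"
    then have s: "s \<in> admissible" by simp
    note c = d_admissible(1)[OF r] d_admissible(1)[OF s]
    show "d (r \<otimes>\<^bsub>fring\<^esub> s) = d r \<sqinter> d s"
    proof (rule d_eqI)
      show "d r \<sqinter> d s \<in> P \<longleftrightarrow> (r \<otimes>\<^bsub>fring\<^esub> s) P \<noteq> 0" if P: "P \<in> prime_filters" for P
        using prime_filterD(4)[OF P c] d_admissible(2)[OF r P] d_admissible(2)[OF s P] by simp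
    qed (simp_all add: c mult_admissible r s)
    show "d (r \<oplus>\<^bsub>fring\<^esub> s) \<sqsubseteq> d r \<squnion> d s"
    proof (rule iffD2[OF le_iff_prime_filters], rule_tac[3] ballI, rule_tac[3] impI)
      fix P assume P: "P \<in> prime_filters" and "d (r \<oplus>\<^bsub>fring\<^esub> s) \<in> P"
      then have "r P + s P \<noteq> 0"
        using d_admissible(2)[OF add_admissible[OF r s] P] by simp
      then show "d r \<squnion> d s \<in> P"
        using prime_filterD(5)[OF P c] d_admissible(2)[OF r P] d_admissible(2)[OF s P] by auto
    qed (simp_all add: c d_admissible(1)[OF add_admissible[OF r s]])
    show "\<exists>n::nat. \<exists>t \<in> carrier fring. r [^]\<^bsub>fring\<^esub> n = t \<otimes>\<^bsub>fring\<^esub> s" if le: "d r \<sqsubseteq> d s"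
    proof -
      obtain n t where "t \<in> admissible" "r [^]\<^bsub>fring\<^esub> Suc n = t \<otimes>\<^bsub>fring\<^esub> s"
        using r s le by (rule function_divides)
      then show ?thesis
        by (metis fring_simps(1))
    qed
    show "\<exists>a \<in> carrier fring. \<exists>b \<in> carrier fring.
      d (a \<otimes>\<^bsub>fring\<^esub> r \<oplus>\<^bsub>fring\<^esub> b \<otimes>\<^bsub>fring\<^esub> s) = d r \<squnion> d s"
    proof -
      \<comment> \<open>A direct combination of \<open>r\<close> and \<open>s\<close> might cancel.
        Instead, powers of monomials with the same supports are used: they are multiples of
        \<open>r\<close> and \<open>s\<close>, and their sum is nonzero wherever one of them
        is.\<close>
      obtain v w where vw: "d r = \<delta> v" "d s = \<delta> w"
        using c range_\<delta> by blast
      have "d (monomial v) \<sqsubseteq> d r" "d (monomial w) \<sqsubseteq> d s"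
        using c by (simp_all add: d_monomial flip: vw)
      obtain m a where a: "a \<in> admissible" "monomial v [^]\<^bsub>fring\<^esub> Suc m = a \<otimes>\<^bsub>fring\<^esub> r"
        using monomial_admissible r \<open>d (monomial v) \<sqsubseteq> d r\<close> by (rule function_divides)
      obtain n b where b: "b \<in> admissible" "monomial w [^]\<^bsub>fring\<^esub> Suc n = b \<otimes>\<^bsub>fring\<^esub> s"
        using monomial_admissible s \<open>d (monomial w) \<sqsubseteq> d s\<close> by (rule function_divides)
      have "d (monomial v [^]\<^bsub>fring\<^esub> Suc m \<oplus>\<^bsub>fring\<^esub> monomial w [^]\<^bsub>fring\<^esub> Suc n) = d r \<squnion> d s"
      proof (rule d_eqI)
        fix P assume P: "P \<in> prime_filters"
        have "d r \<squnion> d s \<in> P \<longleftrightarrow> \<delta> v \<in> P \<or> \<delta> w \<in> P"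
          using prime_filterD(5)[OF P c] vw by simp
        also have "\<dots> \<longleftrightarrow> monomial v P ^ Suc m + monomial w P ^ Suc n \<noteq> 0"
          using P var_nonzero[of v] var_nonzero[of w] var_power_add_nonzero[of v "Suc m" w "Suc n"]
          by (auto simp: monomial_def)
        finally show "d r \<squnion> d s \<in> P \<longleftrightarrow>
          (monomial v [^]\<^bsub>fring\<^esub> Suc m \<oplus>\<^bsub>fring\<^esub> monomial w [^]\<^bsub>fring\<^esub> Suc n) P \<noteq> 0"
          unfolding nat_pow_fring using P by simp
      next
        show "monomial v [^]\<^bsub>fring\<^esub> Suc m \<oplus>\<^bsub>fring\<^esub> monomial w [^]\<^bsub>fring\<^esub> Suc n \<in> admissible"
          unfolding a(2) b(2) using a(1) b(1) r s by (simp add: add_admissible mult_admissible)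
      qed (simp add: c)
      then show ?thesis
        unfolding a(2) b(2) using a(1) b(1) unfolding fring_simps(1) by blast
    qed
  qed
qed

end

section \<open>The endomorphism lying over nabla\<close>

text \<open>Renaming \<open>t\<^sub>v\<close> to \<open>t\<^bsub>\<phi> v\<^esub>\<close> while composing with \<open>P \<mapsto> \<nabla>\<^sup>-\<^sup>1 P\<close> makes sense because
  \<open>v\<close> is active at \<open>\<nabla>\<^sup>-\<^sup>1 P\<close> iff \<open>\<phi> v\<close> is active at \<open>P\<close>.\<close>

locale function_ring_endomorphism =
  distributive_nabla_algebra A + normal_nabla_algebra A + function_ring A \<delta>
  for A :: "('a, 'm) nabla_algebra_scheme" (structure) and \<delta> :: "'v::linorder \<Rightarrow> 'a" +
  fixes \<phi> :: "'v \<Rightarrow> 'v"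
  assumes inj_\<phi>: "inj \<phi>" and \<delta>_\<phi>: "\<delta> (\<phi> v) = \<nabla> (\<delta> v)"
begin

definition preimage :: "'a set \<Rightarrow> 'a set" where
  "preimage P = {a \<in> carrier A. \<nabla> a \<in> P}"

text \<open>Normality gives preservation of \<open>\<top>\<close> and meets, adjointness that of
  \<open>\<bottom>\<close> and joins.\<close>

lemma preimage_prime_filter:
  assumes P: "P \<in> prime_filters"
  shows "preimage P \<in> prime_filters"
  unfolding prime_filters_def mem_Collect_eq
proof (intro conjI ballI)
  show "\<top> \<in> preimage P" "\<bottom> \<notin> preimage P"
    using prime_filterD(2,3)[OF P] by (simp_all add: preimage_def nabla_top nabla_bottom)
  fix a b assume ab: "a \<in> carrier A" "b \<in> carrier A"
  show "a \<sqinter> b \<in> preimage P \<longleftrightarrow> a \<in> preimage P \<and> b \<in> preimage P"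
    using ab prime_filterD(4)[OF P, of "\<nabla> a" "\<nabla> b"]
    by (simp add: preimage_def nabla_meet nabla_closed)
  show "a \<squnion> b \<in> preimage P \<longleftrightarrow> a \<in> preimage P \<or> b \<in> preimage P"
    using ab prime_filterD(5)[OF P, of "\<nabla> a" "\<nabla> b"] by (simp add: preimage_def nabla_join nabla_closed)
qed (simp add: preimage_def)

lemma active_preimage: "active (preimage P) = \<phi> -` active P"
  by (auto simp: active_def preimage_def \<delta>_\<phi> \<delta>_closed)

definition \<pi> :: "('a set \<Rightarrow> 'v mpoly fract) \<Rightarrow> 'a set \<Rightarrow> 'v mpoly fract" where
  "\<pi> r P = (if P \<in> prime_filters then rename_fract \<phi> (r (preimage P)) else 0)"

text \<open>Dependence on \<open>E\<close> becomes dependence on the image of \<open>E\<close> under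
  \<open>\<nabla>\<close>. The variables newly active between the preimages are those that
  \<open>\<phi>\<close> sends to newly active ones, so \<open>residue_rename\<close>
  applies.\<close>

lemma \<pi>_admissible:
  assumes r: "r \<in> admissible"
  shows "\<pi> r \<in> admissible"
proof -
  obtain E where E: "finite E" "E \<subseteq> carrier A" "depends_on E r"
    using admissibleD(2)[OF r] by blast
  show ?thesis
  proof (rule admissibleI[of _ "(\<lambda>a. \<nabla> a) ` E"])
    show "(\<lambda>a. \<nabla> a) ` E \<subseteq> carrier A"
      using E(2) nabla_closed by blast
    show "depends_on ((\<lambda>a. \<nabla> a) ` E) (\<pi> r)"
    proof (rule depends_onI)
      fix P Q assume PQ: "P \<in> prime_filters" "Q \<in> prime_filters"
        "P \<inter> (\<lambda>a. \<nabla> a) ` E = Q \<inter> (\<lambda>a. \<nabla> a) ` E"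
      then have "preimage P \<inter> E = preimage Q \<inter> E"
        unfolding preimage_def by blast
      then have "r (preimage P) = r (preimage Q)"
        by (rule depends_onD[OF E(3) preimage_prime_filter[OF PQ(1)] preimage_prime_filter[OF PQ(2)]])
      then show "\<pi> r P = \<pi> r Q"
        using PQ by (simp add: \<pi>_def)
    qed
    fix P Q assume PQ: "P \<in> prime_filters" "Q \<in> prime_filters" "P \<subseteq> Q"
    then have "preimage P \<subseteq> preimage Q"
      by (auto simp: preimage_def)
    then have "residue (\<phi> -` (active Q - active P)) (r (preimage Q)) (r (preimage P))"
      using admissibleD(3)[OF r preimage_prime_filter[OF PQ(1)] preimage_prime_filter[OF PQ(2)]]
      by (simp add: active_preimage vimage_Diff)
    then show "residue (active Q - active P) (\<pi> r Q) (\<pi> r P)"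
      using residue_rename[OF inj_\<phi>] PQ by (simp add: \<pi>_def)
  qed (use E(1) in \<open>simp_all add: \<pi>_def\<close>)
qed

lemma \<pi>_ring_hom: "\<pi> \<in> ring_hom fring fring"
proof (rule ring_hom_memI)
  show "\<pi> \<one>\<^bsub>fring\<^esub> = \<one>\<^bsub>fring\<^esub>"
    using preimage_prime_filter by (auto simp: \<pi>_def rename_fract_one inj_\<phi> fun_eq_iff)
qed (auto simp: \<pi>_admissible \<pi>_def rename_fract_add rename_fract_mult inj_\<phi> fun_eq_iff)

lemma d_\<pi>_admissible:
  assumes r: "r \<in> admissible"
  shows "d (\<pi> r) = \<nabla> (d r)"
proof (rule d_eqI[OF \<pi>_admissible[OF r]])
  note c = d_admissible(1)[OF r]
  show "\<nabla> (d r) \<in> carrier A"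
    using c by (rule nabla_closed)
  fix P assume P: "P \<in> prime_filters"
  have "\<nabla> (d r) \<in> P \<longleftrightarrow> d r \<in> preimage P"
    using c by (simp add: preimage_def)
  also have "\<dots> \<longleftrightarrow> r (preimage P) \<noteq> 0"
    using r preimage_prime_filter[OF P] by (rule d_admissible(2))
  finally show "\<nabla> (d r) \<in> P \<longleftrightarrow> \<pi> r P \<noteq> 0"
    using P by (simp add: \<pi>_def rename_fract_eq_0_iff inj_\<phi>)
qed

sublocale supported_nabla_algebra A fring d \<pi>
  by unfold_locales (simp_all add: \<pi>_ring_hom d_\<pi>_admissible)

end

section \<open>Embedding into the universe type\<close>

lemma (in supported_nabla_algebra) supported_nabla_algebra_iso:
  fixes R' :: "'s ring"
  assumes e: "e \<in> ring_iso R R'" and "cring R'"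
    and d': "\<And>x. x \<in> carrier R \<Longrightarrow> d' (e x) = d x"
    and \<pi>': "\<And>x. x \<in> carrier R \<Longrightarrow> \<pi>' (e x) = e (\<pi> x)"
  shows "supported_nabla_algebra A R' d' \<pi>'"
proof -
  interpret R': cring R' by fact
  interpret e: ring_hom_ring R R' e
    using e R.ring_axioms R'.ring_axioms by (simp add: ring_hom_ringI2 ring_iso_def)
  have surj: "\<exists>x \<in> carrier R. x' = e x" if "x' \<in> carrier R'" for x'
    using e that by (auto simp: ring_iso_def bij_betw_def)
  show ?thesis
  proof unfold_locales
    show "d' \<zero>\<^bsub>R'\<^esub> = \<bottom>" "d' \<one>\<^bsub>R'\<^esub> = \<top>"
      using d'[OF R.zero_closed] d'[OF R.one_closed] by (simp_all add: d_zero d_one)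
    show "\<exists>x\<in>carrier R'. d' x = a" if a: "a \<in> carrier A" for a
    proof -
      obtain x where x: "x \<in> carrier R" "d x = a"
        using d_surj[OF a] by blast
      then show ?thesis
        using d'[OF x(1)] e.hom_closed[OF x(1)] by blast
    qed
    show "\<pi>' \<in> ring_hom R' R'"
    proof (rule ring_hom_memI)
      fix x' y' assume x': "x' \<in> carrier R'" and y': "y' \<in> carrier R'"
      obtain x y where xy: "x \<in> carrier R" "y \<in> carrier R" "x' = e x" "y' = e y"
        using surj[OF x'] surj[OF y'] by blast
      show "\<pi>' (x' \<otimes>\<^bsub>R'\<^esub> y') = \<pi>' x' \<otimes>\<^bsub>R'\<^esub> \<pi>' y'"
        using xy \<pi>'[of "x \<otimes>\<^bsub>R\<^esub> y"] by (simp add: \<pi>' \<pi>_closed ring_hom_mult[OF \<pi>_hom])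
      show "\<pi>' (x' \<oplus>\<^bsub>R'\<^esub> y') = \<pi>' x' \<oplus>\<^bsub>R'\<^esub> \<pi>' y'"
        using xy \<pi>'[of "x \<oplus>\<^bsub>R\<^esub> y"] by (simp add: \<pi>' \<pi>_closed ring_hom_add[OF \<pi>_hom])
    next
      show "\<pi>' x' \<in> carrier R'" if "x' \<in> carrier R'" for x'
        using surj[OF that] \<pi>' \<pi>_closed by auto
      show "\<pi>' \<one>\<^bsub>R'\<^esub> = \<one>\<^bsub>R'\<^esub>"
        using \<pi>'[OF R.one_closed] by (simp add: ring_hom_one[OF \<pi>_hom])
    qed
    fix x' assume x': "x' \<in> carrier R'"
    obtain x where x: "x \<in> carrier R" "x' = e x"
      using surj[OF x'] by blast
    show "d' x' \<in> carrier A"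
      using x by (simp add: d' d_closed)
    show "d' (\<pi>' x') = \<nabla> (d' x')"
      using x by (simp add: d' \<pi>' d_\<pi> \<pi>_closed)
    fix y' assume y': "y' \<in> carrier R'"
    obtain y where y: "y \<in> carrier R" "y' = e y"
      using surj[OF y'] by blast
    show "d' (x' \<otimes>\<^bsub>R'\<^esub> y') = d' x' \<sqinter> d' y'"
      using x y d'[of "x \<otimes>\<^bsub>R\<^esub> y"] by (simp add: d' d_mult)
    show "d' (x' \<oplus>\<^bsub>R'\<^esub> y') \<sqsubseteq> d' x' \<squnion> d' y'"
      using x y d'[of "x \<oplus>\<^bsub>R\<^esub> y"] by (simp add: d' d_add)
    show "\<exists>n::nat. \<exists>t\<in>carrier R'. x' [^]\<^bsub>R'\<^esub> n = t \<otimes>\<^bsub>R'\<^esub> y'" if "d' x' \<sqsubseteq> d' y'"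
    proof -
      have "d x \<sqsubseteq> d y"
        using that x y by (simp add: d')
      then obtain n :: nat and t where t: "t \<in> carrier R" "x [^]\<^bsub>R\<^esub> n = t \<otimes>\<^bsub>R\<^esub> y"
        using d_divides[OF x(1) y(1)] by blast
      then have "x' [^]\<^bsub>R'\<^esub> n = e t \<otimes>\<^bsub>R'\<^esub> y'"
        using x y e.hom_nat_pow[OF x(1), of n] by simp
      then show ?thesis
        using t(1) e.hom_closed by blast
    qed
    show "\<exists>s\<in>carrier R'. \<exists>t\<in>carrier R'. d' (s \<otimes>\<^bsub>R'\<^esub> x' \<oplus>\<^bsub>R'\<^esub> t \<otimes>\<^bsub>R'\<^esub> y') = d' x' \<squnion> d' y'"
    proof -
      obtain s t where st: "s \<in> carrier R" "t \<in> carrier R"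
        "d (s \<otimes>\<^bsub>R\<^esub> x \<oplus>\<^bsub>R\<^esub> t \<otimes>\<^bsub>R\<^esub> y) = d x \<squnion> d y"
        using d_combination[OF x(1) y(1)] by blast
      then have "d' (e s \<otimes>\<^bsub>R'\<^esub> x' \<oplus>\<^bsub>R'\<^esub> e t \<otimes>\<^bsub>R'\<^esub> y') = d' x' \<squnion> d' y'"
        using x y d'[of "s \<otimes>\<^bsub>R\<^esub> x \<oplus>\<^bsub>R\<^esub> t \<otimes>\<^bsub>R\<^esub> y"] by (simp add: d')
      then show ?thesis
        using st(1,2) e.hom_closed by blast
    qed
  qed
qed

lemma (in supported_nabla_algebra) supported_nabla_algebra_image:
  assumes e: "inj_on e (carrier R)"
  shows "supported_nabla_algebra A (image_ring e R) (d \<circ> inv_into (carrier R) e)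
    (e \<circ> \<pi> \<circ> inv_into (carrier R) e)"
proof (rule supported_nabla_algebra_iso)
  show iso: "e \<in> ring_iso R (image_ring e R)"
    using e by (rule inj_imp_image_ring_iso)
  show "cring (image_ring e R)"
    using R.ring_iso_imp_img_cring[OF iso] by (simp add: image_ring_def image_group_def monoid.defs)
qed (use e in simp_all)

section \<open>Comparison of cardinalities of types\<close>

text \<open>The \<open>itself\<close> arguments turn a comparison of types into an ordinary
  predicate, so such comparisons can be chained by rules.\<close>

definition embeds_in :: "'t itself \<Rightarrow> 'x itself \<Rightarrow> bool" where
  "embeds_in _ _ \<longleftrightarrow> (\<exists>f :: 't \<Rightarrow> 'x. inj f)"

lemma embeds_in_refl: "embeds_in TYPE('x) TYPE('x)"
  unfolding embeds_in_def using inj_on_id by blast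

lemma embeds_in_inj:
  fixes f :: "'t \<Rightarrow> 'u"
  assumes "inj f" "embeds_in TYPE('u) TYPE('x)"
  shows "embeds_in TYPE('t) TYPE('x)"
  using assms inj_compose unfolding embeds_in_def by blast

lemma embeds_in_surj:
  fixes g :: "'u \<Rightarrow> 't"
  assumes "surj g" "embeds_in TYPE('u) TYPE('x)"
  shows "embeds_in TYPE('t) TYPE('x)"
  using embeds_in_inj[OF surj_imp_inj_inv] assms by blast

context
  assumes infinite: "infinite (UNIV :: 'x set)"
begin

lemma embeds_in_countable: "embeds_in TYPE('t::countable) TYPE('x)"
proof -
  obtain c :: "nat \<Rightarrow> 'x" where "inj c"
    using infinite_countable_subset[OF infinite] by blast
  then have "inj (c \<circ> to_nat :: 't \<Rightarrow> 'x)"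
    using inj_compose inj_to_nat by blast
  then show ?thesis
    unfolding embeds_in_def by blast
qed

lemma embeds_in_square: "embeds_in TYPE('x \<times> 'x) TYPE('x)"
proof -
  have "\<exists>f. bij_betw f ((UNIV :: 'x set) \<times> (UNIV :: 'x set)) (UNIV :: 'x set)"
    unfolding card_of_ordIso using infinite by (rule card_of_Times_same_infinite)
  then show ?thesis
    unfolding embeds_in_def by (auto simp: bij_betw_def)
qed

lemma embeds_in_prod:
  assumes "embeds_in TYPE('t) TYPE('x)" "embeds_in TYPE('u) TYPE('x)"
  shows "embeds_in TYPE('t \<times> 'u) TYPE('x)"
proof -
  obtain f :: "'t \<Rightarrow> 'x" and g :: "'u \<Rightarrow> 'x" where "inj f" "inj g"
    using assms unfolding embeds_in_def by blast
  then have "inj (map_prod f g)"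
    by (rule prod.inj_map)
  then show ?thesis
    using embeds_in_square by (rule embeds_in_inj)
qed

text \<open>A list is coded by its length and the iterated pairing of its entries, starting from a
  fixed value; knowing the length makes the pairing decodable.\<close>

lemma embeds_in_list:
  assumes "embeds_in TYPE('t) TYPE('x)"
  shows "embeds_in TYPE('t list) TYPE('x)"
proof -
  obtain f :: "'t \<times> 'x \<Rightarrow> 'x" where f: "inj f"
    using embeds_in_prod[OF assms embeds_in_refl] unfolding embeds_in_def by blast
  define h where "h = (\<lambda>xs. foldr (\<lambda>x y. f (x, y)) xs undefined)"
  have "xs = ys" if "length xs = length ys" "h xs = h ys" for xs ys
    using that by (induction xs ys rule: list_induct2) (auto simp: h_def dest: injD[OF f])
  then have "inj (\<lambda>xs. (length xs, h xs))"
    by (intro injI) auto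
  moreover have "embeds_in TYPE(nat \<times> 'x) TYPE('x)"
    by (intro embeds_in_prod embeds_in_countable embeds_in_refl)
  ultimately show ?thesis
    by (rule embeds_in_inj)
qed

text \<open>Multisets are images of lists, polynomials images of lists of terms, and fractions
  images of pairs; a surjective image of an embeddable type is embeddable.\<close>

lemma embeds_in_mpoly_fract:
  assumes v: "embeds_in TYPE('v::linorder) TYPE('x)"
  shows "embeds_in TYPE('v mpoly fract) TYPE('x)"
proof -
  have "surj (mset :: 'v list \<Rightarrow> 'v multiset)"
    by (metis ex_mset surjI)
  then have "embeds_in TYPE('v multiset) TYPE('x)"
    using embeds_in_list[OF v] by (rule embeds_in_surj)
  then have list: "embeds_in TYPE(('v multiset \<times> int) list) TYPE('x)"
    by (intro embeds_in_list embeds_in_prod embeds_in_countable)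
  have "surj (\<lambda>ts. \<Sum>(m, c)\<leftarrow>ts. Poly_Mapping.single m c :: 'v mpoly)"
  proof (rule surjI)
    fix f :: "'v mpoly"
    let ?ms = "sorted_list_of_set (Poly_Mapping.keys f)"
    show "(\<Sum>(m, c)\<leftarrow>map (\<lambda>m. (m, Poly_Mapping.lookup f m)) ?ms. Poly_Mapping.single m c) = f"
      by (simp add: comp_def sum_list_distinct_conv_sum_set sum_single_keys)
  qed
  then have "embeds_in TYPE('v mpoly) TYPE('x)"
    using list by (rule embeds_in_surj)
  moreover have "surj (\<lambda>(f, g). Fract f g :: 'v mpoly fract)"
    unfolding surj_def by (metis Fract_cases case_prod_conv)
  ultimately show ?thesis
    using embeds_in_surj embeds_in_prod by blast
qed

end

text \<open>A function is coded by its graph: each pair of an argument and its value becomes one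
  subset of \<open>'a + nat\<close>, and the graph a set of such subsets.\<close>

lemma embeds_in_universe:
  assumes "embeds_in TYPE('k) TYPE('a + nat)"
  shows "embeds_in TYPE('a set \<Rightarrow> 'k) TYPE('a ring_universe)"
proof -
  have inf: "infinite (UNIV :: ('a + nat) set)"
    by simp
  obtain k :: "'k \<Rightarrow> 'a + nat" where k: "inj k"
    using assms unfolding embeds_in_def by blast
  obtain p :: "('a + nat) \<times> ('a + nat) \<Rightarrow> 'a + nat" where p: "inj p"
    using embeds_in_square[OF inf] unfolding embeds_in_def by blast
  \<comment> \<open>The tag \<open>Inr 0\<close> records the value even for empty \<open>P\<close>;
    the tags \<open>Inl a\<close> record the members of \<open>P\<close>.\<close>
  define code where "code P x = insert (p (Inr 0, k x)) ((\<lambda>a. p (Inl a, k x)) ` P)" for P x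
  have code: "P = P' \<and> x = x'" if eq: "code P x = code P' x'" for P P' x x'
  proof -
    have "p (Inr 0, k x) \<in> code P' x'"
      unfolding eq[symmetric] by (simp add: code_def)
    then have "x = x'"
      by (auto simp: code_def inj_eq[OF p] inj_eq[OF k])
    moreover have "a \<in> Q \<longleftrightarrow> p (Inl a, k y) \<in> code Q y" for a Q y
      by (auto simp: code_def inj_eq[OF p])
    ultimately show ?thesis
      using eq by blast
  qed
  have "inj (\<lambda>u. range (\<lambda>P. code P (u P)))"
  proof (rule injI, rule ext)
    fix u v :: "'a set \<Rightarrow> 'k" and P
    assume "range (\<lambda>P. code P (u P)) = range (\<lambda>P. code P (v P))"
    then obtain P' where "code P (u P) = code P' (v P')"
      by blast
    then show "u P = v P"
      using code by blast
  qed
  then show ?thesis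
    unfolding embeds_in_def by blast
qed

section \<open>Choice of variables and the resulting representation\<close>

theorem theorem5p7:
  fixes A :: "'a nabla_algebra" and C :: "condition set"
  assumes "C \<subseteq> {Fa, Fu}"
    and "distributive_nabla_algebra A"
    and "normal_nabla_algebra A"
    and "nabla_algebra_satisfies A C"
  shows "\<exists>(D :: ('a ring_universe, 'a ring_universe) semi_dynamic_ring) i.
           D \<in> sdr_class C \<and> nabla_algebra_morphism A (Al D) i \<and> inj_on i (carrier A)"
proof -
  interpret distributive_nabla_algebra A by fact
  interpret normal_nabla_algebra A by fact
  \<comment> \<open>The default \<open>\<bottom>\<close> keeps all labels in the carrier and
    respects the shift, because \<open>\<nabla>\<close> fixes \<open>\<bottom>\<close>.\<close>
  define \<delta> :: "('a \<times> nat) ordered_copy \<Rightarrow> 'a" where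
    "\<delta> v = (case Rep_ordered_copy v of (a, n) \<Rightarrow> if a \<in> carrier A then (nabla A ^^ n) a else \<bottom>\<^bsub>A\<^esub>)" for v
  \<comment> \<open>The counter \<open>n\<close> makes the renaming injective even when
    \<open>\<nabla>\<close> is not, while the label changes by one application of
    \<open>\<nabla>\<close>.\<close>
  define \<phi> :: "('a \<times> nat) ordered_copy \<Rightarrow> ('a \<times> nat) ordered_copy" where
    "\<phi> v = Abs_ordered_copy (case Rep_ordered_copy v of (a, n) \<Rightarrow> (a, Suc n))" for v
  have iter: "(nabla A ^^ n) a \<in> carrier A" if "a \<in> carrier A" for a n
    using that by (induction n) (simp_all add: nabla_closed)
  interpret function_ring_endomorphism A \<delta> \<phi>
  proof unfold_locales
    have "\<delta> (Abs_ordered_copy (a, 0)) = a" if "a \<in> carrier A" for a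
      using that by (simp add: \<delta>_def Abs_ordered_copy_inverse)
    then show "range \<delta> = carrier A"
    proof -
      have "carrier A \<subseteq> range \<delta>"
        using \<open>\<And>a. a \<in> carrier A \<Longrightarrow> \<delta> (Abs_ordered_copy (a, 0)) = a\<close> by (metis rangeI subsetI)
      moreover have "\<delta> v \<in> carrier A" for v
        using iter by (simp add: \<delta>_def split: prod.split)
      ultimately show ?thesis
        by blast
    qed
    show "inj \<phi>"
    proof (rule injI)
      fix v w assume "\<phi> v = \<phi> w"
      then have "Rep_ordered_copy v = Rep_ordered_copy w"
        by (simp add: \<phi>_def Abs_ordered_copy_inject split: prod.splits)
      then show "v = w"
        by (simp only: Rep_ordered_copy_inject)
    qed
    show "\<delta> (\<phi> v) = nabla A (\<delta> v)" for v
      by (auto simp: \<delta>_def \<phi>_def Abs_ordered_copy_inverse nabla_bottom split: prod.split)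
  qed
  have "inj (\<lambda>v. map_prod Inl Inr (Rep_ordered_copy v) :: ('a + nat) \<times> ('a + nat))"
  proof (rule injI)
    fix v w assume "map_prod Inl Inr (Rep_ordered_copy v) = (map_prod Inl Inr (Rep_ordered_copy w)
      :: ('a + nat) \<times> ('a + nat))"
    then have "Rep_ordered_copy v = Rep_ordered_copy w"
      by (simp add: prod_eq_iff)
    then show "v = w"
      by (simp only: Rep_ordered_copy_inject)
  qed
  then have "embeds_in TYPE(('a \<times> nat) ordered_copy) TYPE('a + nat)"
    by (rule embeds_in_inj[OF _ embeds_in_square]) simp
  then have "embeds_in TYPE('a set \<Rightarrow> ('a \<times> nat) ordered_copy mpoly fract) TYPE('a ring_universe)"
    by (intro embeds_in_universe embeds_in_mpoly_fract) simp_all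
  then obtain e :: "('a set \<Rightarrow> ('a \<times> nat) ordered_copy mpoly fract) \<Rightarrow> 'a ring_universe" where "inj e"
    unfolding embeds_in_def by blast
  then have "inj_on e (carrier fring)"
    by (rule inj_on_subset) simp
  from supported_nabla_algebra.representation[OF supported_nabla_algebra_image[OF this] assms(4)]
  show ?thesis .
qed

end
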